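(* Let $G$ be a solvable Lie group, $H$ a uniform subgroup of $G$, and $\mathrm{g}$ a left-invariant pseudo-Riemannian metric on $G$ which is right-invariant under $H$ (that is, the map $G\to G$, $g\mapsto gh$, is an isometry for all $h\in H$). Then $\mathrm{g}$ is bi-invariant.
   Context: A uniform subgroup $H$ of a Lie group $G$ is a closed subgroup such that $G/H$ is compact. A pseudo-Riemannian metric is a smooth symmetric non-degenerate $(0,2)$-tensor field of arbitrary signature. A left-invariant metric on $G$ is bi-invariant if all right multiplications $G\to G$, $h\mapsto hg$, $g\in G$, are isometries.
   Formalization: The solvable Lie group G is additionally assumed connected; without this the claim fails, e.g. for G = R^2 ⋊ Z/4 with rotations by right angles, H = R^2, and the left-invariant metric dx^2 + 2dy^2 at the identity. *)

theory Defs
  imports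
    "HOL-Analysis.Analysis"
    "HOL-Algebra.Left_Coset"
    "HOL-Algebra.Solvable_Groups"
begin

section \<open>Smooth manifolds\<close>

text \<open>
  Manifolds are modelled on a linear subspace \<open>E\<close> of a Euclidean space, so that the dimension is
  \<open>dim E\<close> and dimension 0 is included. In what follows \<open>S\<close> is relatively open in \<open>E\<close>. For
  \<open>x \<in> E\<close>, a Frechet derivative taken \<open>at x within E\<close> is uniquely determined on vectors of
  \<open>E\<close> only, and it is never evaluated on other vectors. If \<open>E = UNIV\<close>, then
  \<open>at x within E\<close> is \<open>at x\<close>.
\<close>

abbreviation deriv_at ::
  "'e::euclidean_space set \<Rightarrow> ('e \<Rightarrow> 'f::real_normed_vector) \<Rightarrow> 'e \<Rightarrow> 'e \<Rightarrow> 'f" where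
  "deriv_at E f x \<equiv> frechet_derivative f (at x within E)"

primrec Ck_on ::
  "nat \<Rightarrow> 'e::euclidean_space set \<Rightarrow> 'e set \<Rightarrow> ('e \<Rightarrow> 'f::real_normed_vector) \<Rightarrow> bool" where
  "Ck_on 0 E S f \<longleftrightarrow> continuous_on S f"
| "Ck_on (Suc k) E S f \<longleftrightarrow>
     (\<forall>x\<in>S. f differentiable (at x within E)) \<and> (\<forall>v\<in>E. Ck_on k E S (\<lambda>x. deriv_at E f x v))"

definition smooth_on ::
  "'e::euclidean_space set \<Rightarrow> 'e set \<Rightarrow> ('e \<Rightarrow> 'f::real_normed_vector) \<Rightarrow> bool" where
  "smooth_on E S f \<longleftrightarrow> (\<forall>k. Ck_on k E S f)"

text \<open>A chart is its domain together with its coordinate map, whose values off the domain are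
  irrelevant.\<close>

type_synonym ('a, 'e) chart = "'a set \<times> ('a \<Rightarrow> 'e)"

record ('a, 'e) manifold =
  mtop :: "'a topology"
  model :: "'e set"
  atlas :: "('a, 'e) chart set"

definition is_chart :: "('a, 'e::euclidean_space) manifold \<Rightarrow> ('a, 'e) chart \<Rightarrow> bool" where
  "is_chart M c \<longleftrightarrow>
     openin (mtop M) (fst c) \<and>
     openin (top_of_set (model M)) (snd c ` fst c) \<and>
     homeomorphic_map (subtopology (mtop M) (fst c)) (top_of_set (snd c ` fst c)) (snd c)"

definition chart_inv :: "('a, 'e) chart \<Rightarrow> 'e \<Rightarrow> 'a" where
  "chart_inv c = inv_into (fst c) (snd c)"

text \<open>The map \<open>f\<close> read in the charts \<open>c\<close> and \<open>d\<close>; it is meaningful on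
  \<open>snd c ` (fst c \<inter> f -` fst d)\<close>.\<close>

definition local_rep ::
  "('a, 'e) chart \<Rightarrow> ('b, 'f) chart \<Rightarrow> ('a \<Rightarrow> 'b) \<Rightarrow> 'e \<Rightarrow> 'f" where
  "local_rep c d f = snd d \<circ> f \<circ> chart_inv c"

definition smooth_manifold :: "('a, 'e::euclidean_space) manifold \<Rightarrow> bool" where
  "smooth_manifold M \<longleftrightarrow>
     subspace (model M) \<and> Hausdorff_space (mtop M) \<and> second_countable (mtop M) \<and>
     (\<forall>c\<in>atlas M. is_chart M c) \<and>
     (\<Union>c\<in>atlas M. fst c) = topspace (mtop M) \<and>
     (\<forall>c\<in>atlas M. \<forall>d\<in>atlas M.
        smooth_on (model M) (snd c ` (fst c \<inter> fst d)) (local_rep c d id))"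

definition smooth_map ::
  "('a, 'e::euclidean_space) manifold \<Rightarrow> ('b, 'f::euclidean_space) manifold \<Rightarrow> ('a \<Rightarrow> 'b) \<Rightarrow> bool" where
  "smooth_map M N f \<longleftrightarrow>
     continuous_map (mtop M) (mtop N) f \<and>
     (\<forall>c\<in>atlas M. \<forall>d\<in>atlas N.
        smooth_on (model M) (snd c ` (fst c \<inter> f -` fst d)) (local_rep c d f))"

definition diffeomorphism ::
  "('a, 'e::euclidean_space) manifold \<Rightarrow> ('b, 'f::euclidean_space) manifold \<Rightarrow> ('a \<Rightarrow> 'b) \<Rightarrow> bool" where
  "diffeomorphism M N f \<longleftrightarrow>
     bij_betw f (topspace (mtop M)) (topspace (mtop N)) \<and>
     smooth_map M N f \<and> smooth_map N M (inv_into (topspace (mtop M)) f)"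

definition prod_manifold ::
  "('a, 'e) manifold \<Rightarrow> ('b, 'f) manifold \<Rightarrow> ('a \<times> 'b, 'e \<times> 'f) manifold" where
  "prod_manifold M N =
     \<lparr>mtop = prod_topology (mtop M) (mtop N),
      model = model M \<times> model N,
      atlas = {(fst c \<times> fst d, map_prod (snd c) (snd d)) | c d. c \<in> atlas M \<and> d \<in> atlas N}\<rparr>"


section \<open>Tangent spaces and pseudo-Riemannian metrics\<close>

definition charts_at :: "('a, 'e) manifold \<Rightarrow> 'a \<Rightarrow> ('a, 'e) chart set" where
  "charts_at M p = {c \<in> atlas M. p \<in> fst c}"

text \<open>A tangent vector at \<open>p\<close> is a family of coordinate vectors, one for each chart at \<open>p\<close>,
  related by the derivatives of the coordinate changes. The value 0 at the remaining indices makes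
  equality of tangent vectors the equality of functions.\<close>

type_synonym ('a, 'e) tangent = "('a, 'e) chart \<Rightarrow> 'e"

definition tangent_space ::
  "('a, 'e::euclidean_space) manifold \<Rightarrow> 'a \<Rightarrow> ('a, 'e) tangent set" where
  "tangent_space M p =
     {v. (\<forall>c\<in>charts_at M p. v c \<in> model M) \<and>
         (\<forall>c\<in>charts_at M p. \<forall>d\<in>charts_at M p.
            v d = deriv_at (model M) (local_rep c d id) (snd c p) (v c)) \<and>
         (\<forall>c. c \<notin> charts_at M p \<longrightarrow> v c = 0)}"

text \<open>The tangent vector at \<open>p\<close> whose coordinate vector in the chart \<open>c\<close> is \<open>x\<close>.\<close>

definition tangent_of_coord ::
  "('a, 'e::euclidean_space) manifold \<Rightarrow> 'a \<Rightarrow> ('a, 'e) chart \<Rightarrow> 'e \<Rightarrow> ('a, 'e) tangent" where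
  "tangent_of_coord M p c x =
     (\<lambda>d. if d \<in> charts_at M p then deriv_at (model M) (local_rep c d id) (snd c p) x else 0)"

text \<open>The differential at \<open>p\<close>. By the chain rule it does not depend on the chosen chart \<open>c\<close>.\<close>

definition tangent_map ::
  "('a, 'e::euclidean_space) manifold \<Rightarrow> ('b, 'f::euclidean_space) manifold \<Rightarrow> ('a \<Rightarrow> 'b) \<Rightarrow> 'a \<Rightarrow>
   ('a, 'e) tangent \<Rightarrow> ('b, 'f) tangent" where
  "tangent_map M N f p v =
     (\<lambda>d. if d \<in> charts_at N (f p)
          then (let c = (SOME c. c \<in> charts_at M p)
                in deriv_at (model M) (local_rep c d f) (snd c p) (v c))
          else 0)"

type_synonym ('a, 'e) tensor02 = "'a \<Rightarrow> ('a, 'e) tangent \<Rightarrow> ('a, 'e) tangent \<Rightarrow> real"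

text \<open>Linearity is required in the first argument only; symmetry gives it in the second. Smoothness
  of the tensor field is smoothness of its components in every chart.\<close>

definition pseudo_riemannian_metric ::
  "('a, 'e::euclidean_space) manifold \<Rightarrow> ('a, 'e) tensor02 \<Rightarrow> bool" where
  "pseudo_riemannian_metric M g \<longleftrightarrow>
     (\<forall>p\<in>topspace (mtop M).
        (\<forall>u\<in>tangent_space M p. \<forall>v\<in>tangent_space M p. \<forall>w\<in>tangent_space M p. \<forall>a b.
           g p (\<lambda>c. a *\<^sub>R u c + b *\<^sub>R v c) w = a * g p u w + b * g p v w) \<and>
        (\<forall>u\<in>tangent_space M p. \<forall>v\<in>tangent_space M p. g p u v = g p v u) \<and>
        (\<forall>u\<in>tangent_space M p. (\<forall>v\<in>tangent_space M p. g p u v = 0) \<longrightarrow> u = (\<lambda>_. 0))) \<and>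
     (\<forall>c\<in>atlas M. \<forall>x\<in>model M. \<forall>y\<in>model M.
        smooth_on (model M) (snd c ` fst c)
          (\<lambda>z. let p = chart_inv c z in g p (tangent_of_coord M p c x) (tangent_of_coord M p c y)))"

definition isometry ::
  "('a, 'e::euclidean_space) manifold \<Rightarrow> ('a, 'e) tensor02 \<Rightarrow> ('a \<Rightarrow> 'a) \<Rightarrow> bool" where
  "isometry M g f \<longleftrightarrow>
     diffeomorphism M M f \<and>
     (\<forall>p\<in>topspace (mtop M). \<forall>u\<in>tangent_space M p. \<forall>v\<in>tangent_space M p.
        g (f p) (tangent_map M M f p u) (tangent_map M M f p v) = g p u v)"


section \<open>Lie groups\<close>

definition lie_group :: "('a, 'm) monoid_scheme \<Rightarrow> ('a, 'e::euclidean_space) manifold \<Rightarrow> bool" where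
  "lie_group G M \<longleftrightarrow>
     group G \<and> smooth_manifold M \<and> topspace (mtop M) = carrier G \<and>
     smooth_map (prod_manifold M M) M (\<lambda>(x, y). x \<otimes>\<^bsub>G\<^esub> y) \<and>
     smooth_map M M (\<lambda>x. inv\<^bsub>G\<^esub> x)"

text \<open>The quotient topology on the set of left cosets \<open>x H\<close>.\<close>

definition coset_space :: "('a, 'm) monoid_scheme \<Rightarrow> 'a topology \<Rightarrow> 'a set \<Rightarrow> 'a set topology" where
  "coset_space G X H =
     topology (\<lambda>U. U \<subseteq> lcosets\<^bsub>G\<^esub> H \<and> openin X {x \<in> topspace X. x <#\<^bsub>G\<^esub> H \<in> U})"

lemma openin_coset_space:
  "openin (coset_space G X H) U \<longleftrightarrow>
     U \<subseteq> lcosets\<^bsub>G\<^esub> H \<and> openin X {x \<in> topspace X. x <#\<^bsub>G\<^esub> H \<in> U}"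
proof -
  have *: "{x \<in> topspace X. x <#\<^bsub>G\<^esub> H \<in> S \<inter> T} =
      {x \<in> topspace X. x <#\<^bsub>G\<^esub> H \<in> S} \<inter> {x \<in> topspace X. x <#\<^bsub>G\<^esub> H \<in> T}" for S T
    by auto
  have **: "{x \<in> topspace X. x <#\<^bsub>G\<^esub> H \<in> \<Union>K} = (\<Union>S\<in>K. {x \<in> topspace X. x <#\<^bsub>G\<^esub> H \<in> S})" for K
    by auto
  have "istopology (\<lambda>U. U \<subseteq> lcosets\<^bsub>G\<^esub> H \<and> openin X {x \<in> topspace X. x <#\<^bsub>G\<^esub> H \<in> U})"
    unfolding istopology_def * ** by blast
  then show ?thesis
    by (simp add: coset_space_def topology_inverse')
qed

definition uniform_subgroup :: "('a, 'm) monoid_scheme \<Rightarrow> 'a topology \<Rightarrow> 'a set \<Rightarrow> bool" where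
  "uniform_subgroup G X H \<longleftrightarrow>
     subgroup H G \<and> closedin X H \<and> compact_space (coset_space G X H)"

definition left_invariant ::
  "('a, 'm) monoid_scheme \<Rightarrow> ('a, 'e::euclidean_space) manifold \<Rightarrow> ('a, 'e) tensor02 \<Rightarrow> bool" where
  "left_invariant G M g \<longleftrightarrow> (\<forall>h\<in>carrier G. isometry M g (\<lambda>x. h \<otimes>\<^bsub>G\<^esub> x))"

definition right_invariant_under ::
  "('a, 'm) monoid_scheme \<Rightarrow> ('a, 'e::euclidean_space) manifold \<Rightarrow> 'a set \<Rightarrow> ('a, 'e) tensor02 \<Rightarrow> bool" where
  "right_invariant_under G M H g \<longleftrightarrow> (\<forall>h\<in>H. isometry M g (\<lambda>x. x \<otimes>\<^bsub>G\<^esub> h))"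

definition bi_invariant ::
  "('a, 'm) monoid_scheme \<Rightarrow> ('a, 'e::euclidean_space) manifold \<Rightarrow> ('a, 'e) tensor02 \<Rightarrow> bool" where
  "bi_invariant G M g \<longleftrightarrow> left_invariant G M g \<and> right_invariant_under G M (carrier G) g"

end

theory Submission
  imports Defs
begin

text \<open>
  The metric corresponds to a symmetric bilinear form \<open>\<beta>\<close> on the Lie algebra, and right translation by \<open>h\<close>
  is an isometry iff \<open>Ad(h\<^sup>-\<^sup>1)\<close> preserves \<open>\<beta>\<close>. Since \<open>G/H\<close> is compact, the orbit of \<open>\<beta>\<close> under \<open>G\<close> is bounded,
  so \<open>G\<close> acts boundedly on the finite-dimensional space of forms with bounded orbit. A bounded linear
  action of a connected solvable group is commutative: if \<open>a\<close> commutes with its commutator with \<open>b\<close>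
  and \<open>b\<close> is close to the identity, then all powers of that commutator are close to the identity, so it is trivial.
  Hence \<open>Ad(x y x\<^sup>-\<^sup>1)\<close> and \<open>Ad(y)\<close> move \<open>\<beta>\<close> in the same way, and differentiation shows that
  \<open>ad [x,y]\<close> is skew for \<open>\<beta>\<close>.

  For arbitrary \<open>x\<close> let \<open>L\<close> be the action of \<open>ad x\<close> on forms. Skewness of brackets and
  the Jacobi identity give \<open>L\<^sup>3 \<beta> = 0\<close>, so \<open>\<beta>\<close> moves polynomially along the one-parameter group of \<open>x\<close>;
  being bounded, it does not move, so \<open>L \<beta> = 0\<close>. Therefore the stabilizer of \<open>\<beta>\<close> is open in the connected group \<open>G\<close>.
\<close>

section \<open>Bounded representations of connected solvable groups\<close>

text \<open>For a definite metric the operators preserving \<beta> form a compact group from the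
  start. In arbitrary signature the only source of boundedness is the compactness of G/H, and it
  bounds the orbit of \<beta>, not Ad itself. This is why the argument lives on the space of forms
  and, inside it, on the vectors with bounded orbit. No exponential map is constructed. A chart
  \<theta> at the identity supplies curves \<theta>(s x) that have the right tangent at s = 0 but
  are not one-parameter groups; the k-th power of \<theta>((t/k) x) for large k replaces the value
  at time t. For the same reason, infinitesimal invariance is carried to a neighbourhood of the
  identity by differentiating along right translates of the chart. The model space of the manifold
  is a subspace of a Euclidean space. Operators and forms are extended to the ambient space by a
  fixed projection, so that one type of bounded operators serves throughout.\<close>

lemma blinfun_compose_assoc: "(a o\<^sub>L b) o\<^sub>L c = a o\<^sub>L (b o\<^sub>L c)"
  by (rule blinfun_eqI) simp

lemma blinfun_compose_id [simp]: "a o\<^sub>L id_blinfun = a" "id_blinfun o\<^sub>L a = a"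
  by (rule blinfun_eqI; simp)+

lemmas blinfun_compose_diff =
  bounded_bilinear.diff_left[OF bounded_bilinear_blinfun_compose]
  bounded_bilinear.diff_right[OF bounded_bilinear_blinfun_compose]

lemma (in group) commutator_mult:
  assumes "a \<in> carrier G" "b \<in> carrier G"
  shows "(a \<otimes> b \<otimes> inv a \<otimes> inv b) \<otimes> (b \<otimes> a) = a \<otimes> b"
proof -
  have "inv b \<otimes> (b \<otimes> a) = a"
    using assms by (simp add: m_assoc[symmetric])
  then show ?thesis
    using assms by (simp add: m_assoc)
qed

locale bounded_rep = group G for G (structure) +
  fixes \<Phi> :: "'a \<Rightarrow> 'w::real_normed_vector \<Rightarrow>\<^sub>L 'w" and R :: real
  assumes rep_one: "\<Phi> \<one> = id_blinfun"
    and rep_mult: "\<lbrakk>x \<in> carrier G; y \<in> carrier G\<rbrakk> \<Longrightarrow> \<Phi> (x \<otimes> y) = \<Phi> x o\<^sub>L \<Phi> y"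
    and rep_bounded: "x \<in> carrier G \<Longrightarrow> norm (\<Phi> x) \<le> R"
begin

lemma bound_nonneg: "0 \<le> R"
  using rep_bounded[OF one_closed] norm_ge_zero order_trans by blast

text \<open>If all \<open>c\<^sup>n\<close> lie within a distance \<open>r < 1\<close> of the identity, then \<open>2 (c - 1) = (c\<^sup>2 - 1) - (c - 1)\<^sup>2\<close>
  shows that the smallest such \<open>r\<close> satisfies \<open>2 r \<le> r + r\<^sup>2\<close>, so that it is 0.\<close>

lemma no_small_subgroups:
  assumes c: "c \<in> carrier G" and r: "r < 1"
    and small: "\<And>n::nat. norm (\<Phi> (c [^] n) - id_blinfun) \<le> r"
  shows "\<Phi> c = id_blinfun"
proof -
  define f where "f n = norm (\<Phi> (c [^] n) - id_blinfun)" for n :: nat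
  define s where "s = (SUP n. f n)"
  have bdd: "bdd_above (range f)"
    using small by (auto simp: f_def intro!: bdd_aboveI2)
  have f_le: "f n \<le> s" for n
    unfolding s_def by (rule cSUP_upper[OF _ bdd]) simp
  have s0: "0 \<le> s"
    using f_le[of 0] norm_ge_zero[of "\<Phi> (c [^] (0::nat)) - id_blinfun"] unfolding f_def by linarith
  have s1: "s \<le> r"
    unfolding s_def using small by (intro cSUP_least) (auto simp: f_def)
  have step: "2 * f n \<le> s + s * s" for n
  proof -
    let ?x = "\<Phi> (c [^] n)"
    have sq: "\<Phi> (c [^] (n + n)) = ?x o\<^sub>L ?x"
      using c by (simp add: nat_pow_mult[symmetric] rep_mult)
    have "2 *\<^sub>R (?x - id_blinfun) =
        (\<Phi> (c [^] (n + n)) - id_blinfun) - ((?x - id_blinfun) o\<^sub>L (?x - id_blinfun))"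
    proof -
      have "(?x - id_blinfun) o\<^sub>L (?x - id_blinfun) = ((?x o\<^sub>L ?x) - ?x) - (?x - id_blinfun)"
        by (simp only: blinfun_compose_diff blinfun_compose_id)
      then show ?thesis
        by (simp add: sq scaleR_2)
    qed
    then have "2 * f n = norm ((\<Phi> (c [^] (n + n)) - id_blinfun) - ((?x - id_blinfun) o\<^sub>L (?x - id_blinfun)))"
      unfolding f_def by (metis norm_scaleR abs_numeral)
    also have "\<dots> \<le> f (n + n) + norm ((?x - id_blinfun) o\<^sub>L (?x - id_blinfun))"
      unfolding f_def by (rule norm_triangle_ineq4)
    also have "\<dots> \<le> s + f n * f n"
      unfolding f_def by (intro add_mono norm_blinfun_compose) (use f_le[of "n + n"] in \<open>simp add: f_def\<close>)
    also have "\<dots> \<le> s + s * s"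
      using f_le[of n] by (intro add_left_mono mult_mono) (auto simp: f_def s0)
    finally show ?thesis .
  qed
  have "s \<le> (s + s * s) / 2"
    using step unfolding s_def by (intro cSUP_least) (auto simp: field_simps)
  then have "s * (1 - s) \<le> 0"
    by (simp add: field_simps)
  then have "s \<le> 0"
    using s1 r by (simp add: mult_le_0_iff)
  then have "f 1 = 0"
    using f_le[of 1] by (smt (verit) f_def norm_ge_zero)
  then show ?thesis
    using c by (simp add: f_def)
qed

lemma rep_inv:
  assumes "x \<in> carrier G"
  shows "\<Phi> x o\<^sub>L \<Phi> (inv x) = id_blinfun" "\<Phi> (inv x) o\<^sub>L \<Phi> x = id_blinfun"
  using assms by (simp_all add: rep_mult[symmetric] rep_one)

lemma commute_if_commutator:
  assumes a: "a \<in> carrier G" and b: "b \<in> carrier G"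
    and ab: "\<Phi> (a \<otimes> b \<otimes> inv a \<otimes> inv b) = id_blinfun"
  shows "\<Phi> a o\<^sub>L \<Phi> b = \<Phi> b o\<^sub>L \<Phi> a"
proof -
  have "a \<otimes> b = (a \<otimes> b \<otimes> inv a \<otimes> inv b) \<otimes> (b \<otimes> a)"
    using a b by (simp add: commutator_mult)
  then have "\<Phi> (a \<otimes> b) = \<Phi> (a \<otimes> b \<otimes> inv a \<otimes> inv b) o\<^sub>L \<Phi> (b \<otimes> a)"
    using a b by (metis rep_mult m_closed inv_closed)
  then show ?thesis
    using ab a b by (simp add: rep_mult)
qed

text \<open>Write c for the commutator. Under \<Phi>, a and c commute, so a b = c b a iterates to
  a^n b = c^n b a^n. Hence c^n - 1 = (a^n (b - 1) - (b - 1) a^n) (b a^n)^-1, whose norm is at most 2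
  R R times that of b - 1, uniformly in n, and \<open>no_small_subgroups\<close> applies to
  c.\<close>

lemma commute_near_one:
  assumes a: "a \<in> carrier G" and b: "b \<in> carrier G"
    and ac: "\<Phi> a o\<^sub>L \<Phi> (a \<otimes> b \<otimes> inv a \<otimes> inv b) = \<Phi> (a \<otimes> b \<otimes> inv a \<otimes> inv b) o\<^sub>L \<Phi> a"
    and near: "2 * R * R * norm (\<Phi> b - id_blinfun) < 1"
  shows "\<Phi> a o\<^sub>L \<Phi> b = \<Phi> b o\<^sub>L \<Phi> a"
proof -
  define c where "c = a \<otimes> b \<otimes> inv a \<otimes> inv b"
  have c: "c \<in> carrier G"
    using a b by (simp add: c_def)
  have ab: "a \<otimes> b = c \<otimes> (b \<otimes> a)"
    using a b by (simp add: c_def commutator_mult)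
  have aab: "\<Phi> a o\<^sub>L \<Phi> b = \<Phi> c o\<^sub>L (\<Phi> b o\<^sub>L \<Phi> a)"
    using ab a b c by (metis rep_mult m_closed blinfun_compose_assoc)
  have acn: "\<Phi> a o\<^sub>L \<Phi> (c [^] n) = \<Phi> (c [^] n) o\<^sub>L \<Phi> a" for n :: nat
  proof (induction n)
    case (Suc n)
    then show ?case
      using c ac[folded c_def] by (simp add: rep_mult) (metis blinfun_compose_assoc)
  qed (simp add: rep_one)
  have key: "\<Phi> (a [^] n) o\<^sub>L \<Phi> b = \<Phi> (c [^] n) o\<^sub>L (\<Phi> b o\<^sub>L \<Phi> (a [^] n))" for n :: nat
  proof (induction n)
    case (Suc n)
    have an: "a [^] Suc n = a \<otimes> a [^] n" and cn: "c [^] Suc n = c [^] n \<otimes> c"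
      using a by (simp_all add: nat_pow_comm[of a n 1, simplified])
    have "\<Phi> (a [^] Suc n) o\<^sub>L \<Phi> b = \<Phi> a o\<^sub>L (\<Phi> (a [^] n) o\<^sub>L \<Phi> b)"
      unfolding an using a by (simp add: rep_mult blinfun_compose_assoc)
    also have "\<dots> = (\<Phi> a o\<^sub>L \<Phi> (c [^] n)) o\<^sub>L (\<Phi> b o\<^sub>L \<Phi> (a [^] n))"
      by (simp add: Suc.IH blinfun_compose_assoc)
    also have "\<dots> = \<Phi> (c [^] n) o\<^sub>L ((\<Phi> a o\<^sub>L \<Phi> b) o\<^sub>L \<Phi> (a [^] n))"
      by (simp add: acn blinfun_compose_assoc)
    also have "\<dots> = \<Phi> (c [^] Suc n) o\<^sub>L (\<Phi> b o\<^sub>L \<Phi> (a [^] Suc n))"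
      unfolding aab an cn using a c by (simp add: rep_mult blinfun_compose_assoc)
    finally show ?case .
  qed (simp add: rep_one)
  have "norm (\<Phi> (c [^] n) - id_blinfun) \<le> 2 * R * R * norm (\<Phi> b - id_blinfun)" for n :: nat
  proof -
    let ?A = "\<Phi> (a [^] n)" and ?B = "\<Phi> b" and ?Q = "\<Phi> (inv (b \<otimes> a [^] n))"
    have Q: "(?B o\<^sub>L ?A) o\<^sub>L ?Q = id_blinfun"
      using a b rep_inv(1)[of "b \<otimes> a [^] n"] by (simp add: rep_mult)
    have "\<Phi> (c [^] n) - id_blinfun = ((\<Phi> (c [^] n) o\<^sub>L (?B o\<^sub>L ?A)) - (?B o\<^sub>L ?A)) o\<^sub>L ?Q"
      using Q by (simp add: blinfun_compose_diff blinfun_compose_assoc)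
    also have "\<dots> = ((?A o\<^sub>L (?B - id_blinfun)) - ((?B - id_blinfun) o\<^sub>L ?A)) o\<^sub>L ?Q"
      unfolding key[symmetric] by (simp add: blinfun_compose_diff)
    also have "norm \<dots> \<le> norm ((?A o\<^sub>L (?B - id_blinfun)) - ((?B - id_blinfun) o\<^sub>L ?A)) * norm ?Q"
      by (rule norm_blinfun_compose)
    also have "\<dots> \<le> (norm (?A o\<^sub>L (?B - id_blinfun)) + norm ((?B - id_blinfun) o\<^sub>L ?A)) * norm ?Q"
      by (intro mult_right_mono norm_triangle_ineq4) simp
    also have "\<dots> \<le> (norm ?A * norm (?B - id_blinfun) + norm (?B - id_blinfun) * norm ?A) * norm ?Q"
      by (intro mult_right_mono add_mono norm_blinfun_compose) simp
    also have "\<dots> \<le> (R * norm (?B - id_blinfun) + norm (?B - id_blinfun) * R) * R"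
      using a b bound_nonneg by (intro mult_mono add_mono rep_bounded) auto
    finally show ?thesis
      by (simp add: algebra_simps)
  qed
  from no_small_subgroups[OF c near this] show ?thesis
    using commute_if_commutator[OF a b] by (simp add: c_def)
qed

text \<open>In the image of \<open>S\<close>, the operators commuting with \<Phi> a form a clopen
  subset. For openness, a point b1 near such a b0 is b0 times b0^-1 b1, and the second factor is
  close enough to the identity for \<open>commute_near_one\<close>. The radius is the same for all
  b0, because inverses are bounded by \<open>R\<close> too.\<close>

lemma commute_connected:
  assumes S: "subgroup S G" and conn: "connected (\<Phi> ` S)" and a: "a \<in> carrier G"
    and ac: "\<And>b. b \<in> S \<Longrightarrow>
      \<Phi> a o\<^sub>L \<Phi> (a \<otimes> b \<otimes> inv a \<otimes> inv b) = \<Phi> (a \<otimes> b \<otimes> inv a \<otimes> inv b) o\<^sub>L \<Phi> a"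
    and b: "b \<in> S"
  shows "\<Phi> a o\<^sub>L \<Phi> b = \<Phi> b o\<^sub>L \<Phi> a"
proof -
  define T where "T = {y \<in> \<Phi> ` S. \<Phi> a o\<^sub>L y = y o\<^sub>L \<Phi> a}"
  have SG: "x \<in> S \<Longrightarrow> x \<in> carrier G" for x
    using S subgroup.mem_carrier by metis
  \<comment> \<open>With this value b0^-1 b1 acts within R \<epsilon> of the identity and 2 R R (R
    \<epsilon>) < 1. The summand 1 keeps the denominator positive.\<close>
  define \<epsilon> where "\<epsilon> = 1 / (2 * R * R * R + 1)"
  have R0: "2 * R * R * R + 1 > 0"
    using bound_nonneg by (simp add: add_nonneg_pos)
  have \<epsilon>: "\<epsilon> > 0"
    using R0 by (simp add: \<epsilon>_def)
  have "closedin (top_of_set (\<Phi> ` S)) T"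
  proof -
    have "closed {y. \<Phi> a o\<^sub>L y = y o\<^sub>L \<Phi> a}"
      by (intro closed_Collect_eq continuous_intros
          bounded_bilinear.continuous_on[OF bounded_bilinear_blinfun_compose])
    moreover have "T = \<Phi> ` S \<inter> {y. \<Phi> a o\<^sub>L y = y o\<^sub>L \<Phi> a}"
      by (auto simp: T_def)
    ultimately show ?thesis
      by (simp add: closedin_closed_Int)
  qed
  moreover have "openin (top_of_set (\<Phi> ` S)) T"
  proof (subst openin_euclidean_subtopology_iff, intro conjI ballI)
    fix y assume "y \<in> T"
    then obtain b0 where b0: "b0 \<in> S" and y: "y = \<Phi> b0" and com0: "\<Phi> a o\<^sub>L \<Phi> b0 = \<Phi> b0 o\<^sub>L \<Phi> a"
      by (auto simp: T_def)
    have "y' \<in> T" if y': "y' \<in> \<Phi> ` S" and d: "dist y' y < \<epsilon>" for y'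
    proof -
      obtain b1 where b1: "b1 \<in> S" and y'_eq: "y' = \<Phi> b1"
        using y' by auto
      let ?b = "inv b0 \<otimes> b1"
      have bS: "?b \<in> S"
        using S b0 b1 by (simp add: subgroup.m_closed subgroup.m_inv_closed)
      have "\<Phi> ?b - id_blinfun = \<Phi> (inv b0) o\<^sub>L (\<Phi> b1 - \<Phi> b0)"
        using SG b0 b1 by (simp add: rep_mult rep_inv blinfun_compose_diff)
      then have "norm (\<Phi> ?b - id_blinfun) \<le> norm (\<Phi> (inv b0)) * norm (\<Phi> b1 - \<Phi> b0)"
        by (simp add: norm_blinfun_compose)
      also have "\<dots> \<le> R * \<epsilon>"
        using d SG b0 bound_nonneg unfolding y y'_eq dist_norm by (intro mult_mono rep_bounded) auto
      finally have "2 * R * R * norm (\<Phi> ?b - id_blinfun) \<le> 2 * R * R * (R * \<epsilon>)"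
        using bound_nonneg by (intro mult_left_mono) auto
      also have "\<dots> < 1"
        using R0 by (simp add: \<epsilon>_def field_simps)
      finally have "\<Phi> a o\<^sub>L \<Phi> ?b = \<Phi> ?b o\<^sub>L \<Phi> a"
        by (rule commute_near_one[OF a SG[OF bS] ac[OF bS]])
      moreover have "\<Phi> b1 = \<Phi> b0 o\<^sub>L \<Phi> ?b"
        using SG b0 b1 by (simp add: rep_mult[symmetric] m_assoc[symmetric])
      ultimately have "\<Phi> a o\<^sub>L \<Phi> b1 = \<Phi> b1 o\<^sub>L \<Phi> a"
        using com0 by (metis blinfun_compose_assoc)
      then show ?thesis
        using b1 by (auto simp: T_def y'_eq)
    qed
    then show "\<exists>e>0. \<forall>x'\<in>\<Phi> ` S. dist x' y < e \<longrightarrow> x' \<in> T"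
      using \<epsilon> by blast
  qed (auto simp: T_def)
  moreover have "id_blinfun \<in> T"
    using S rep_one by (force simp: T_def dest: subgroup.one_closed)
  ultimately have "T = \<Phi> ` S"
    using conn unfolding connected_clopen by blast
  then show ?thesis
    using b by (auto simp: T_def)
qed

end

section \<open>Connectedness of the derived series of a topological group\<close>

locale topological_group = group G for G (structure) +
  fixes X :: "'a topology"
  assumes space: "topspace X = carrier G"
    and mult_cont: "continuous_map (prod_topology X X) X (\<lambda>(x, y). x \<otimes> y)"
    and inv_cont: "continuous_map X X (\<lambda>x. inv x)"
begin

lemma continuous_map_mult:
  assumes "continuous_map Y X f" "continuous_map Y X h"
  shows "continuous_map Y X (\<lambda>t. f t \<otimes> h t)"
  using continuous_map_compose[OF continuous_map_pairedI[OF assms] mult_cont] by (simp add: o_def)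

lemma continuous_map_inv:
  assumes "continuous_map Y X f"
  shows "continuous_map Y X (\<lambda>t. inv (f t))"
  using continuous_map_compose[OF assms inv_cont] by (simp add: o_def)

lemma connectedin_mult:
  assumes "connectedin X A" "connectedin X B"
  shows "connectedin X ((\<lambda>(x, y). x \<otimes> y) ` (A \<times> B))"
proof -
  have "connectedin (prod_topology X X) (A \<times> B)"
    using assms by (simp add: connectedin_Times)
  from connectedin_continuous_map_image[OF mult_cont this] show ?thesis .
qed

text \<open>The products of at most \<open>n\<close> commutators form a connected set containing the identity.\<close>

lemma connectedin_derived:
  assumes S: "subgroup S G" and conn: "connectedin X S"
  shows "connectedin X (derived G S)"
proof -
  define C where "C = derived_set G S"
  have SG: "x \<in> S \<Longrightarrow> x \<in> carrier G" for x
    using S subgroup.mem_carrier by metis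
  have one: "\<one> \<in> S"
    using S by (rule subgroup.one_closed)
  have C_conn: "connectedin X C"
  proof -
    let ?f = "\<lambda>p. fst p \<otimes> snd p \<otimes> inv (fst p) \<otimes> inv (snd p)"
    have "continuous_map (prod_topology X X) X ?f"
      by (intro continuous_map_mult continuous_map_inv continuous_map_fst continuous_map_snd)
    moreover have "connectedin (prod_topology X X) (S \<times> S)"
      using conn by (simp add: connectedin_Times)
    ultimately have "connectedin X (?f ` (S \<times> S))"
      by (rule connectedin_continuous_map_image)
    moreover have "?f ` (S \<times> S) = C"
      unfolding C_def by force
    ultimately show ?thesis
      by simp
  qed
  have C_one: "\<one> \<in> C"
    unfolding C_def using one by force
  \<comment> \<open>Inversion exchanges the two entries of a commutator, so products of commutators
    already exhaust the generated subgroup.\<close>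
  have C_inv: "inv x \<in> C" if x: "x \<in> C" for x
  proof -
    obtain a b where ab: "a \<in> S" "b \<in> S" and x: "x = a \<otimes> b \<otimes> inv a \<otimes> inv b"
      using x unfolding C_def by blast
    have "inv x = b \<otimes> a \<otimes> inv b \<otimes> inv a"
      using ab SG by (simp add: x inv_mult_group m_assoc)
    then show ?thesis
      unfolding C_def using ab by blast
  qed
  define P where "P n = ((\<lambda>A. (\<lambda>(x, y). x \<otimes> y) ` (A \<times> C)) ^^ n) {\<one>}" for n :: nat
  have P_Suc: "P (Suc n) = (\<lambda>(x, y). x \<otimes> y) ` (P n \<times> C)" for n
    by (simp add: P_def)
  have CG: "C \<subseteq> carrier G"
    unfolding C_def using SG by auto
  have PG: "P n \<subseteq> carrier G" for n
  proof (induction n)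
    case (Suc n)
    then show ?case
      unfolding P_Suc using CG by fastforce
  qed (simp add: P_def)
  have P_one: "\<one> \<in> P n" for n
  proof (induction n)
    case (Suc n)
    have "(\<lambda>(x, y). x \<otimes> y) (\<one>, \<one>) \<in> P (Suc n)"
      unfolding P_Suc by (intro imageI SigmaI Suc C_one)
    then show ?case
      by simp
  qed (simp add: P_def)
  have P_conn: "connectedin X (P n)" for n
  proof (induction n)
    case (Suc n)
    then show ?case
      unfolding P_Suc by (intro connectedin_mult C_conn)
  qed (simp add: P_def space)
  have P_add: "x \<otimes> y \<in> P (m + n)" if "x \<in> P m" "y \<in> P n" for x y m n
    using that(2)
  proof (induction n arbitrary: y)
    case 0
    then show ?case
      using that(1) subsetD[OF PG that(1)] by (simp add: P_def)
  next
    case (Suc n)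
    then obtain u c where uc: "u \<in> P n" "c \<in> C" and y: "y = u \<otimes> c"
      by (auto simp: P_Suc)
    have "(\<lambda>(x, y). x \<otimes> y) (x \<otimes> u, c) \<in> P (Suc (m + n))"
      unfolding P_Suc using Suc.IH[OF uc(1)] uc(2) by (intro imageI SigmaI)
    moreover have "x \<in> carrier G" "u \<in> carrier G" "c \<in> carrier G"
      using that(1) uc PG CG by blast+
    ultimately show ?case
      by (simp add: y m_assoc)
  qed
  have P1: "C \<subseteq> P 1"
    using CG by (force simp: P_def)
  have "derived G S = (\<Union>n. P n)"
  proof (intro equalityI subsetI)
    fix x assume "x \<in> derived G S"
    then have "x \<in> generate G C"
      by (simp add: derived_def C_def)
    then show "x \<in> (\<Union>n. P n)"
    proof induction
      case one
      then show ?case using P_one by blast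
    next
      case (incl h)
      then show ?case using P1 by blast
    next
      case (inv h)
      then show ?case using C_inv P1 by blast
    next
      case (eng h1 h2)
      then show ?case using P_add by blast
    qed
  next
    fix x assume "x \<in> (\<Union>n. P n)"
    then obtain n where "x \<in> P n"
      by blast
    then have "x \<in> generate G C"
    proof (induction n arbitrary: x)
      case 0
      then show ?case
        by (simp add: P_def generate.one)
    next
      case (Suc n)
      then obtain u c where "u \<in> P n" "c \<in> C" "x = u \<otimes> c"
        by (auto simp: P_Suc)
      then show ?case
        using Suc.IH[of u] by (metis generate.eng generate.incl)
    qed
    then show "x \<in> derived G S"
      by (simp add: derived_def C_def)
  qed
  moreover have "connectedin X (\<Union>n. P n)"
    using P_conn P_one by (intro connectedin_Union) (auto, blast)
  ultimately show ?thesis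
    by simp
qed

lemma connectedin_exp_of_derived:
  assumes "connected_space X"
  shows "connectedin X ((derived G ^^ n) (carrier G))"
proof (induction n)
  case 0
  then show ?case
    using assms by (simp add: space[symmetric] connectedin_topspace)
next
  case (Suc n)
  then show ?case
    using connectedin_derived[OF exp_of_derived_is_subgroup[OF subgroup_self]] by simp
qed

end

locale continuous_bounded_rep = topological_group G X + bounded_rep G \<Phi> R
  for G :: "('a, 'm) monoid_scheme" (structure) and X :: "'a topology"
    and \<Phi> :: "'a \<Rightarrow> 'w::real_normed_vector \<Rightarrow>\<^sub>L 'w" and R :: real +
  assumes rep_cont: "continuous_map X euclidean \<Phi>"
begin

text \<open>Triviality of \<Phi> climbs the derived series. If \<open>D (n + 2)\<close> acts
  trivially, then \<open>D (n + 1)\<close> acts commutatively. An element of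
  \<open>D (n + 1)\<close> then commutes with its commutators with \<open>D n\<close>, which lie in
  \<open>D (n + 1)\<close>, and hence with \<open>D n\<close> by \<open>commute_connected\<close>.
  Now an element of \<open>D n\<close> also commutes with its commutators with \<open>D n\<close>,
  so \<open>D n\<close> acts commutatively and \<open>D (n + 1)\<close> trivially.\<close>

theorem rep_commute:
  assumes conn: "connected_space X" and solv: "solvable G"
    and x: "x \<in> carrier G" and y: "y \<in> carrier G"
  shows "\<Phi> x o\<^sub>L \<Phi> y = \<Phi> y o\<^sub>L \<Phi> x"
proof -
  define D where "D n = (derived G ^^ n) (carrier G)" for n
  have D_sub: "subgroup (D n) G" for n
    unfolding D_def by (rule exp_of_derived_is_subgroup[OF subgroup_self])
  have DG: "z \<in> D n \<Longrightarrow> z \<in> carrier G" for z n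
    using D_sub subgroup.mem_carrier by metis
  have D_conn: "connected (\<Phi> ` D n)" for n
    using connectedin_continuous_map_image[OF rep_cont connectedin_exp_of_derived[OF conn]]
    unfolding D_def by (simp add: connectedin_iff_connected)
  have D_Suc: "a \<otimes> b \<otimes> inv a \<otimes> inv b \<in> D (Suc n)" if "a \<in> D n" "b \<in> D n" for a b n
    using that by (auto simp: D_def derived_def intro!: generate.incl)
  have D_mono: "D (Suc n) \<subseteq> D n" for n
    using derived_incl[OF order_refl D_sub[of n]] by (simp add: D_def)
  have trivial_Suc: "\<Phi> z = id_blinfun"
    if com: "\<And>a b. a \<in> D n \<Longrightarrow> b \<in> D n \<Longrightarrow> \<Phi> a o\<^sub>L \<Phi> b = \<Phi> b o\<^sub>L \<Phi> a" and z: "z \<in> D (Suc n)" for n z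
  proof -
    have "z \<in> generate G (derived_set G (D n))"
      using z by (simp add: D_def derived_def)
    moreover have *: "\<Phi> h = id_blinfun" if h: "h \<in> derived_set G (D n)" for h
    proof -
      obtain a b where ab: "a \<in> D n" "b \<in> D n" and h_eq: "h = a \<otimes> b \<otimes> inv a \<otimes> inv b"
        using h by blast
      then have "\<Phi> h = (\<Phi> b o\<^sub>L \<Phi> a) o\<^sub>L \<Phi> (inv a) o\<^sub>L \<Phi> (inv b)"
        using com[OF ab] DG by (simp add: rep_mult)
      also have "\<dots> = \<Phi> b o\<^sub>L (\<Phi> a o\<^sub>L \<Phi> (inv a)) o\<^sub>L \<Phi> (inv b)"
        by (simp add: blinfun_compose_assoc)
      finally show ?thesis
        using ab DG by (simp add: rep_inv)
    qed
    ultimately show ?thesis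
    proof induction
      case one
      then show ?case by (simp add: rep_one)
    next
      case (incl h)
      then show ?case by blast
    next
      case (inv h)
      then have "h \<in> carrier G" "\<Phi> h = id_blinfun"
        using DG by auto
      then show ?case
        using rep_inv(1)[of h] by simp
    next
      case (eng h1 h2)
      have "derived_set G (D n) \<subseteq> carrier G"
        using DG by auto
      then have "h1 \<in> carrier G" "h2 \<in> carrier G"
        using eng.hyps generate_in_carrier by blast+
      then show ?case
        using eng.IH * by (simp add: rep_mult)
    qed
  qed
  have com_Suc: "\<Phi> a o\<^sub>L \<Phi> b = \<Phi> b o\<^sub>L \<Phi> a"
    if triv: "\<And>z. z \<in> D (Suc (Suc n)) \<Longrightarrow> \<Phi> z = id_blinfun" and a: "a \<in> D n" and b: "b \<in> D n" for n a b
  proof -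
    have ab1: "\<Phi> u o\<^sub>L \<Phi> v = \<Phi> v o\<^sub>L \<Phi> u" if "u \<in> D (Suc n)" "v \<in> D (Suc n)" for u v
      using triv[OF D_Suc[OF that]] DG[OF that(1)] DG[OF that(2)] by (intro commute_if_commutator)
    have ab2: "\<Phi> u o\<^sub>L \<Phi> v = \<Phi> v o\<^sub>L \<Phi> u" if u: "u \<in> D (Suc n)" and v: "v \<in> D n" for u v
    proof (rule commute_connected[OF D_sub D_conn _ _ v])
      fix w assume "w \<in> D n"
      then have "u \<otimes> w \<otimes> inv u \<otimes> inv w \<in> D (Suc n)"
        using u D_mono by (intro D_Suc) auto
      then show "\<Phi> u o\<^sub>L \<Phi> (u \<otimes> w \<otimes> inv u \<otimes> inv w) = \<Phi> (u \<otimes> w \<otimes> inv u \<otimes> inv w) o\<^sub>L \<Phi> u"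
        using u by (intro ab1)
    qed (rule DG[OF u])
    show ?thesis
    proof (rule commute_connected[OF D_sub D_conn _ _ b])
      fix w assume "w \<in> D n"
      then show "\<Phi> a o\<^sub>L \<Phi> (a \<otimes> w \<otimes> inv a \<otimes> inv w) = \<Phi> (a \<otimes> w \<otimes> inv a \<otimes> inv w) o\<^sub>L \<Phi> a"
        using a by (intro ab2[symmetric] D_Suc)
    qed (rule DG[OF a])
  qed
  obtain m where "D m = {\<one>}"
    using solv solvable_iff_trivial_derived_seq by (auto simp: D_def)
  \<comment> \<open>The index is raised by one so that the downward induction, which ends at
    \<open>D (Suc 0)\<close>, also covers m = 0.\<close>
  then have "\<And>z. z \<in> D (Suc m) \<Longrightarrow> \<Phi> z = id_blinfun"
    using D_mono[of m] rep_one by auto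
  then have "\<And>z. z \<in> D (Suc 0) \<Longrightarrow> \<Phi> z = id_blinfun"
  proof (induction m)
    case (Suc m)
    have "\<Phi> w = id_blinfun" if w: "w \<in> D (Suc m)" for w
      by (rule trivial_Suc[OF _ w]) (rule com_Suc[OF Suc.prems(2)])
    from Suc.IH[OF Suc.prems(1) this] show ?case .
  qed
  then have "\<And>z. z \<in> D (Suc (Suc 0)) \<Longrightarrow> \<Phi> z = id_blinfun"
    using D_mono by blast
  moreover have "x \<in> D 0" "y \<in> D 0"
    using x y by (simp_all add: D_def)
  ultimately show ?thesis
    by (rule com_Suc)
qed

end

text \<open>A map defined on a subspace is handled by composing it with such a projection, which
  keeps it within the bounded operators of the ambient space. This serves for the bounded part of a
  representation as well as for the model space of a manifold.\<close>

lemma subspace_projection: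
  fixes S :: "'w::euclidean_space set"
  assumes "subspace S"
  obtains P :: "'w \<Rightarrow>\<^sub>L 'w" where "\<And>x. P x \<in> S" "\<And>x. x \<in> S \<Longrightarrow> P x = x"
proof -
  obtain p where p: "linear p" "range p \<subseteq> S" "\<forall>x\<in>S. p (id x) = x"
    using linear_exists_left_inverse_on[OF linear_id assms] by (auto simp: o_def)
  then have "bounded_linear p"
    by (simp add: linear_conv_bounded_linear)
  then show ?thesis
    using p by (intro that[of "Blinfun p"]) (auto simp: bounded_linear_Blinfun_apply)
qed

lemma linear_blinfun_apply: "linear (blinfun_apply A)"
  by (rule bounded_linear.linear[OF blinfun.bounded_linear_right])

text \<open>Powers of \<open>T (t / k)\<close> approximate \<open>w + t L w\<close> when \<open>L (L w) = 0\<close>, so boundedness of the powers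
  forces this affine function of \<open>t\<close> to be constant.\<close>

lemma derivative_zero_if_powers_bounded:
  fixes T :: "real \<Rightarrow> 'w::real_normed_vector \<Rightarrow>\<^sub>L 'w"
  assumes powers: "\<And>s n x. norm ((blinfun_apply (T s) ^^ n) x) \<le> R * norm x"
    and deriv: "((\<lambda>s. (T s - id_blinfun) /\<^sub>R s) \<longlongrightarrow> L) (at_right 0)"
    and LL: "L (L w) = 0"
  shows "L w = 0"
proof -
  have R: "0 \<le> R * norm x" for x :: 'w
    using powers[where n = 0 and x = x] norm_ge_zero order_trans by (metis funpow_0)
  have bound: "t * norm (L w) \<le> R * norm w + norm w + 1" if t: "t > 0" for t
  proof -
    define K where "K = norm w + t * norm (L w)"
    have K: "K \<ge> 0"
      using t by (simp add: K_def)
    \<comment> \<open>If the vector space is zero, \<open>R\<close> could be negative; the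
      truncation makes it a nonnegative factor.\<close>
    define R' where "R' = max R 0"
    have R': "R' \<ge> 0" and powers': "norm ((blinfun_apply (T s) ^^ n) x) \<le> R' * norm x" for s n x
      using order_trans[OF powers mult_right_mono[of R R' "norm x"]] by (auto simp: R'_def)
    \<comment> \<open>The k steps of length s = t / k accumulate an error of at most k R'
      (\<epsilon> s K) = \<epsilon> R' t K, which this value keeps below 1.\<close>
    define \<epsilon> where "\<epsilon> = 1 / (R' * t * K + 1)"
    have den: "R' * t * K + 1 > 0"
      using R' K t by (intro add_nonneg_pos mult_nonneg_nonneg) auto
    have \<epsilon>: "\<epsilon> > 0"
      using den by (simp add: \<epsilon>_def)
    obtain d where d: "d > 0" and close: "\<And>s. 0 < s \<Longrightarrow> s < d \<Longrightarrow> norm ((T s - id_blinfun) /\<^sub>R s - L) < \<epsilon>"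
      using tendstoD[OF deriv \<epsilon>] unfolding eventually_at_right_field dist_norm by auto
    obtain k :: nat where k: "t / d < real k"
      using reals_Archimedean2 by blast
    then have k0: "real k > 0"
      using t d by (meson divide_pos_pos order_less_trans)
    define s where "s = t / real k"
    have s: "0 < s" "s < d"
      using k k0 t d by (auto simp: s_def field_simps)
    define v where "v j = w + (real j * s) *\<^sub>R L w" for j
    have v_le: "norm (v j) \<le> K" if "j \<le> k" for j
    proof -
      have "norm (v j) \<le> norm w + norm ((real j * s) *\<^sub>R L w)"
        unfolding v_def by (rule norm_triangle_ineq)
      also have "norm ((real j * s) *\<^sub>R L w) = (real j * s) * norm (L w)"
        using s by simp
      also have "real j * s \<le> t"
        using that k0 t by (simp add: s_def field_simps)
      finally show ?thesis
        by (simp add: K_def mult_right_mono)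
    qed
    have step: "norm (T s (v j) - v (Suc j)) \<le> \<epsilon> * s * K" if "j \<le> k" for j
    proof -
      have "T s (v j) - v (Suc j) = s *\<^sub>R (((T s - id_blinfun) /\<^sub>R s - L) (v j))"
      proof -
        have "s *\<^sub>R (((T s - id_blinfun) /\<^sub>R s - L) y) = T s y - y - s *\<^sub>R L y" for y
          using s by (simp add: blinfun.bilinear_simps scaleR_diff_right)
        moreover have "L (v j) = L w" "v (Suc j) = v j + s *\<^sub>R L w"
          using LL by (simp_all add: v_def blinfun.bilinear_simps algebra_simps)
        ultimately show ?thesis
          by simp
      qed
      also have "norm \<dots> \<le> s * (norm ((T s - id_blinfun) /\<^sub>R s - L) * norm (v j))"
        using s norm_blinfun by (simp add: mult_left_mono)
      also have "\<dots> \<le> s * (\<epsilon> * K)"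
        using s close[OF s] v_le[OF that] \<epsilon> by (intro mult_left_mono mult_mono) auto
      finally show ?thesis
        by (simp add: algebra_simps)
    qed
    have lin: "(blinfun_apply (T s) ^^ n) (x - y) = (blinfun_apply (T s) ^^ n) x - (blinfun_apply (T s) ^^ n) y"
      for n x y
      by (induction n) (simp_all add: blinfun.bilinear_simps)
    \<comment> \<open>The error of each single step is transported by a power of \<open>T s\<close>,
      which enlarges it by a factor of at most \<open>R'\<close>. So the errors add up instead of
      growing geometrically.\<close>
    have iter: "norm ((blinfun_apply (T s) ^^ n) (v i) - v (i + n)) \<le> real n * (R' * (\<epsilon> * s * K))"
      if "i + n \<le> k" for i n
      using that
    proof (induction n arbitrary: i)
      case (Suc n)
      let ?F = "(blinfun_apply (T s) ^^ n)"
      have "(blinfun_apply (T s) ^^ Suc n) (v i) - v (i + Suc n) =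
          ?F (T s (v i) - v (Suc i)) + (?F (v (Suc i)) - v (Suc i + n))"
        by (simp add: funpow_swap1 lin)
      also have "norm \<dots> \<le> norm (?F (T s (v i) - v (Suc i))) + norm (?F (v (Suc i)) - v (Suc i + n))"
        by (rule norm_triangle_ineq)
      also have "\<dots> \<le> R' * (\<epsilon> * s * K) + real n * (R' * (\<epsilon> * s * K))"
        using Suc.prems R' by (intro add_mono Suc.IH order_trans[OF powers'] mult_left_mono step) auto
      finally show ?case
        by (simp add: algebra_simps)
    qed simp
    have "norm (v k) \<le> norm ((blinfun_apply (T s) ^^ k) (v 0)) + norm ((blinfun_apply (T s) ^^ k) (v 0) - v (0 + k))"
      by (simp add: norm_minus_commute norm_triangle_sub)
    also have "\<dots> \<le> R * norm w + real k * (R' * (\<epsilon> * s * K))"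
      using iter[of 0 k] powers[where s = s and n = k and x = w] by (intro add_mono) (auto simp: v_def)
    also have "real k * (R' * (\<epsilon> * s * K)) = \<epsilon> * (R' * t * K)"
      using k0 by (simp add: s_def)
    also have "\<dots> \<le> 1"
      using den by (simp add: \<epsilon>_def field_simps)
    finally have vk: "norm (w + t *\<^sub>R L w) \<le> R * norm w + 1"
      using k0 by (simp add: v_def s_def)
    have "t * norm (L w) = norm ((w + t *\<^sub>R L w) - w)"
      using t by simp
    also have "\<dots> \<le> norm (w + t *\<^sub>R L w) + norm w"
      by (rule norm_triangle_ineq4)
    finally show ?thesis
      using vk by linarith
  qed
  show ?thesis
  proof (rule ccontr)
    assume "L w \<noteq> 0"
    define c where "c = R * norm w + norm w + 1"
    have "c > 0"
      using R[of w] by (simp add: c_def add_nonneg_pos)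
    then have "2 * c \<le> c"
      using bound[of "2 * c / norm (L w)"] \<open>L w \<noteq> 0\<close> by (simp add: c_def)
    then show False
      using \<open>c > 0\<close> by simp
  qed
qed

section \<open>Vectors with bounded orbit in a continuous representation\<close>

locale continuous_rep = topological_group G X
  for G :: "('a, 'm) monoid_scheme" (structure) and X :: "'a topology" +
  fixes \<rho> :: "'a \<Rightarrow> 'w::euclidean_space \<Rightarrow>\<^sub>L 'w"
  assumes rep_one: "\<rho> \<one> = id_blinfun"
    and rep_mult: "\<lbrakk>x \<in> carrier G; y \<in> carrier G\<rbrakk> \<Longrightarrow> \<rho> (x \<otimes> y) = \<rho> x o\<^sub>L \<rho> y"
    and rep_cont: "continuous_map X euclidean \<rho>"
begin

definition bounded_part :: "'w set" where
  "bounded_part = {w. \<exists>M. \<forall>x\<in>carrier G. norm (\<rho> x w) \<le> M}"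

lemma subspace_bounded_part: "subspace bounded_part"
proof (rule subspaceI)
  show "0 \<in> bounded_part"
    by (auto simp: bounded_part_def intro!: exI[of _ 0])
next
  fix u v assume "u \<in> bounded_part" "v \<in> bounded_part"
  then obtain M N where "\<forall>x\<in>carrier G. norm (\<rho> x u) \<le> M" "\<forall>x\<in>carrier G. norm (\<rho> x v) \<le> N"
    by (auto simp: bounded_part_def)
  then show "u + v \<in> bounded_part"
    unfolding bounded_part_def
    by (auto simp: blinfun.bilinear_simps intro!: exI[of _ "M + N"] norm_triangle_mono)
next
  fix c :: real and u assume "u \<in> bounded_part"
  then obtain M where "\<forall>x\<in>carrier G. norm (\<rho> x u) \<le> M"
    by (auto simp: bounded_part_def)
  then show "c *\<^sub>R u \<in> bounded_part"
    unfolding bounded_part_def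
    by (auto simp: blinfun.bilinear_simps intro!: exI[of _ "\<bar>c\<bar> * M"] mult_left_mono)
qed

lemma bounded_part_invariant:
  assumes "w \<in> bounded_part" "x \<in> carrier G"
  shows "\<rho> x w \<in> bounded_part"
proof -
  obtain M where M: "\<And>y. y \<in> carrier G \<Longrightarrow> norm (\<rho> y w) \<le> M"
    using assms(1) by (auto simp: bounded_part_def)
  have "norm (\<rho> y (\<rho> x w)) \<le> M" if "y \<in> carrier G" for y
    using M[of "y \<otimes> x"] assms(2) that by (simp add: rep_mult)
  then show ?thesis
    by (auto simp: bounded_part_def)
qed

text \<open>The restriction of \<open>\<rho>\<close> to its bounded part, extended by the identity on a complement.\<close>

lemma bounded_part_rep:
  obtains P :: "'w \<Rightarrow>\<^sub>L 'w" and R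
  where "\<And>w. w \<in> bounded_part \<Longrightarrow> P w = w"
    and "\<And>w. P w \<in> bounded_part"
    and "continuous_bounded_rep G X (\<lambda>x. (\<rho> x o\<^sub>L P) + (id_blinfun - P)) R"
proof -
  obtain P :: "'w \<Rightarrow>\<^sub>L 'w" where P: "\<And>w. P w \<in> bounded_part" "\<And>w. w \<in> bounded_part \<Longrightarrow> P w = w"
    using subspace_projection[OF subspace_bounded_part] by metis
  define \<Phi> where "\<Phi> x = (\<rho> x o\<^sub>L P) + (id_blinfun - P)" for x
  have \<Phi>_apply: "\<Phi> x w = \<rho> x (P w) + w - P w" for x w
    by (simp add: \<Phi>_def blinfun.bilinear_simps)
  have "\<forall>b. \<exists>M. \<forall>x\<in>carrier G. norm (\<rho> x (P b)) \<le> M"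
    using P(1) by (auto simp: bounded_part_def)
  then obtain M where M: "\<And>b x. x \<in> carrier G \<Longrightarrow> norm (\<rho> x (P b)) \<le> M b"
    by metis
  \<comment> \<open>In finite dimension, bounds on the images of the basis vectors b give an
    operator bound; the image of b is \<rho> x (P b) + (b - P b).\<close>
  define R where "R = (\<Sum>b\<in>Basis. M b + norm (b - P b))"
  have "continuous_bounded_rep G X \<Phi> R"
  proof
    show "\<Phi> \<one> = id_blinfun"
      by (rule blinfun_eqI) (simp add: \<Phi>_apply rep_one)
  next
    fix x y assume xy: "x \<in> carrier G" "y \<in> carrier G"
    show "\<Phi> (x \<otimes> y) = \<Phi> x o\<^sub>L \<Phi> y"
    proof (rule blinfun_eqI)
      fix w
      have "P (\<rho> y (P w)) = \<rho> y (P w)" "P (P w) = P w"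
        using P bounded_part_invariant xy by simp_all
      then have "P (\<Phi> y w) = \<rho> y (P w)"
        by (simp add: \<Phi>_apply blinfun.bilinear_simps)
      then show "\<Phi> (x \<otimes> y) w = (\<Phi> x o\<^sub>L \<Phi> y) w"
        using xy by (simp add: \<Phi>_apply[of x] \<Phi>_apply[of "x \<otimes> y"] rep_mult) (simp add: \<Phi>_apply)
    qed
  next
    fix x assume x: "x \<in> carrier G"
    have "norm (\<Phi> x) \<le> (\<Sum>b\<in>Basis. norm (\<Phi> x b))"
      by (rule norm_blinfun_euclidean_le)
    also have "\<dots> \<le> R"
      unfolding R_def
    proof (rule sum_mono)
      fix b :: 'w
      have "norm (\<Phi> x b) \<le> norm (\<rho> x (P b)) + norm (b - P b)"
        unfolding \<Phi>_apply by (metis add_diff_eq norm_triangle_ineq)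
      then show "norm (\<Phi> x b) \<le> M b + norm (b - P b)"
        using M[OF x, of b] by linarith
    qed
    finally show "norm (\<Phi> x) \<le> R" .
  next
    have "continuous_map euclidean euclidean (\<lambda>a. (a o\<^sub>L P) + (id_blinfun - P))"
      unfolding continuous_map_iff_continuous2
      by (intro continuous_intros bounded_bilinear.continuous_on[OF bounded_bilinear_blinfun_compose])
    from continuous_map_compose[OF rep_cont this]
    show "continuous_map X euclidean \<Phi>"
      by (simp add: \<Phi>_def[abs_def] o_def)
  qed
  then show ?thesis
    using that[OF P(2,1)] by (simp add: \<Phi>_def[abs_def])
qed

lemma rep_commute_on_bounded_part:
  assumes "connected_space X" "solvable G" and w: "w \<in> bounded_part"
    and xy: "x \<in> carrier G" "y \<in> carrier G"
  shows "\<rho> x (\<rho> y w) = \<rho> y (\<rho> x w)"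
proof -
  obtain P R where P: "\<And>w. w \<in> bounded_part \<Longrightarrow> blinfun_apply P w = w" "\<And>w. blinfun_apply P w \<in> bounded_part"
    and rep: "continuous_bounded_rep G X (\<lambda>x. (\<rho> x o\<^sub>L P) + (id_blinfun - P)) R"
    using bounded_part_rep by metis
  have "((\<rho> x o\<^sub>L P) + (id_blinfun - P)) (((\<rho> y o\<^sub>L P) + (id_blinfun - P)) w) =
      ((\<rho> y o\<^sub>L P) + (id_blinfun - P)) (((\<rho> x o\<^sub>L P) + (id_blinfun - P)) w)"
    using continuous_bounded_rep.rep_commute[OF rep assms(1,2) xy]
    by (metis blinfun_apply_blinfun_compose)
  then show ?thesis
    using bounded_part_invariant w xy by (simp add: blinfun.bilinear_simps P(1))
qed

text \<open>L maps the bounded part to itself, since its values there are limits of difference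
  quotients in a closed subspace. The case L (L v) = 0 can therefore be used twice, for v = L w and
  then for v = w. The curve x need not be a one-parameter group: the bounds concern powers of x s,
  which lie in the group anyway.\<close>

lemma derivative_zero_on_bounded_part:
  assumes w: "w \<in> bounded_part"
    and x: "\<And>s. x s \<in> carrier G"
    and deriv: "((\<lambda>s. (\<rho> (x s) - id_blinfun) /\<^sub>R s) \<longlongrightarrow> L) (at_right 0)"
    and LLL: "L (L (L w)) = 0"
  shows "L w = 0"
proof -
  obtain P R where P: "\<And>w. w \<in> bounded_part \<Longrightarrow> blinfun_apply P w = w" "\<And>w. blinfun_apply P w \<in> bounded_part"
    and rep: "continuous_bounded_rep G X (\<lambda>x. (\<rho> x o\<^sub>L P) + (id_blinfun - P)) R"
    using bounded_part_rep by metis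
  define \<Phi> where "\<Phi> x = (\<rho> x o\<^sub>L P) + (id_blinfun - P)" for x
  interpret \<Phi>: continuous_bounded_rep G X \<Phi> R
    using rep by (simp add: \<Phi>_def[abs_def])
  have L_bounded: "L v \<in> bounded_part" if v: "v \<in> bounded_part" for v
  proof (rule Lim_in_closed_set[OF closed_subspace[OF subspace_bounded_part]])
    show "((\<lambda>s. ((\<rho> (x s) - id_blinfun) /\<^sub>R s) v) \<longlongrightarrow> L v) (at_right 0)"
      by (intro tendsto_intros deriv)
    show "\<forall>\<^sub>F s in at_right 0. ((\<rho> (x s) - id_blinfun) /\<^sub>R s) v \<in> bounded_part"
      using v x bounded_part_invariant subspace_bounded_part
      by (intro always_eventually allI)
        (simp add: blinfun.bilinear_simps subspace_diff subspace_scale)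
  qed simp
  have "((\<lambda>s. ((\<rho> (x s) - id_blinfun) /\<^sub>R s) o\<^sub>L P) \<longlongrightarrow> L o\<^sub>L P) (at_right 0)"
    by (intro bounded_bilinear.tendsto[OF bounded_bilinear_blinfun_compose] deriv tendsto_const)
  moreover have "((\<rho> (x s) - id_blinfun) /\<^sub>R s) o\<^sub>L P = (\<Phi> (x s) - id_blinfun) /\<^sub>R s" for s
    by (rule blinfun_eqI) (simp add: \<Phi>_def blinfun.bilinear_simps)
  ultimately have deriv': "((\<lambda>s. (\<Phi> (x s) - id_blinfun) /\<^sub>R s) \<longlongrightarrow> L o\<^sub>L P) (at_right 0)"
    by simp
  have pow: "(blinfun_apply (\<Phi> (x s)) ^^ n) v = \<Phi> (x s [^] n) v" for s n v
    using x by (induction n arbitrary: v) (simp_all del: funpow.simps(2) add: funpow_Suc_right \<Phi>.rep_one \<Phi>.rep_mult)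
  have powers: "norm ((blinfun_apply (\<Phi> (x s)) ^^ n) v) \<le> R * norm v" for s n v
    unfolding pow
    using order_trans[OF norm_blinfun mult_right_mono[OF \<Phi>.rep_bounded norm_ge_zero]] x by simp
  have *: "L v = 0" if v: "v \<in> bounded_part" and "L (L v) = 0" for v
  proof -
    have "(L o\<^sub>L P) ((L o\<^sub>L P) v) = 0"
      using that L_bounded by (simp add: P(1))
    from derivative_zero_if_powers_bounded[OF powers deriv' this] show ?thesis
      using v by (simp add: P(1))
  qed
  show ?thesis
    using *[OF w *[OF L_bounded[OF w] LLL]] .
qed

end

section \<open>Bilinear forms\<close>

text \<open>Indexing by the basis itself gives a finite type, so that forms become vectors of a
  finite power of the reals. This is a Euclidean space, as \<open>continuous_rep\<close>
  requires.\<close>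

typedef (overloaded) 'e basis_index = "Basis :: 'e::euclidean_space set"
  morphisms basis_vec basis_index
  using nonempty_Basis by blast

instance basis_index :: (euclidean_space) finite
proof
  have "finite (basis_index ` (Basis :: 'a set))"
    by simp
  moreover have "basis_index ` (Basis :: 'a set) = UNIV"
    using type_definition.Abs_image[OF type_definition_basis_index] .
  ultimately show "finite (UNIV :: 'a basis_index set)"
    by simp
qed

lemma basis_vec_representation:
  fixes u :: "'e::euclidean_space"
  shows "(\<Sum>i\<in>UNIV. (u \<bullet> basis_vec i) *\<^sub>R basis_vec i) = u"
proof -
  have "bij_betw basis_vec (UNIV :: 'e basis_index set) Basis"
    using type_definition.Rep_range[OF type_definition_basis_index]
    by (auto simp: bij_betw_def inj_def basis_vec_inject)
  from sum.reindex_bij_betw[OF this, of "\<lambda>b. (u \<bullet> b) *\<^sub>R b"] show ?thesis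
    by (simp add: euclidean_representation)
qed

type_synonym 'e form = "real ^ ('e basis_index \<times> 'e basis_index)"

definition form_apply :: "'e::euclidean_space form \<Rightarrow> 'e \<Rightarrow> 'e \<Rightarrow> real" where
  "form_apply w u v = (\<Sum>i\<in>UNIV. \<Sum>j\<in>UNIV. w $ (i, j) * ((u \<bullet> basis_vec i) * (v \<bullet> basis_vec j)))"

definition form_of :: "('e::euclidean_space \<Rightarrow> 'e \<Rightarrow> real) \<Rightarrow> 'e form" where
  "form_of \<beta> = (\<chi> p. \<beta> (basis_vec (fst p)) (basis_vec (snd p)))"

lemma form_apply_form_of:
  assumes "bilinear \<beta>"
  shows "form_apply (form_of \<beta>) u v = \<beta> u v"
proof -
  have "\<beta> u v = \<beta> (\<Sum>i\<in>UNIV. (u \<bullet> basis_vec i) *\<^sub>R basis_vec i) (\<Sum>i\<in>UNIV. (v \<bullet> basis_vec i) *\<^sub>R basis_vec i)"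
    by (simp add: basis_vec_representation)
  also have "\<dots> = form_apply (form_of \<beta>) u v"
    unfolding bilinear_sum[OF assms] form_apply_def form_of_def
    by (simp add: sum.cartesian_product bilinear_lmul[OF assms] bilinear_rmul[OF assms] mult_ac)
  finally show ?thesis ..
qed

lemma bilinear_form_apply: "bilinear (form_apply w)"
  unfolding bilinear_def form_apply_def
  by (auto intro!: linearI simp: inner_add_left algebra_simps sum.distrib sum_distrib_left)

lemma form_apply_basis: "form_apply w (basis_vec i) (basis_vec j) = w $ (i, j)"
proof -
  have *: "basis_vec k \<bullet> basis_vec l = (if k = l then 1 else 0)" for k l :: "'a basis_index"
    using basis_vec[of k] basis_vec[of l] by (simp add: inner_Basis basis_vec_inject)
  show ?thesis
    by (simp add: form_apply_def * if_distrib[of "\<lambda>x. _ * x"] mult_if_delta cong: if_cong)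
qed

lemma form_eqI:
  assumes "\<And>u v. form_apply w u v = form_apply w' u v"
  shows "w = w'"
  using assms by (simp add: vec_eq_iff form_apply_basis[symmetric])

lemma form_apply_linear:
  "form_apply (w + w') u v = form_apply w u v + form_apply w' u v"
  "form_apply (r *\<^sub>R w) u v = r * form_apply w u v"
  "form_apply (w - w') u v = form_apply w u v - form_apply w' u v"
  "form_apply 0 u v = 0"
  by (simp_all add: form_apply_def sum.distrib sum_subtractf sum_distrib_left algebra_simps)

lemma tendsto_form_apply [tendsto_intros]:
  assumes "(f \<longlongrightarrow> u) F" "(h \<longlongrightarrow> v) F"
  shows "((\<lambda>x. form_apply w (f x) (h x)) \<longlongrightarrow> form_apply w u v) F"
  unfolding form_apply_def by (intro tendsto_intros assms)

lemma bilinear_comp_linear: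
  assumes "bilinear \<beta>" "linear f" "linear h"
  shows "bilinear (\<lambda>u v. \<beta> (f u) (h v))"
  using assms unfolding bilinear_def by (auto intro: linear_compose[unfolded o_def])

definition pullback :: "('e::euclidean_space \<Rightarrow>\<^sub>L 'e) \<Rightarrow> 'e form \<Rightarrow>\<^sub>L 'e form" where
  "pullback A = Blinfun (\<lambda>w. form_of (\<lambda>u v. form_apply w (A u) (A v)))"

lemma form_apply_pullback [simp]: "form_apply (pullback A w) u v = form_apply w (A u) (A v)"
proof -
  have "linear (\<lambda>w. form_of (\<lambda>u v. form_apply w (A u) (A v)))"
    by (auto intro!: linearI simp: form_of_def vec_eq_iff form_apply_linear)
  then have "pullback A w = form_of (\<lambda>u v. form_apply w (A u) (A v))"
    by (simp add: pullback_def bounded_linear_Blinfun_apply linear_conv_bounded_linear)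
  moreover have "bilinear (\<lambda>u v. form_apply w (A u) (A v))"
    by (rule bilinear_comp_linear[OF bilinear_form_apply linear_blinfun_apply linear_blinfun_apply])
  ultimately show ?thesis
    by (simp add: form_apply_form_of)
qed

text \<open>The derivative of \<open>pullback\<close> at the identity in the direction
  \<open>A\<close>, that is, the Lie derivative of forms by a linear endomorphism.\<close>

definition infinitesimal :: "('e::euclidean_space \<Rightarrow>\<^sub>L 'e) \<Rightarrow> 'e form \<Rightarrow>\<^sub>L 'e form" where
  "infinitesimal A = Blinfun (\<lambda>w. form_of (\<lambda>u v. form_apply w (A u) v + form_apply w u (A v)))"

lemma form_apply_infinitesimal [simp]:
  "form_apply (infinitesimal A w) u v = form_apply w (A u) v + form_apply w u (A v)"
proof -
  have "linear (\<lambda>w. form_of (\<lambda>u v. form_apply w (A u) v + form_apply w u (A v)))"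
    by (auto intro!: linearI simp: form_of_def vec_eq_iff form_apply_linear algebra_simps)
  then have "infinitesimal A w = form_of (\<lambda>u v. form_apply w (A u) v + form_apply w u (A v))"
    by (simp add: infinitesimal_def bounded_linear_Blinfun_apply linear_conv_bounded_linear)
  moreover have "bilinear (\<lambda>u v. form_apply w (A u) v + form_apply w u (A v))"
  proof -
    have "bilinear (\<lambda>u v. form_apply w (A u) v)"
      by (rule bilinear_comp_linear[OF bilinear_form_apply linear_blinfun_apply linear_ident])
    moreover have "bilinear (\<lambda>u v. form_apply w u (A v))"
      by (rule bilinear_comp_linear[OF bilinear_form_apply linear_ident linear_blinfun_apply])
    ultimately show ?thesis
      unfolding bilinear_def by (auto intro: linear_compose_add)
  qed
  ultimately show ?thesis
    by (simp add: form_apply_form_of)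
qed

lemma tendsto_formI:
  fixes f :: "'c \<Rightarrow> 'e::euclidean_space form"
  assumes "\<And>u v. ((\<lambda>x. form_apply (f x) u v) \<longlongrightarrow> form_apply w u v) F"
  shows "(f \<longlongrightarrow> w) F"
proof (rule vec_tendstoI)
  fix p :: "'e basis_index \<times> 'e basis_index"
  show "((\<lambda>x. f x $ p) \<longlongrightarrow> w $ p) F"
    using assms[of "basis_vec (fst p)" "basis_vec (snd p)"] by (simp add: form_apply_basis)
qed

lemma continuous_on_pullback: "continuous_on UNIV (pullback :: ('e::euclidean_space \<Rightarrow>\<^sub>L 'e) \<Rightarrow> _)"
  unfolding continuous_on_def
  by (intro ballI tendsto_componentwise1 tendsto_formI) (auto intro!: tendsto_intros)

text \<open>Write A s = 1 + s E s. Expanding w (A s u) (A s v) gives the first-order terms and the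
  remainder s * s * w (E s u) (E s v), which still tends to 0 after division by s.\<close>

lemma pullback_derivative:
  fixes A :: "real \<Rightarrow> 'e::euclidean_space \<Rightarrow>\<^sub>L 'e"
  assumes "((\<lambda>s. (A s - id_blinfun) /\<^sub>R s) \<longlongrightarrow> D) (at_right 0)"
  shows "((\<lambda>s. (pullback (A s) - id_blinfun) /\<^sub>R s) \<longlongrightarrow> infinitesimal D) (at_right 0)"
proof (intro tendsto_componentwise1 tendsto_formI)
  fix w :: "'e form" and u v
  define E where "E s = (A s - id_blinfun) /\<^sub>R s" for s
  have E: "(E \<longlongrightarrow> D) (at_right 0)"
    using assms by (simp add: E_def[abs_def])
  have "((\<lambda>s. form_apply w (E s u) v + form_apply w u (E s v) + s * form_apply w (E s u) (E s v))
      \<longlongrightarrow> form_apply w (D u) v + form_apply w u (D v) + 0 * form_apply w (D u) (D v)) (at_right 0)"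
    by (intro tendsto_intros E)
  moreover have "form_apply w (E s u) v + form_apply w u (E s v) + s * form_apply w (E s u) (E s v) =
      form_apply (((pullback (A s) - id_blinfun) /\<^sub>R s) w) u v" if "s > 0" for s
  proof -
    have A: "A s x = x + s *\<^sub>R E s x" for x
      using that by (simp add: E_def blinfun.bilinear_simps)
    note lin = bilinear_ladd bilinear_radd bilinear_lmul bilinear_rmul
    have "form_apply w (A s u) (A s v) = form_apply w u v + s * (form_apply w (E s u) v + form_apply w u (E s v))
        + s * s * form_apply w (E s u) (E s v)"
      unfolding A by (simp add: lin[OF bilinear_form_apply] algebra_simps)
    then show ?thesis
      using that by (simp add: blinfun.bilinear_simps form_apply_linear field_simps)
  qed
  ultimately show "((\<lambda>s. form_apply (((pullback (A s) - id_blinfun) /\<^sub>R s) w) u v)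
      \<longlongrightarrow> form_apply (infinitesimal D w) u v) (at_right 0)"
    by (auto elim!: Lim_transform_eventually simp: eventually_at_right_less
        intro: eventually_mono[OF eventually_at_right_less])
qed

section \<open>The action of a group on bilinear forms\<close>

context topological_group
begin

text \<open>\<open>pullback\<close> reverses the order of composition, and inversion in the group
  reverses it back.\<close>

lemma continuous_rep_pullback:
  fixes A :: "'a \<Rightarrow> 'e::euclidean_space \<Rightarrow>\<^sub>L 'e"
  assumes "continuous_rep G X A"
  shows "continuous_rep G X (\<lambda>x. pullback (A (inv x)))"
proof -
  interpret A: continuous_rep G X A by fact
  show ?thesis
  proof
    show "pullback (A (inv \<one>)) = id_blinfun"
      by (intro blinfun_eqI form_eqI) (simp add: A.rep_one)
    show "pullback (A (inv (x \<otimes> y))) = pullback (A (inv x)) o\<^sub>L pullback (A (inv y))"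
      if "x \<in> carrier G" "y \<in> carrier G" for x y
      using that by (intro blinfun_eqI form_eqI) (simp add: A.rep_mult inv_mult_group)
    have "continuous_map euclidean euclidean (pullback :: ('e \<Rightarrow>\<^sub>L 'e) \<Rightarrow> _)"
      using continuous_on_pullback by simp
    from continuous_map_compose[OF continuous_map_compose[OF inv_cont A.rep_cont] this]
    show "continuous_map X euclidean (\<lambda>x. pullback (A (inv x)))"
      by (simp add: o_def)
  qed
qed

end

locale bounded_orbit_form = continuous_rep G X A
  for G :: "('a, 'm) monoid_scheme" (structure) and X :: "'a topology"
    and A :: "'a \<Rightarrow> 'e::euclidean_space \<Rightarrow>\<^sub>L 'e" +
  fixes \<beta> :: "'e \<Rightarrow> 'e \<Rightarrow> real"
  assumes bilinear: "bilinear \<beta>"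
    and orbit_bounded: "\<exists>K. \<forall>x\<in>carrier G. \<bar>\<beta> (A x u) (A x v)\<bar> \<le> K"
begin

sublocale forms: continuous_rep G X "\<lambda>x. pullback (A (inv x))"
  by (rule continuous_rep_pullback[OF continuous_rep_axioms])

lemma form_in_bounded_part: "form_of \<beta> \<in> forms.bounded_part"
proof -
  have "\<exists>K. \<forall>x\<in>carrier G. \<bar>pullback (A (inv x)) (form_of \<beta>) $ p\<bar> \<le> K" for p
  proof -
    have eq: "w $ p = form_apply w (basis_vec (fst p)) (basis_vec (snd p))" for w :: "'e form"
      by (simp add: form_apply_basis)
    obtain K where "\<And>x. x \<in> carrier G \<Longrightarrow> \<bar>\<beta> (A x (basis_vec (fst p))) (A x (basis_vec (snd p)))\<bar> \<le> K"
      using orbit_bounded by blast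
    then show ?thesis
      by (auto simp: eq form_apply_form_of[OF bilinear])
  qed
  then obtain K where K: "\<And>p x. x \<in> carrier G \<Longrightarrow> \<bar>pullback (A (inv x)) (form_of \<beta>) $ p\<bar> \<le> K p"
    by metis
  have "norm (pullback (A (inv x)) (form_of \<beta>)) \<le> (\<Sum>p\<in>UNIV. K p)" if "x \<in> carrier G" for x
    by (rule order_trans[OF norm_le_l1_cart]) (intro sum_mono K that)
  then show ?thesis
    unfolding forms.bounded_part_def by blast
qed

text \<open>The actions of x^-1 and y^-1 are compared, because the inversions then cancel.
  Solvability reaches the infinitesimal argument only through this symmetry between x y and y
  x.\<close>

lemma form_commute:
  assumes "connected_space X" "solvable G" "x \<in> carrier G" "y \<in> carrier G"
  shows "\<beta> (A (x \<otimes> y) u) (A (x \<otimes> y) v) = \<beta> (A (y \<otimes> x) u) (A (y \<otimes> x) v)"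
proof -
  have "pullback (A (inv (inv y))) (pullback (A (inv (inv x))) (form_of \<beta>)) =
      pullback (A (inv (inv x))) (pullback (A (inv (inv y))) (form_of \<beta>))"
    by (rule forms.rep_commute_on_bounded_part[OF assms(1,2) form_in_bounded_part]) (use assms in auto)
  from arg_cong[OF this, of "\<lambda>w. form_apply w u v"] show ?thesis
    using assms by (simp add: form_apply_form_of[OF bilinear] rep_mult)
qed

text \<open>With L = \<open>infinitesimal D\<close>, the hypothesis \<open>third\<close> is L (L (L
  \<beta>)) = 0 expanded by the Leibniz rule, whence the coefficients 1, 3, 3, 1. The curve is
  inverted in the application, since the representation on forms involves
  \<open>inv\<close>.\<close>

lemma skew_if_third_derivative_zero:
  assumes x: "\<And>s. x s \<in> carrier G"
    and deriv: "((\<lambda>s. (A (x s) - id_blinfun) /\<^sub>R s) \<longlongrightarrow> D) (at_right 0)"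
    and third: "\<And>u v. \<beta> (D (D (D u))) v + 3 * \<beta> (D (D u)) (D v) + 3 * \<beta> (D u) (D (D v)) + \<beta> u (D (D (D v))) = 0"
  shows "\<beta> (D u) v + \<beta> u (D v) = 0"
proof -
  have "infinitesimal D (form_of \<beta>) = 0"
  proof (rule forms.derivative_zero_on_bounded_part[OF form_in_bounded_part])
    show "inv (x s) \<in> carrier G" for s
      using x by simp
    show "((\<lambda>s. (pullback (A (inv (inv (x s)))) - id_blinfun) /\<^sub>R s) \<longlongrightarrow> infinitesimal D) (at_right 0)"
      using pullback_derivative[OF deriv] x by simp
    show "infinitesimal D (infinitesimal D (infinitesimal D (form_of \<beta>))) = 0"
      using third by (intro form_eqI) (simp add: form_apply_linear form_apply_form_of[OF bilinear] algebra_simps)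
  qed
  from arg_cong[OF this, of "\<lambda>w. form_apply w u v"] show ?thesis
    by (simp add: form_apply_linear form_apply_form_of[OF bilinear])
qed

end

section \<open>Invariance of forms with bounded orbit\<close>

lemma has_vector_derivative_at_right_quotient:
  assumes "(f has_vector_derivative D) (at 0)"
  shows "((\<lambda>s. (f s - f 0) /\<^sub>R s) \<longlongrightarrow> D) (at_right (0::real))"
proof -
  have "((\<lambda>y. (f y - f 0 - y *\<^sub>R D) /\<^sub>R norm y) \<longlongrightarrow> 0) (at_right 0)"
    using assms unfolding has_vector_derivative_def has_derivative_def
    by (auto intro: tendsto_within_subset)
  then have "((\<lambda>y. (f y - f 0 - y *\<^sub>R D) /\<^sub>R norm y + D) \<longlongrightarrow> 0 + D) (at_right 0)"
    by (intro tendsto_intros)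
  moreover have "\<forall>\<^sub>F y in at_right 0. (f y - f 0 - y *\<^sub>R D) /\<^sub>R norm y + D = (f y - f 0) /\<^sub>R y"
    using eventually_at_right_less[of "0::real"] by eventually_elim (simp add: algebra_simps)
  ultimately show ?thesis
    by (auto intro: Lim_transform_eventually)
qed

text \<open>The chart \<open>\<theta>\<close> at the identity carries what is needed of the Lie structure; \<open>ad\<close> is the
  derivative of the adjoint representation \<open>A\<close> in this chart.\<close>

locale adjoint_rep = continuous_rep G X A
  for G :: "('a, 'm) monoid_scheme" (structure) and X :: "'a topology"
    and A :: "'a \<Rightarrow> 'e::euclidean_space \<Rightarrow>\<^sub>L 'e" +
  fixes \<theta> :: "'e \<Rightarrow> 'a" and ad :: "'e \<Rightarrow> 'e \<Rightarrow>\<^sub>L 'e"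
  assumes chart_zero: "\<theta> 0 = \<one>"
    and chart_carrier: "\<theta> z \<in> carrier G"
    and chart_nbhd: "d > 0 \<Longrightarrow> \<exists>V. openin X V \<and> \<one> \<in> V \<and> V \<subseteq> \<theta> ` ball 0 d"
    and ad_deriv: "((\<lambda>z. A (\<theta> z)) has_derivative ad) (at 0)"
    and ad_antisym: "ad u v = - ad v u"
    and chart_conj: "x \<in> carrier G \<Longrightarrow> \<exists>\<gamma>. (\<gamma> has_derivative A x) (at 0) \<and> \<gamma> 0 = 0 \<and>
      (\<forall>\<^sub>F z in nhds 0. A (\<theta> (\<gamma> z)) = A (x \<otimes> \<theta> z \<otimes> inv x))"
    and chart_shift: "\<exists>d>0. \<forall>y\<in>ball 0 d. \<exists>\<gamma> \<gamma>'. (\<gamma> has_derivative \<gamma>') (at y) \<and> \<gamma> y = 0 \<and>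
      (\<forall>\<^sub>F z in nhds y. A (\<theta> z) = A (\<theta> (\<gamma> z) \<otimes> \<theta> y))"
begin

lemma bounded_linear_ad: "bounded_linear ad"
  using ad_deriv by (rule has_derivative_bounded_linear)

lemmas ad_linear = linear_add[OF bounded_linear.linear[OF bounded_linear_ad]]
  linear_diff[OF bounded_linear.linear[OF bounded_linear_ad]]
  linear_cmul[OF bounded_linear.linear[OF bounded_linear_ad]]

lemma rep_chart_zero [simp]: "A (\<theta> 0) = id_blinfun"
  by (simp add: chart_zero rep_one)

lemma ad_deriv_apply: "((\<lambda>z. A (\<theta> z) v) has_derivative (\<lambda>h. ad h v)) (at 0)"
  by (rule bounded_linear.has_derivative[OF blinfun.bounded_linear_left ad_deriv])

lemma ad_quotient: "((\<lambda>s. (A (\<theta> (s *\<^sub>R x)) - id_blinfun) /\<^sub>R s) \<longlongrightarrow> ad x) (at_right 0)"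
proof -
  have "((\<lambda>s::real. A (\<theta> (s *\<^sub>R x))) has_derivative (\<lambda>s. ad (s *\<^sub>R x))) (at 0)"
    by (rule has_derivative_compose[of "\<lambda>s. s *\<^sub>R x", where g = "\<lambda>z. A (\<theta> z)"])
      (auto intro!: derivative_eq_intros ad_deriv)
  then have "((\<lambda>s::real. A (\<theta> (s *\<^sub>R x))) has_vector_derivative ad x) (at 0)"
    by (simp add: has_vector_derivative_def ad_linear)
  from has_vector_derivative_at_right_quotient[OF this] show ?thesis
    by simp
qed

text \<open>This says that Ad x respects the bracket. It results from differentiating A (x
  \<theta>(z) x^-1) A x = A x A (\<theta> z) at z = 0, where the left side runs through the
  coordinate expression \<gamma> of the conjugation, whose derivative is \<open>A x\<close>.\<close>

lemma ad_equivariant: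
  assumes x: "x \<in> carrier G"
  shows "ad (A x y) (A x v) = A x (ad y v)"
proof -
  obtain \<gamma> where \<gamma>: "(\<gamma> has_derivative A x) (at 0)" "\<gamma> 0 = 0"
    and ev: "\<forall>\<^sub>F z in nhds 0. A (\<theta> (\<gamma> z)) = A (x \<otimes> \<theta> z \<otimes> inv x)"
    using chart_conj[OF x] by blast
  have "((\<lambda>z. A (\<theta> (\<gamma> z)) (A x v)) has_derivative (\<lambda>h. ad (A x h) (A x v))) (at 0)"
    by (rule has_derivative_compose[OF \<gamma>(1), where g = "\<lambda>z. A (\<theta> z) (A x v)"])
      (simp add: \<gamma>(2) ad_deriv_apply)
  moreover have "((\<lambda>z. A (\<theta> (\<gamma> z)) (A x v)) has_derivative (\<lambda>h. A x (ad h v))) (at 0)"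
  proof (rule has_derivative_transform_eventually)
    show "((\<lambda>z. A x (A (\<theta> z) v)) has_derivative (\<lambda>h. A x (ad h v))) (at 0)"
      by (rule bounded_linear.has_derivative[OF blinfun.bounded_linear_right ad_deriv_apply])
    have eq: "A x (A (\<theta> z) v) = A (\<theta> (\<gamma> z)) (A x v)"
      if "A (\<theta> (\<gamma> z)) = A (x \<otimes> \<theta> z \<otimes> inv x)" for z
    proof -
      have "A (x \<otimes> \<theta> z \<otimes> inv x) o\<^sub>L A x = A x o\<^sub>L A (\<theta> z)"
        using x chart_carrier by (simp add: rep_mult[symmetric] m_assoc)
      then show ?thesis
        unfolding that by (metis blinfun_apply_blinfun_compose)
    qed
    show "\<forall>\<^sub>F z in at 0 within UNIV. A x (A (\<theta> z) v) = A (\<theta> (\<gamma> z)) (A x v)"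
      using ev eq by (auto simp: eventually_at_filter elim!: eventually_mono)
    show "A x (A (\<theta> 0) v) = A (\<theta> (\<gamma> 0)) (A x v)"
      by (simp add: \<gamma>(2))
  qed simp
  ultimately have "(\<lambda>h. ad (A x h) (A x v)) = (\<lambda>h. A x (ad h v))"
    by (rule has_derivative_unique)
  then show ?thesis
    by meson
qed

text \<open>Put \<theta> z for the group element in \<open>ad_equivariant\<close> and differentiate
  at z = 0 in the direction x.\<close>

lemma jacobi: "ad x (ad y v) = ad (ad x y) v + ad y (ad x v)"
proof -
  have "((\<lambda>z. ad (A (\<theta> z) y) (A (\<theta> z) v)) has_derivative
      (\<lambda>h. ad (A (\<theta> 0) y) (ad h v) + ad (ad h y) (A (\<theta> 0) v))) (at 0)"
    by (intro blinfun.FDERIV ad_deriv_apply bounded_linear.has_derivative[OF bounded_linear_ad])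
  moreover have "((\<lambda>z. A (\<theta> z) (ad y v)) has_derivative (\<lambda>h. ad h (ad y v))) (at 0)"
    by (rule ad_deriv_apply)
  ultimately have "(\<lambda>h. ad (A (\<theta> 0) y) (ad h v) + ad (ad h y) (A (\<theta> 0) v)) = (\<lambda>h. ad h (ad y v))"
    unfolding ad_equivariant[OF chart_carrier] by (rule has_derivative_unique)
  from fun_cong[OF this, of x] show ?thesis
    by (simp add: add.commute)
qed

end

section \<open>Skewness of the adjoint operators and invariance of the form\<close>

locale adjoint_form = adjoint_rep G X A \<theta> ad + bounded_orbit_form G X A \<beta>
  for G :: "('a, 'm) monoid_scheme" (structure) and X :: "'a topology"
    and A :: "'a \<Rightarrow> 'e::euclidean_space \<Rightarrow>\<^sub>L 'e"
    and \<theta> :: "'e \<Rightarrow> 'a" and ad :: "'e \<Rightarrow> 'e \<Rightarrow>\<^sub>L 'e" and \<beta> :: "'e \<Rightarrow> 'e \<Rightarrow> real" +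
  assumes symmetric: "\<beta> u v = \<beta> v u"
    and connected: "connected_space X" and solvable: "solvable G"
begin

lemmas form_linear =
  bilinear_ladd[OF bilinear] bilinear_radd[OF bilinear] bilinear_lmul[OF bilinear]
  bilinear_rmul[OF bilinear] bilinear_lsub[OF bilinear] bilinear_rsub[OF bilinear]
  bilinear_lneg[OF bilinear] bilinear_rneg[OF bilinear]

text \<open>The Lie derivative of \<beta> by \<open>ad x\<close>; as a form in u and v it vanishes
  exactly when \<open>ad x\<close> is skew for \<beta>.\<close>

definition defect :: "'e \<Rightarrow> 'e \<Rightarrow> 'e \<Rightarrow> real" where
  "defect x u v = \<beta> (ad x u) v + \<beta> u (ad x v)"

lemma defect_deriv:
  "((\<lambda>z. \<beta> (A (\<theta> z) u) (A (\<theta> z) v)) has_derivative (\<lambda>h. defect h u v)) (at 0)"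
proof -
  have "bounded_bilinear \<beta>"
    using bilinear by (simp add: bilinear_conv_bounded_bilinear)
  from bounded_bilinear.FDERIV[OF this ad_deriv_apply ad_deriv_apply, of u v] show ?thesis
    by (simp add: defect_def add.commute)
qed

lemma bounded_linear_defect: "bounded_linear (\<lambda>x. defect x u v)"
  using defect_deriv by (rule has_derivative_bounded_linear)

text \<open>By \<open>form_commute\<close> the factor x in x \<theta>(z) x^-1 can be moved to the
  right end, where it cancels x^-1. So conjugation does not change how \<theta>(z) moves \<beta>;
  differentiate at z = 0.\<close>

lemma defect_equivariant:
  assumes x: "x \<in> carrier G"
  shows "defect (A x y) u v = defect y u v"
proof -
  define F where "F z = \<beta> (A (\<theta> z) u) (A (\<theta> z) v)" for z
  have F: "(F has_derivative (\<lambda>h. defect h u v)) (at 0)"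
    unfolding F_def[abs_def] by (rule defect_deriv)
  obtain \<gamma> where \<gamma>: "(\<gamma> has_derivative A x) (at 0)" "\<gamma> 0 = 0"
    and ev: "\<forall>\<^sub>F z in nhds 0. A (\<theta> (\<gamma> z)) = A (x \<otimes> \<theta> z \<otimes> inv x)"
    using chart_conj[OF x] by blast
  have "((\<lambda>z. F (\<gamma> z)) has_derivative (\<lambda>h. defect (A x h) u v)) (at 0)"
    by (rule has_derivative_compose[OF \<gamma>(1)]) (simp add: \<gamma>(2) F)
  moreover have "((\<lambda>z. F (\<gamma> z)) has_derivative (\<lambda>h. defect h u v)) (at 0)"
  proof (rule has_derivative_transform_eventually[OF F])
    have eq: "F z = F (\<gamma> z)" if "A (\<theta> (\<gamma> z)) = A (x \<otimes> \<theta> z \<otimes> inv x)" for z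
    proof -
      have "F (\<gamma> z) = \<beta> (A (x \<otimes> (\<theta> z \<otimes> inv x)) u) (A (x \<otimes> (\<theta> z \<otimes> inv x)) v)"
        using x chart_carrier by (simp add: F_def that m_assoc)
      also have "\<dots> = \<beta> (A ((\<theta> z \<otimes> inv x) \<otimes> x) u) (A ((\<theta> z \<otimes> inv x) \<otimes> x) v)"
        using x chart_carrier by (intro form_commute connected solvable) auto
      also have "\<dots> = F z"
        using x chart_carrier by (simp add: F_def m_assoc)
      finally show ?thesis ..
    qed
    show "\<forall>\<^sub>F z in at 0 within UNIV. F z = F (\<gamma> z)"
      using ev eq by (auto simp: eventually_at_filter elim!: eventually_mono)
    show "F 0 = F (\<gamma> 0)"
      by (simp add: \<gamma>(2))
  qed simp
  ultimately have "(\<lambda>h. defect (A x h) u v) = (\<lambda>h. defect h u v)"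
    by (rule has_derivative_unique)
  then show ?thesis
    by meson
qed

text \<open>As a linear function of its first argument, \<open>defect\<close> takes the same value
  at y and at A (\<theta> (s x)) y. So it vanishes on the difference quotients whose limit is
  [x, y].\<close>

lemma defect_bracket: "defect (ad x y) u v = 0"
proof -
  have "((\<lambda>s. defect (((A (\<theta> (s *\<^sub>R x)) - id_blinfun) /\<^sub>R s) y) u v) \<longlongrightarrow> defect (ad x y) u v) (at_right 0)"
    by (intro bounded_linear.tendsto[OF bounded_linear_defect] tendsto_intros ad_quotient)
  moreover have "defect (((A (\<theta> (s *\<^sub>R x)) - id_blinfun) /\<^sub>R s) y) u v = 0" for s
    using defect_equivariant[OF chart_carrier]
    by (simp add: blinfun.bilinear_simps linear_simps[OF bounded_linear_defect])
  ultimately show ?thesis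
    by (simp add: tendsto_const_iff)
qed

text \<open>Brackets act by skew maps, which together with antisymmetry lets a bracket move across \<open>\<beta>\<close>.\<close>

lemma bracket_shift: "\<beta> (ad x (ad a b)) v = \<beta> x (ad (ad a b) v)"
  using defect_bracket[of a b x v] ad_antisym[of x "ad a b"] by (simp add: defect_def form_linear)

text \<open>A skew map S satisfies \<beta>(x, S x) = 0 by symmetry of \<beta>; take S = ad
  [a, b].\<close>

lemma bracket_self: "\<beta> x (ad x (ad a b)) = 0"
  using defect_bracket[of a b x x] ad_antisym[of x "ad a b"] symmetric[of x]
  by (simp add: defect_def form_linear)

text \<open>\<open>bracket_shift\<close> frees x in both terms, which become \<beta>(x, [[x,
  [x, u]], v]) and \<beta>(x, [[x, u], [x, v]]). By the Jacobi identity their sum is \<beta>(x, [x,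
  [[x, u], v]]), and \<open>bracket_self\<close> applies.\<close>

lemma defect_twice: "defect x (ad x (ad x u)) v = 0"
proof -
  have "defect x (ad x (ad x u)) v = \<beta> x (ad (ad x (ad x u)) v) + \<beta> x (ad (ad x u) (ad x v))"
    by (simp add: defect_def bracket_shift)
  also have "\<dots> = \<beta> x (ad x (ad (ad x u) v))"
    by (simp add: jacobi[of x "ad x u" v] form_linear)
  finally show ?thesis
    by (simp add: bracket_self)
qed

lemma defect_sym: "defect x u v = defect x v u"
  by (simp add: defect_def symmetric add.commute)

text \<open>After shifting, the two terms are \<beta>(x, [[a, b], [c, d]]) and \<beta>(x, [[c, d],
  [a, b]]), which cancel.\<close>

lemma defect_brackets: "defect x (ad a b) (ad c d) = 0"
proof -
  have "defect x (ad a b) (ad c d) = \<beta> x (ad (ad a b) (ad c d)) + \<beta> x (ad (ad c d) (ad a b))"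
    unfolding defect_def symmetric[of "ad a b" "ad x (ad c d)"] by (simp add: bracket_shift)
  then show ?thesis
    using ad_antisym[of "ad a b" "ad c d"] by (simp add: form_linear)
qed

text \<open>Let B be the form \<open>defect x\<close>. The third Lie derivative of \<beta> is the
  second one of B, namely B([x, [x, u]], v) + 2 B([x, u], [x, v]) + B(u, [x, [x, v]]). The outer
  terms vanish by \<open>defect_twice\<close>, the middle one by
  \<open>defect_brackets\<close>.\<close>

lemma defect_zero: "defect x u v = 0"
proof -
  have "\<beta> (ad x (ad x (ad x u))) v + 3 * \<beta> (ad x (ad x u)) (ad x v) +
      3 * \<beta> (ad x u) (ad x (ad x v)) + \<beta> u (ad x (ad x (ad x v))) = 0" for u v
  proof -
    have "defect x (ad x (ad x u)) v + 2 * defect x (ad x u) (ad x v) + defect x u (ad x (ad x v)) = 0"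
      by (simp add: defect_twice defect_brackets defect_sym[of x u])
    then show ?thesis
      by (simp add: defect_def)
  qed
  then show ?thesis
    unfolding defect_def
    by (intro skew_if_third_derivative_zero[OF chart_carrier ad_quotient])
qed

text \<open>The function F(z) = \<beta>(A(\<theta> z) u, A(\<theta> z) v) has derivative 0 at every
  y of a ball, not just at 0: near y, the operator of \<theta> z is that of \<theta>(\<gamma> z)
  \<theta> y, so the derivative of F at y comes from one at 0 with A(\<theta> y) u and A(\<theta> y)
  v in place of u and v. Hence F is constant on the ball.\<close>

lemma invariant_near_one: "\<exists>V. openin X V \<and> \<one> \<in> V \<and> (\<forall>x\<in>V. \<forall>u v. \<beta> (A x u) (A x v) = \<beta> u v)"
proof -
  obtain d where d: "d > 0" and shift: "\<forall>y\<in>ball 0 d. \<exists>\<gamma> \<gamma>'. (\<gamma> has_derivative \<gamma>') (at y) \<and> \<gamma> y = 0 \<and>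
      (\<forall>\<^sub>F z in nhds y. A (\<theta> z) = A (\<theta> (\<gamma> z) \<otimes> \<theta> y))"
    using chart_shift by blast
  have const: "\<beta> (A (\<theta> z) u) (A (\<theta> z) v) = \<beta> u v" if z: "z \<in> ball 0 d" for z u v
  proof -
    define F where "F z = \<beta> (A (\<theta> z) u) (A (\<theta> z) v)" for z
    have "(F has_derivative (\<lambda>h. 0)) (at y within ball 0 d)" if y: "y \<in> ball 0 d" for y
    proof -
      obtain \<gamma> \<gamma>' where \<gamma>: "(\<gamma> has_derivative \<gamma>') (at y)" "\<gamma> y = 0"
        and ev: "\<forall>\<^sub>F z in nhds y. A (\<theta> z) = A (\<theta> (\<gamma> z) \<otimes> \<theta> y)"
        using shift y by blast
      define H where "H z = \<beta> (A (\<theta> z) (A (\<theta> y) u)) (A (\<theta> z) (A (\<theta> y) v))" for z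
      have "(H has_derivative (\<lambda>h. 0)) (at 0)"
        using defect_deriv[of "A (\<theta> y) u" "A (\<theta> y) v"] by (simp add: H_def[abs_def] defect_zero)
      then have "((\<lambda>z. H (\<gamma> z)) has_derivative (\<lambda>h. 0)) (at y)"
        using has_derivative_compose[OF \<gamma>(1), of H "\<lambda>h. 0"] by (simp add: \<gamma>(2))
      moreover have "H (\<gamma> z) = F z" if "A (\<theta> z) = A (\<theta> (\<gamma> z) \<otimes> \<theta> y)" for z
        unfolding H_def F_def that using chart_carrier by (simp add: rep_mult)
      ultimately have "(F has_derivative (\<lambda>h. 0)) (at y)"
        using ev by (auto intro!: has_derivative_transform_eventually[where f = "\<lambda>z. H (\<gamma> z)"]
            simp: eventually_at_filter elim!: eventually_mono dest: eventually_nhds_x_imp_x)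
      then show ?thesis
        by (rule has_derivative_at_withinI)
    qed
    then have "F z = F 0"
      using z d by (intro has_derivative_zero_unique[OF convex_ball[of 0 d], of F]) auto
    then show ?thesis
      by (simp add: F_def)
  qed
  obtain V where "openin X V" "\<one> \<in> V" "V \<subseteq> \<theta> ` ball 0 d"
    using chart_nbhd[OF d] by blast
  then show ?thesis
    using const by blast
qed

theorem form_invariant:
  assumes "x \<in> carrier G"
  shows "\<beta> (A x u) (A x v) = \<beta> u v"
proof -
  define S where "S = {x \<in> carrier G. \<forall>u v. \<beta> (A x u) (A x v) = \<beta> u v}"
  obtain V where V: "openin X V" "\<one> \<in> V" "\<And>x u v. x \<in> V \<Longrightarrow> \<beta> (A x u) (A x v) = \<beta> u v"
    using invariant_near_one by blast
  have S_mult: "x \<otimes> y \<in> S" if "x \<in> S" "y \<in> S" for x y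
    using that by (simp add: S_def rep_mult)
  have S_inv: "inv x \<in> S" if "x \<in> S" for x
  proof -
    have x: "x \<in> carrier G"
      using that by (simp add: S_def)
    have "A x o\<^sub>L A (inv x) = id_blinfun"
      using x by (simp add: rep_mult[symmetric] rep_one)
    then have "A x (A (inv x) u) = u" for u
      by (metis blinfun_apply_blinfun_compose blinfun_apply_id_blinfun)
    then have "\<beta> (A (inv x) u) (A (inv x) v) = \<beta> u v" for u v
      using that by (simp add: S_def) metis
    then show ?thesis
      using x by (simp add: S_def)
  qed
  \<comment> \<open>\<open>N x\<close> is the translate x V. If x preserves \<beta>, then so does
    every element of it; otherwise none does. This makes both the stabilizer and its complement
    open.\<close>
  define N where "N x = {y \<in> topspace X. inv x \<otimes> y \<in> V}" for x
  have N_open: "openin X (N x)" if "x \<in> carrier G" for x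
  proof -
    have "continuous_map X X (\<lambda>y. inv x \<otimes> y)"
      using that by (intro continuous_map_mult) (simp_all add: space)
    then show ?thesis
      unfolding N_def using V(1) by (rule openin_continuous_map_preimage)
  qed
  have N_self: "x \<in> N x" if "x \<in> carrier G" for x
    using that V(2) by (simp add: N_def space)
  have N_S: "inv x \<otimes> y \<in> S" if "x \<in> carrier G" "y \<in> N x" for x y
    using that V(3) by (simp add: N_def S_def space)
  have "openin X S"
  proof (subst openin_subopen, intro ballI)
    fix x assume x: "x \<in> S"
    then have xG: "x \<in> carrier G"
      by (simp add: S_def)
    have "N x \<subseteq> S"
    proof
      fix y assume y: "y \<in> N x"
      then have "x \<otimes> (inv x \<otimes> y) \<in> S" and yG: "y \<in> carrier G"
        using S_mult[OF x N_S[OF xG y]] by (auto simp: N_def space)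
      then show "y \<in> S"
        using xG by (simp add: m_assoc[symmetric])
    qed
    then show "\<exists>T. openin X T \<and> x \<in> T \<and> T \<subseteq> S"
      using N_open N_self xG by blast
  qed
  moreover have "openin X (topspace X - S)"
  proof (subst openin_subopen, intro ballI)
    fix x assume "x \<in> topspace X - S"
    then have xG: "x \<in> carrier G" and xS: "x \<notin> S"
      by (auto simp: space)
    have "y \<notin> S" if y: "y \<in> N x" for y
    proof
      assume yS: "y \<in> S"
      have "y \<otimes> inv (inv x \<otimes> y) \<in> S"
        using S_mult[OF yS S_inv[OF N_S[OF xG y]]] .
      moreover have "y \<otimes> inv (inv x \<otimes> y) = x"
        using xG yS by (simp add: S_def inv_mult_group m_assoc[symmetric])
      ultimately show False
        using xS by simp
    qed
    then show "\<exists>T. openin X T \<and> x \<in> T \<and> T \<subseteq> topspace X - S"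
      using N_open[OF xG] N_self[OF xG] by (intro exI[of _ "N x"]) (auto simp: N_def)
  qed
  ultimately have "S = {} \<or> S = topspace X"
    using connected by (auto simp: connected_space_clopen_in closedin_def openin_subset)
  moreover have "\<one> \<in> S"
    by (simp add: S_def rep_one)
  ultimately have "x \<in> S"
    using assms by (auto simp: space)
  then show ?thesis
    by (simp add: S_def)
qed

end

section \<open>Derivatives within a subspace\<close>

lemma at_within_openin:
  assumes "openin (top_of_set E) S" "x \<in> S"
  shows "at x within S = at x within E"
proof -
  obtain T where T: "open T" "S = E \<inter> T"
    using assms(1) by (auto simp: openin_open)
  have "at x within S = at x within (E \<inter> T)"
    by (simp add: T)
  also have "\<dots> = at x within E"
    using T assms(2) by (intro at_within_nhd[where S = T]) auto
  finally show ?thesis .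
qed

text \<open>\<open>deriv_at\<close> selects some derivative within \<open>E\<close>, and two
  derivatives may differ off \<open>E\<close>. In a direction v of \<open>E\<close> each of them
  gives the velocity of f along the line x + t v, which stays in \<open>E\<close>; this determines
  the value.\<close>

lemma deriv_at_eq:
  assumes "subspace E" "x \<in> E" "v \<in> E"
    and "(f has_derivative D) (at x within E)"
  shows "deriv_at E f x v = D v"
proof -
  have *: "((\<lambda>t. f (x + t *\<^sub>R v)) has_vector_derivative F v) (at 0)"
    if "(f has_derivative F) (at x within E)" for F
  proof -
    have "range (\<lambda>t. x + t *\<^sub>R v) \<subseteq> E"
      using assms(1-3) by (auto intro: subspace_add subspace_scale)
    with that have "(f has_derivative F) (at (x + 0 *\<^sub>R v) within range (\<lambda>t. x + t *\<^sub>R v))"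
      by (auto intro: has_derivative_subset)
    then have "((\<lambda>t. f (x + t *\<^sub>R v)) has_derivative (\<lambda>t. F (t *\<^sub>R v))) (at 0)"
      by (rule has_derivative_in_compose[rotated]) (auto intro!: derivative_eq_intros)
    moreover have "F (t *\<^sub>R v) = t *\<^sub>R F v" for t
      using that by (simp add: has_derivative_bounded_linear linear_simps)
    ultimately show ?thesis
      by (simp add: has_vector_derivative_def)
  qed
  have "f differentiable (at x within E)"
    using assms(4) by (auto simp: differentiable_def)
  then have "(f has_derivative deriv_at E f x) (at x within E)"
    by (simp add: frechet_derivative_works)
  from vector_derivative_unique_at[OF *[OF this] *[OF assms(4)]] show ?thesis .
qed

lemma has_derivative_openin_cong:
  assumes "openin (top_of_set E) S" "x \<in> S" "\<And>z. z \<in> S \<Longrightarrow> f z = g z"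
  shows "(f has_derivative D) (at x within E) \<longleftrightarrow> (g has_derivative D) (at x within E)"
  unfolding at_within_openin[OF assms(1,2), symmetric]
  using assms(2,3) by (metis has_derivative_transform)

lemma deriv_at_cong:
  assumes "openin (top_of_set E) S" "x \<in> S" "\<And>z. z \<in> S \<Longrightarrow> f z = g z"
  shows "deriv_at E f x = deriv_at E g x"
  using has_derivative_openin_cong[OF assms] unfolding frechet_derivative_def by simp

lemma differentiable_openin_cong:
  assumes "openin (top_of_set E) S" "x \<in> S" "\<And>z. z \<in> S \<Longrightarrow> f z = g z"
  shows "f differentiable (at x within E) \<longleftrightarrow> g differentiable (at x within E)"
  using has_derivative_openin_cong[OF assms] unfolding differentiable_def by simp

text \<open>On S, f equals P o f for a projection P onto \<open>F\<close>. So the derivative and its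
  composition with P are both derivatives of f, and they agree on directions of
  \<open>E\<close>.\<close>

lemma deriv_at_in_subspace:
  fixes F :: "'f::euclidean_space set"
  assumes "subspace E" "v \<in> E" and S: "openin (top_of_set E) S" "x \<in> S"
    and f: "f differentiable (at x within E)" and "subspace F" and fF: "\<And>z. z \<in> S \<Longrightarrow> f z \<in> F"
  shows "deriv_at E f x v \<in> F"
proof -
  have xE: "x \<in> E"
    using S openin_imp_subset by blast
  obtain P :: "'f \<Rightarrow>\<^sub>L 'f" where P: "\<And>y. P y \<in> F" "\<And>y. y \<in> F \<Longrightarrow> P y = y"
    using subspace_projection[OF \<open>subspace F\<close>] by metis
  have D: "(f has_derivative deriv_at E f x) (at x within E)"
    using f by (simp add: frechet_derivative_works)
  then have "((\<lambda>z. P (f z)) has_derivative (\<lambda>h. P (deriv_at E f x h))) (at x within E)"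
    by (rule bounded_linear.has_derivative[OF blinfun.bounded_linear_right])
  then have "(f has_derivative (\<lambda>h. P (deriv_at E f x h))) (at x within E)"
    by (subst has_derivative_openin_cong[OF S, of f "\<lambda>z. P (f z)"]) (simp_all add: P(2) fF)
  then have "deriv_at E f x v = P (deriv_at E f x v)"
    by (rule deriv_at_eq[OF \<open>subspace E\<close> xE \<open>v \<in> E\<close>])
  then show ?thesis
    using P(1) by metis
qed

lemma has_derivative_compose_openin:
  assumes S: "openin (top_of_set E) S" "x \<in> S" and fS: "f ` S \<subseteq> F"
    and f: "(f has_derivative f') (at x within E)"
    and g: "(g has_derivative g') (at (f x) within F)"
  shows "((g \<circ> f) has_derivative (g' \<circ> f')) (at x within E)"
proof -
  have "(f has_derivative f') (at x within S)"
    using f by (simp add: at_within_openin[OF S])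
  moreover have "(g has_derivative g') (at (f x) within f ` S)"
    using g fS by (rule has_derivative_subset)
  ultimately have "((\<lambda>z. g (f z)) has_derivative (\<lambda>h. g' (f' h))) (at x within S)"
    by (rule has_derivative_in_compose)
  then show ?thesis
    by (simp add: at_within_openin[OF S] o_def)
qed

lemma Ck_on_cong:
  assumes "openin (top_of_set E) S" "\<And>z. z \<in> S \<Longrightarrow> f z = g z"
  shows "Ck_on k E S f \<longleftrightarrow> Ck_on k E S g"
  using assms(2)
proof (induction k arbitrary: f g)
  case 0
  then show ?case
    by (simp cong: continuous_on_cong)
next
  case (Suc k)
  have "Ck_on k E S (\<lambda>x. deriv_at E f x v) \<longleftrightarrow> Ck_on k E S (\<lambda>x. deriv_at E g x v)" for v
  proof (rule Suc.IH)
    show "deriv_at E f z v = deriv_at E g z v" if "z \<in> S" for z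
      using deriv_at_cong[OF assms(1) that Suc.prems] by simp
  qed
  moreover have "f differentiable (at x within E) \<longleftrightarrow> g differentiable (at x within E)" if "x \<in> S" for x
    using differentiable_openin_cong[OF assms(1) that] Suc.prems by blast
  ultimately show ?case
    by simp
qed

text \<open>\<open>Ck_on\<close> iterates derivatives in fixed directions. After precomposition with
  an affine map, the derivative in direction v is the derivative of f in the fixed direction l v,
  precomposed with the same map, so the induction closes. Translations and the extended
  multiplication are obtained from the smooth multiplication in this way.\<close>

lemma Ck_on_affine:
  assumes E: "subspace E" and S: "openin (top_of_set E) S" and T: "T \<subseteq> F"
    and l: "bounded_linear l" "l ` E \<subseteq> F" and q: "\<And>z. z \<in> S \<Longrightarrow> a + l z \<in> T"
    and F: "subspace F"
    and f: "Ck_on k F T f"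
  shows "Ck_on k E S (\<lambda>z. f (a + l z))"
  using f
proof (induction k arbitrary: f)
  case 0
  have "continuous_on S (\<lambda>z. a + l z)"
    using l(1) by (intro continuous_intros linear_continuous_on)
  then show ?case
    using 0 q continuous_on_compose2[of T f S "\<lambda>z. a + l z"] by auto
next
  case (Suc k)
  have D: "((\<lambda>z. f (a + l z)) has_derivative (\<lambda>h. deriv_at F f (a + l x) (l h))) (at x within E)"
    if x: "x \<in> S" for x
  proof -
    have "(f has_derivative deriv_at F f (a + l x)) (at (a + l x) within F)"
      using Suc.prems q[OF x] by (simp add: frechet_derivative_works)
    moreover have "((\<lambda>z. a + l z) has_derivative l) (at x within E)"
      using has_derivative_add[OF has_derivative_const bounded_linear_imp_has_derivative[OF l(1)]] by simp
    ultimately show ?thesis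
      using has_derivative_compose_openin[OF S x, of "\<lambda>z. a + l z" F l f] q T
      by (auto simp: o_def)
  qed
  have "Ck_on k E S (\<lambda>x. deriv_at E (\<lambda>z. f (a + l z)) x v)" if v: "v \<in> E" for v
  proof (subst Ck_on_cong[OF S])
    show "deriv_at E (\<lambda>z. f (a + l z)) x v = deriv_at F f (a + l x) (l v)" if "x \<in> S" for x
      using deriv_at_eq[OF E _ v D[OF that]] S that openin_imp_subset by blast
    show "Ck_on k E S (\<lambda>x. deriv_at F f (a + l x) (l v))"
      using Suc.prems l(2) v by (intro Suc.IH) auto
  qed
  then show ?case
    using D by (auto simp: differentiable_def)
qed

section \<open>Symmetry of second derivatives\<close>

lemma bounded_linear_along:
  fixes D :: "'c::real_normed_vector \<Rightarrow> real"
  assumes "bounded_linear D"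
  shows "(\<lambda>h. D (h *\<^sub>R v)) = (*) (D v)"
  using assms by (intro ext) (simp add: linear_simps)

text \<open>The mean value theorem is applied twice: in direction v to the difference of f along two
  parallel segments, then in direction w to the directional derivative.\<close>

lemma second_difference:
  fixes f :: "'c::euclidean_space \<Rightarrow> real"
  assumes s: "0 < s"
    and f: "\<And>a b. a \<in> {0..s} \<Longrightarrow> b \<in> {0..s} \<Longrightarrow> f differentiable (at (x + a *\<^sub>R v + b *\<^sub>R w))"
    and fv: "\<And>a b. a \<in> {0..s} \<Longrightarrow> b \<in> {0..s} \<Longrightarrow>
      (\<lambda>y. deriv_at UNIV f y v) differentiable (at (x + a *\<^sub>R v + b *\<^sub>R w))"
  obtains a b where "a \<in> {0..s}" "b \<in> {0..s}"
    "f (x + s *\<^sub>R v + s *\<^sub>R w) - f (x + s *\<^sub>R v) - f (x + s *\<^sub>R w) + f x =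
      s * s * deriv_at UNIV (\<lambda>y. deriv_at UNIV f y v) (x + a *\<^sub>R v + b *\<^sub>R w) w"
proof -
  \<comment> \<open>The term \<open>0 *\<^sub>R w\<close> gives both summands the same shape, so
    that \<open>Df\<close> applies with b = s and with b = 0.\<close>
  define g where "g t = f (x + t *\<^sub>R v + s *\<^sub>R w) - f (x + t *\<^sub>R v + 0 *\<^sub>R w)" for t
  have Df: "((\<lambda>t. f (x + t *\<^sub>R v + b *\<^sub>R w)) has_real_derivative deriv_at UNIV f (x + t *\<^sub>R v + b *\<^sub>R w) v) (at t)"
    if "t \<in> {0..s}" "b \<in> {0..s}" for t b
  proof -
    have "((\<lambda>t. f (x + t *\<^sub>R v + b *\<^sub>R w)) has_derivative
        (\<lambda>h. deriv_at UNIV f (x + t *\<^sub>R v + b *\<^sub>R w) (h *\<^sub>R v))) (at t)"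
      using f[OF that] by (intro has_derivative_compose[of "\<lambda>t. x + t *\<^sub>R v + b *\<^sub>R w" "\<lambda>h. h *\<^sub>R v" _ UNIV f])
        (auto intro!: derivative_eq_intros simp: frechet_derivative_works)
    moreover have "bounded_linear (deriv_at UNIV f (x + t *\<^sub>R v + b *\<^sub>R w))"
      by (rule has_derivative_bounded_linear[OF f[OF that, unfolded frechet_derivative_works]])
    ultimately show ?thesis
      by (simp add: has_field_derivative_def bounded_linear_along)
  qed
  have "\<exists>a>0. a < s \<and> g s - g 0 =
      (s - 0) * (deriv_at UNIV f (x + a *\<^sub>R v + s *\<^sub>R w) v - deriv_at UNIV f (x + a *\<^sub>R v + 0 *\<^sub>R w) v)"
    unfolding g_def using s by (intro MVT2 DERIV_diff Df) auto
  then obtain a where a: "0 < a" "a < s" and ga: "g s - g 0 =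
      s * (deriv_at UNIV f (x + a *\<^sub>R v + s *\<^sub>R w) v - deriv_at UNIV f (x + a *\<^sub>R v + 0 *\<^sub>R w) v)"
    by auto
  have Dfv: "((\<lambda>b. deriv_at UNIV f (x + a *\<^sub>R v + b *\<^sub>R w) v) has_real_derivative
      deriv_at UNIV (\<lambda>y. deriv_at UNIV f y v) (x + a *\<^sub>R v + b *\<^sub>R w) w) (at b)"
    if "b \<in> {0..s}" for b
  proof -
    let ?h = "\<lambda>y. deriv_at UNIV f y v"
    have d: "?h differentiable (at (x + a *\<^sub>R v + b *\<^sub>R w))"
      using fv that a by auto
    have "((\<lambda>b. ?h (x + a *\<^sub>R v + b *\<^sub>R w)) has_derivative
        (\<lambda>h. deriv_at UNIV ?h (x + a *\<^sub>R v + b *\<^sub>R w) (h *\<^sub>R w))) (at b)"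
      using d by (intro has_derivative_compose[of "\<lambda>b. x + a *\<^sub>R v + b *\<^sub>R w" "\<lambda>h. h *\<^sub>R w" _ UNIV ?h])
        (auto intro!: derivative_eq_intros simp: frechet_derivative_works)
    moreover have "bounded_linear (deriv_at UNIV ?h (x + a *\<^sub>R v + b *\<^sub>R w))"
      by (rule has_derivative_bounded_linear[OF d[unfolded frechet_derivative_works]])
    ultimately show ?thesis
      by (simp add: has_field_derivative_def bounded_linear_along)
  qed
  have "\<exists>b>0. b < s \<and> deriv_at UNIV f (x + a *\<^sub>R v + s *\<^sub>R w) v - deriv_at UNIV f (x + a *\<^sub>R v + 0 *\<^sub>R w) v =
      (s - 0) * deriv_at UNIV (\<lambda>y. deriv_at UNIV f y v) (x + a *\<^sub>R v + b *\<^sub>R w) w"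
    using s by (intro MVT2 Dfv) auto
  then obtain b where b: "0 < b" "b < s" and
    gb: "deriv_at UNIV f (x + a *\<^sub>R v + s *\<^sub>R w) v - deriv_at UNIV f (x + a *\<^sub>R v + 0 *\<^sub>R w) v =
      s * deriv_at UNIV (\<lambda>y. deriv_at UNIV f y v) (x + a *\<^sub>R v + b *\<^sub>R w) w"
    by auto
  show ?thesis
    using a b ga[unfolded gb] by (intro that[of a b]) (auto simp: g_def)
qed

text \<open>The second difference over the parallelogram spanned by s v and s w is symmetric in v
  and w. So a value of one mixed derivative near x equals a value of the other near x, and
  continuity at x concludes.\<close>

lemma second_derivative_symmetric_real:
  fixes f :: "'c::euclidean_space \<Rightarrow> real"
  assumes W: "open W" "x \<in> W" and f: "Ck_on 2 UNIV W f"
  shows "deriv_at UNIV (\<lambda>y. deriv_at UNIV f y v) x w = deriv_at UNIV (\<lambda>y. deriv_at UNIV f y w) x v"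
proof -
  define D where "D v w y = deriv_at UNIV (\<lambda>y. deriv_at UNIV f y v) y w" for v w y
  have f1: "f differentiable (at y)" if "y \<in> W" for y
    using f that by (simp add: numeral_2_eq_2)
  have f2: "(\<lambda>y. deriv_at UNIV f y v) differentiable (at y)" if "y \<in> W" for y v
    using f that by (simp add: numeral_2_eq_2)
  have f3: "continuous_on W (D v w)" for v w
    using f unfolding D_def by (simp add: numeral_2_eq_2)
  have "\<bar>D v w x - D w v x\<bar> \<le> e" if e: "e > 0" for e
  proof -
    have "\<exists>d>0. \<forall>y\<in>W. dist y x < d \<longrightarrow> dist (D v w y) (D v w x) < e / 2" for v w
      using f3[of v w] W(2) e unfolding continuous_on_iff by (meson half_gt_zero)
    then obtain d1 d2 where d: "d1 > 0" "d2 > 0"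
      and d1: "\<And>y. y \<in> W \<Longrightarrow> dist y x < d1 \<Longrightarrow> dist (D v w y) (D v w x) < e / 2"
      and d2: "\<And>y. y \<in> W \<Longrightarrow> dist y x < d2 \<Longrightarrow> dist (D w v y) (D w v x) < e / 2"
      by metis
    obtain d0 where d0: "d0 > 0" "ball x d0 \<subseteq> W"
      using W open_contains_ball by blast
    define d where "d = min d0 (min d1 d2)"
    \<comment> \<open>Every point of the parallelogram is within s K = d / 2 of x; the summand 1
      covers v = w = 0.\<close>
    define K where "K = norm v + norm w + 1"
    define s where "s = d / (2 * K)"
    have K: "K > 0"
      unfolding K_def by (simp add: add_nonneg_pos)
    have d_pos: "d > 0"
      using d d0 by (simp add: d_def)
    then have s: "s > 0"
      using K by (simp add: s_def)
    have near: "dist (x + a *\<^sub>R v + b *\<^sub>R w) x < d" if "a \<in> {0..s}" "b \<in> {0..s}" for a b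
    proof -
      have "dist (x + a *\<^sub>R v + b *\<^sub>R w) x \<le> a * norm v + b * norm w"
        using that norm_triangle_ineq[of "a *\<^sub>R v" "b *\<^sub>R w"] by (simp add: dist_norm add.assoc)
      also have "\<dots> \<le> s * norm v + s * norm w"
        using that by (intro add_mono mult_right_mono) auto
      also have "\<dots> \<le> s * K"
        using s by (simp add: K_def algebra_simps)
      also have "\<dots> < d"
        using K d_pos by (simp add: s_def)
      finally show ?thesis .
    qed
    have inO: "x + a *\<^sub>R v + b *\<^sub>R w \<in> W" if "a \<in> {0..s}" "b \<in> {0..s}" for a b
      using near[OF that] d0 by (auto simp: d_def dist_commute)
    have inO': "x + a *\<^sub>R w + b *\<^sub>R v \<in> W" if "a \<in> {0..s}" "b \<in> {0..s}" for a b
      using inO[OF that(2,1)] by (simp add: add_ac)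
    obtain a b where ab: "a \<in> {0..s}" "b \<in> {0..s}" and eq1:
      "f (x + s *\<^sub>R v + s *\<^sub>R w) - f (x + s *\<^sub>R v) - f (x + s *\<^sub>R w) + f x = s * s * D v w (x + a *\<^sub>R v + b *\<^sub>R w)"
      unfolding D_def by (rule second_difference[OF s f1[OF inO] f2[OF inO]])
    obtain a' b' where ab': "a' \<in> {0..s}" "b' \<in> {0..s}" and eq2:
      "f (x + s *\<^sub>R w + s *\<^sub>R v) - f (x + s *\<^sub>R w) - f (x + s *\<^sub>R v) + f x = s * s * D w v (x + a' *\<^sub>R w + b' *\<^sub>R v)"
      unfolding D_def by (rule second_difference[OF s f1[OF inO'] f2[OF inO']])
    have "s * s * D v w (x + a *\<^sub>R v + b *\<^sub>R w) = s * s * D w v (x + a' *\<^sub>R w + b' *\<^sub>R v)"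
    proof -
      have "f (x + s *\<^sub>R w + s *\<^sub>R v) = f (x + s *\<^sub>R v + s *\<^sub>R w)"
        by (simp add: add_ac)
      then show ?thesis
        using eq1 eq2 by linarith
    qed
    then have "D v w (x + a *\<^sub>R v + b *\<^sub>R w) = D w v (x + a' *\<^sub>R w + b' *\<^sub>R v)"
      using s by simp
    moreover have "dist (D v w (x + a *\<^sub>R v + b *\<^sub>R w)) (D v w x) < e / 2"
      using near[OF ab] inO[OF ab] by (intro d1) (auto simp: d_def)
    moreover have "dist (D w v (x + a' *\<^sub>R w + b' *\<^sub>R v)) (D w v x) < e / 2"
      using near[OF ab'(2,1)] inO'[OF ab'] by (intro d2) (auto simp: d_def add_ac)
    ultimately show ?thesis
      unfolding dist_real_def by linarith
  qed
  then have "\<bar>D v w x - D w v x\<bar> \<le> 0"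
    by (rule field_le_epsilon) simp
  then show ?thesis
    by (simp add: D_def)
qed

lemma second_derivative_symmetric:
  fixes f :: "'c::euclidean_space \<Rightarrow> 'f::euclidean_space"
  assumes W: "open W" "x \<in> W" and f: "Ck_on 2 UNIV W f"
  shows "deriv_at UNIV (\<lambda>y. deriv_at UNIV f y v) x w = deriv_at UNIV (\<lambda>y. deriv_at UNIV f y w) x v"
proof (rule euclidean_eqI)
  fix i :: 'f assume "i \<in> Basis"
  have oO: "openin (top_of_set UNIV) W"
    using W by simp
  have inner1: "deriv_at UNIV (\<lambda>y. h y \<bullet> i) y v = deriv_at UNIV h y v \<bullet> i"
    if "h differentiable (at y)" for h :: "'c \<Rightarrow> 'f" and y v
  proof (rule deriv_at_eq)
    show "((\<lambda>y. h y \<bullet> i) has_derivative (\<lambda>v. deriv_at UNIV h y v \<bullet> i)) (at y)"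
      using that by (intro bounded_linear.has_derivative[OF bounded_linear_inner_left])
        (simp add: frechet_derivative_works)
  qed auto
  have f1: "f differentiable (at y)" if "y \<in> W" for y
    using f that by (simp add: numeral_2_eq_2)
  have f2: "(\<lambda>y. deriv_at UNIV f y v) differentiable (at y)" if "y \<in> W" for y v
    using f that by (simp add: numeral_2_eq_2)
  have f3: "continuous_on W (\<lambda>y. deriv_at UNIV (\<lambda>y. deriv_at UNIV f y v) y w)" for v w
    using f by (simp add: numeral_2_eq_2)
  have c1: "deriv_at UNIV (\<lambda>y. f y \<bullet> i) y v = deriv_at UNIV f y v \<bullet> i" if "y \<in> W" for y v
    using that by (intro inner1 f1)
  have c2: "deriv_at UNIV (\<lambda>y. deriv_at UNIV (\<lambda>y. f y \<bullet> i) y v) y w =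
      deriv_at UNIV (\<lambda>y. deriv_at UNIV f y v) y w \<bullet> i" if y: "y \<in> W" for y v w
    using deriv_at_cong[OF oO y, of "\<lambda>y. deriv_at UNIV (\<lambda>y. f y \<bullet> i) y v" "\<lambda>y. deriv_at UNIV f y v \<bullet> i"]
    by (simp add: c1 inner1[OF f2[OF y]])
  have inner_diff: "(\<lambda>y. h y \<bullet> i) differentiable (at y)" if "h differentiable (at y)"
    for h :: "'c \<Rightarrow> 'f" and y
    using that by (intro differentiable_inner) auto
  have "Ck_on 2 UNIV W (\<lambda>y. f y \<bullet> i)"
  proof -
    have "(\<lambda>y. f y \<bullet> i) differentiable (at y)" if "y \<in> W" for y
      using that by (intro inner_diff f1)
    moreover have "(\<lambda>y. deriv_at UNIV (\<lambda>y. f y \<bullet> i) y v) differentiable (at y)" if y: "y \<in> W" for y v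
      using inner_diff[OF f2[OF y, of v]]
        differentiable_openin_cong[OF oO y, of "\<lambda>y. deriv_at UNIV (\<lambda>y. f y \<bullet> i) y v"
          "\<lambda>y. deriv_at UNIV f y v \<bullet> i", OF c1] by simp
    moreover have "continuous_on W (\<lambda>y. deriv_at UNIV (\<lambda>y. deriv_at UNIV (\<lambda>y. f y \<bullet> i) y v) y w)" for v w
      using continuous_on_inner[OF f3[of v w] continuous_on_const, of i]
      by (simp add: c2 cong: continuous_on_cong)
    ultimately show ?thesis
      by (simp add: numeral_2_eq_2)
  qed
  from second_derivative_symmetric_real[OF W this, of v w]
  show "deriv_at UNIV (\<lambda>y. deriv_at UNIV f y v) x w \<bullet> i = deriv_at UNIV (\<lambda>y. deriv_at UNIV f y w) x v \<bullet> i"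
    by (simp add: c2 W)
qed

section \<open>Operator-valued maps\<close>

text \<open>On a Euclidean space an operator g is the sum, over the basis vectors b, of the rank-one
  operators formed from g b and the inner product with b. This is a fixed bounded linear expression
  in finitely many values of g.\<close>

lemma has_derivative_blinfun_componentwise:
  fixes f f' :: "'c::real_normed_vector \<Rightarrow> 'e::euclidean_space \<Rightarrow>\<^sub>L 'f::real_normed_vector"
  assumes "\<And>v. ((\<lambda>x. f x v) has_derivative (\<lambda>h. f' h v)) (at x)"
  shows "(f has_derivative f') (at x)"
proof -
  have rep: "g = (\<Sum>b\<in>Basis. blinfun_scaleR_left (g b) o\<^sub>L blinfun_inner_left b)"
    for g :: "'e \<Rightarrow>\<^sub>L 'f"
  proof (rule blinfun_eqI)
    fix v
    have "g v = g (\<Sum>b\<in>Basis. (v \<bullet> b) *\<^sub>R b)"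
      by (simp add: euclidean_representation)
    then show "g v = (\<Sum>b\<in>Basis. blinfun_scaleR_left (g b) o\<^sub>L blinfun_inner_left b) v"
      by (simp add: blinfun.bilinear_simps blinfun.sum_left blinfun.sum_right inner_commute)
  qed
  have "((\<lambda>x. \<Sum>b\<in>Basis. blinfun_scaleR_left (f x b) o\<^sub>L blinfun_inner_left b) has_derivative
      (\<lambda>h. \<Sum>b\<in>Basis. blinfun_scaleR_left (f' h b) o\<^sub>L blinfun_inner_left b)) (at x)"
    by (intro has_derivative_sum bounded_linear.has_derivative[OF bounded_bilinear.bounded_linear_left[OF bounded_bilinear_blinfun_compose]]
        bounded_linear.has_derivative[OF bounded_linear_blinfun_scaleR_left] assms)
  then show ?thesis
    by (simp add: rep[symmetric])
qed

text \<open>This differentiates R^-1 L without inverting R and without prior continuity of \<Psi>.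
  With N = R - 1, K = L - R and E = \<Psi> - 1 - K, the equation R \<Psi> = L becomes E = -N (\<Psi>
  - 1). Where N has norm below 1/2, \<Psi> - 1 is at most twice K in norm, so E is at most 2 |N|
  |K|, which is o(z).\<close>

lemma has_derivative_left_quotient:
  fixes R L \<Psi> r l :: "'c::real_normed_vector \<Rightarrow> 'e::real_normed_vector \<Rightarrow>\<^sub>L 'e"
  assumes R: "(R has_derivative r) (at 0)" and L: "(L has_derivative l) (at 0)"
    and R0: "R 0 = id_blinfun" and L0: "L 0 = id_blinfun" and \<Psi>0: "\<Psi> 0 = id_blinfun"
    and eq: "\<forall>\<^sub>F z in nhds 0. R z o\<^sub>L \<Psi> z = L z"
  shows "(\<Psi> has_derivative (\<lambda>h. l h - r h)) (at 0)"
proof -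
  define N where "N z = R z - id_blinfun" for z
  define K where "K z = L z - R z" for z
  define E where "E z = \<Psi> z - id_blinfun - K z" for z
  have K: "(K has_derivative (\<lambda>h. l h - r h)) (at 0)"
    unfolding K_def[abs_def] by (intro has_derivative_diff L R)
  have K0: "K 0 = 0" and E0: "E 0 = 0" and N0: "N 0 = 0"
    by (simp_all add: K_def E_def N_def R0 L0 \<Psi>0)
  have N_lim: "(N \<longlongrightarrow> 0) (nhds 0)"
  proof -
    have "(R \<longlongrightarrow> R 0) (nhds 0)"
      using has_derivative_continuous[OF R] by (simp add: isCont_def tendsto_at_iff_tendsto_nhds)
    from tendsto_diff[OF this tendsto_const[of id_blinfun]] show ?thesis
      by (simp add: N_def[abs_def] R0)
  qed
  obtain C d where C: "C \<ge> 0" "d > 0" and K_le: "\<And>z. norm z < d \<Longrightarrow> norm (K z) \<le> C * norm z"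
  proof -
    obtain d where d: "d > 0" "\<And>z. norm z < d \<Longrightarrow> norm (K z - (l z - r z)) \<le> 1 * norm z"
      using K unfolding has_derivative_at_alt by (auto simp: K0 dest!: spec[of _ 1])
    obtain B where B: "B > 0" "\<And>z. norm (l z - r z) \<le> norm z * B"
      using bounded_linear.pos_bounded[OF has_derivative_bounded_linear[OF K]] by blast
    have "norm (K z) \<le> (B + 1) * norm z" if "norm z < d" for z
      using d(2)[OF that] B(2)[of z] norm_triangle_sub[of "K z" "l z - r z"] by (simp add: algebra_simps)
    then show ?thesis
      using that[of "B + 1" d] B(1) d(1) by auto
  qed
  have "\<forall>\<^sub>F z in nhds 0. norm (N z) < 1 / 2"
    using tendstoD[OF N_lim, of "1/2"] by simp
  then have "\<forall>\<^sub>F z in nhds 0. norm (N z) < 1 / 2 \<and> R z o\<^sub>L \<Psi> z = L z"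
    using eq by eventually_elim simp
  then obtain e where e: "e > 0" "\<And>z. norm z < e \<Longrightarrow> norm (N z) < 1 / 2 \<and> R z o\<^sub>L \<Psi> z = L z"
    unfolding eventually_nhds_metric by (auto simp: dist_norm)
  have E_le: "norm (E z) \<le> 2 * norm (N z) * norm (K z)" if z: "norm z < e" for z
  proof -
    have "R z o\<^sub>L \<Psi> z = \<Psi> z + (N z o\<^sub>L \<Psi> z)"
      by (simp add: N_def blinfun_compose_diff)
    then have "\<Psi> z + (N z o\<^sub>L \<Psi> z) = L z"
      using e(2)[OF z] by simp
    then have E_eq: "E z = - (N z o\<^sub>L (\<Psi> z - id_blinfun))"
      by (simp add: E_def K_def N_def blinfun_compose_diff algebra_simps)
    have *: "norm (E z) \<le> norm (N z) * norm (\<Psi> z - id_blinfun)"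
      unfolding E_eq norm_minus_cancel by (rule norm_blinfun_compose)
    also have "\<dots> \<le> 1 / 2 * norm (\<Psi> z - id_blinfun)"
      using e(2)[OF z] by (intro mult_right_mono) auto
    finally have "norm (\<Psi> z - id_blinfun) \<le> 2 * norm (K z)"
      using norm_triangle_sub[of "\<Psi> z - id_blinfun" "K z"] by (simp add: E_def)
    then have "norm (N z) * norm (\<Psi> z - id_blinfun) \<le> norm (N z) * (2 * norm (K z))"
      by (intro mult_left_mono) auto
    then show ?thesis
      using * by simp
  qed
  have "(E has_derivative (\<lambda>h. 0)) (at 0)"
  proof (rule has_derivativeI_sandwich[where e = "min d e" and H = "\<lambda>z. 2 * norm (N z) * C"])
    show "((\<lambda>z. 2 * norm (N z) * C) \<longlongrightarrow> 0) (at 0)"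
      using tendsto_mult_left_zero[OF tendsto_mult_right_zero[OF tendsto_norm_zero[OF tendsto_mono[OF at_within_le_nhds N_lim]]]]
      by simp
  next
    fix z :: 'c assume z: "z \<in> UNIV" "z \<noteq> 0" "dist z 0 < min d e"
    have "norm (E z) \<le> 2 * norm (N z) * norm (K z)"
      using z by (intro E_le) auto
    also have "\<dots> \<le> 2 * norm (N z) * (C * norm z)"
      using z by (intro mult_left_mono K_le) auto
    finally show "norm (E z - E 0 - 0) / norm (z - 0) \<le> 2 * norm (N z) * C"
      using z(2) by (simp add: E0 field_simps)
  qed (use C e in auto)
  from has_derivative_add[OF this K] have "((\<lambda>z. \<Psi> z - id_blinfun) has_derivative (\<lambda>h. l h - r h)) (at 0)"
    by (simp add: E_def)
  from has_derivative_add[OF this has_derivative_const[of id_blinfun]] show ?thesis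
    by simp
qed

section \<open>Charts and tangent maps\<close>

lemma manifold_model: "smooth_manifold M \<Longrightarrow> subspace (model M)"
  by (simp add: smooth_manifold_def)

lemma manifold_chart: "smooth_manifold M \<Longrightarrow> c \<in> atlas M \<Longrightarrow> is_chart M c"
  by (simp add: smooth_manifold_def)

lemma charts_at_atlas: "c \<in> charts_at M p \<Longrightarrow> c \<in> atlas M"
  and charts_at_mem: "c \<in> charts_at M p \<Longrightarrow> p \<in> fst c"
  by (simp_all add: charts_at_def)

lemma charts_at_chart: "smooth_manifold M \<Longrightarrow> c \<in> charts_at M p \<Longrightarrow> is_chart M c"
  by (simp add: manifold_chart charts_at_atlas)

lemma ex_chart_at:
  assumes "smooth_manifold M" "p \<in> topspace (mtop M)"
  obtains c where "c \<in> charts_at M p"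
proof -
  have "p \<in> (\<Union>c\<in>atlas M. fst c)"
    using assms by (simp add: smooth_manifold_def)
  then show ?thesis
    using that unfolding charts_at_def by blast
qed

lemma chart_inv_coord: "is_chart M c \<Longrightarrow> p \<in> fst c \<Longrightarrow> chart_inv c (snd c p) = p"
  unfolding chart_inv_def is_chart_def
  by (auto dest!: homeomorphic_imp_injective_map openin_subset intro!: inv_into_f_f simp: Int_absorb1)

lemma chart_inv_mem: "z \<in> snd c ` fst c \<Longrightarrow> chart_inv c z \<in> fst c"
  and coord_chart_inv: "z \<in> snd c ` fst c \<Longrightarrow> snd c (chart_inv c z) = z"
  by (simp_all add: chart_inv_def inv_into_into f_inv_into_f)

lemma chart_subset: "is_chart M c \<Longrightarrow> fst c \<subseteq> topspace (mtop M)"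
  by (simp add: is_chart_def openin_subset)

lemma coord_in_model: "is_chart M c \<Longrightarrow> p \<in> fst c \<Longrightarrow> snd c p \<in> model M"
  unfolding is_chart_def using openin_imp_subset by blast

lemma chart_open_image:
  assumes c: "is_chart M c" and W: "openin (mtop M) W"
  shows "openin (top_of_set (model M)) (snd c ` (fst c \<inter> W))"
proof -
  have "open_map (subtopology (mtop M) (fst c)) (top_of_set (snd c ` fst c)) (snd c)"
    using c by (simp add: is_chart_def homeomorphic_imp_open_map)
  moreover have "openin (subtopology (mtop M) (fst c)) (fst c \<inter> W)"
    using W by (simp add: openin_subtopology_Int2)
  ultimately have "openin (top_of_set (snd c ` fst c)) (snd c ` (fst c \<inter> W))"
    by (simp add: open_map_def)
  then show ?thesis
    using c unfolding is_chart_def by (meson openin_trans)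
qed

lemma continuous_map_chart_inv:
  assumes c: "is_chart M c"
  shows "continuous_map (top_of_set (snd c ` fst c)) (mtop M) (chart_inv c)"
  unfolding continuous_map_def
proof (intro conjI allI impI)
  show "chart_inv c \<in> topspace (top_of_set (snd c ` fst c)) \<rightarrow> topspace (mtop M)"
  proof (rule Pi_I)
    fix z assume "z \<in> topspace (top_of_set (snd c ` fst c))"
    then have "z \<in> snd c ` fst c"
      by simp
    from chart_inv_mem[OF this] show "chart_inv c z \<in> topspace (mtop M)"
      using chart_subset[OF c] by blast
  qed
next
  fix W assume W: "openin (mtop M) W"
  have "{z \<in> snd c ` fst c. chart_inv c z \<in> W} = snd c ` (fst c \<inter> W)"
    by (auto simp: chart_inv_coord[OF c])
  then have "openin (top_of_set (model M)) {z \<in> snd c ` fst c. chart_inv c z \<in> W}"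
    using chart_open_image[OF c W] by simp
  moreover have "snd c ` fst c \<subseteq> model M"
    using coord_in_model[OF c] by blast
  ultimately show "openin (top_of_set (snd c ` fst c)) {z \<in> topspace (top_of_set (snd c ` fst c)). chart_inv c z \<in> W}"
    by (auto intro: openin_subset_trans)
qed

lemma continuous_map_coord:
  assumes "is_chart M c"
  shows "continuous_map (subtopology (mtop M) (fst c)) euclidean (snd c)"
proof -
  have "continuous_map (subtopology (mtop M) (fst c)) (top_of_set (snd c ` fst c)) (snd c)"
    using assms by (simp add: is_chart_def homeomorphic_imp_continuous_map)
  then show ?thesis
    by (simp add: continuous_map_in_subtopology)
qed

section \<open>Maps read in charts and the chain rule\<close>

definition rep_domain :: "('a, 'e) chart \<Rightarrow> ('b, 'f) chart \<Rightarrow> ('a \<Rightarrow> 'b) \<Rightarrow> 'e set" where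
  "rep_domain c d f = snd c ` (fst c \<inter> f -` fst d)"

lemma openin_rep_domain:
  assumes "is_chart M c" "is_chart N d" "continuous_map (mtop M) (mtop N) f"
  shows "openin (top_of_set (model M)) (rep_domain c d f)"
proof -
  have "openin (mtop M) {x \<in> topspace (mtop M). f x \<in> fst d}"
    using assms(2,3) by (auto simp: is_chart_def intro: openin_continuous_map_preimage)
  from chart_open_image[OF assms(1) this]
  have "openin (top_of_set (model M)) (snd c ` (fst c \<inter> {x \<in> topspace (mtop M). f x \<in> fst d}))" .
  moreover have "fst c \<inter> {x \<in> topspace (mtop M). f x \<in> fst d} = fst c \<inter> f -` fst d"
    using chart_subset[OF assms(1)] by auto
  ultimately show ?thesis
    by (simp add: rep_domain_def)
qed

lemma local_rep_coord: "is_chart M c \<Longrightarrow> p \<in> fst c \<Longrightarrow> local_rep c d f (snd c p) = snd d (f p)"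
  by (simp add: local_rep_def chart_inv_coord)

text \<open>Tangent maps see first derivatives only. This class is closed under composition by the
  pointwise chain rule, which is all that compositions of translations and conjugations
  require.\<close>

definition mdifferentiable ::
  "('a, 'e::euclidean_space) manifold \<Rightarrow> ('b, 'f::euclidean_space) manifold \<Rightarrow> ('a \<Rightarrow> 'b) \<Rightarrow> bool" where
  "mdifferentiable M N f \<longleftrightarrow> continuous_map (mtop M) (mtop N) f \<and>
     (\<forall>p\<in>topspace (mtop M). \<forall>c\<in>charts_at M p. \<forall>d\<in>charts_at N (f p).
        local_rep c d f differentiable (at (snd c p) within model M))"

abbreviation rep_deriv ::
  "('a, 'e::euclidean_space) manifold \<Rightarrow> ('a, 'e) chart \<Rightarrow> ('b, 'f::real_normed_vector) chart \<Rightarrow>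
    ('a \<Rightarrow> 'b) \<Rightarrow> 'a \<Rightarrow> 'e \<Rightarrow> 'f" where
  "rep_deriv M c d f p \<equiv> deriv_at (model M) (local_rep c d f) (snd c p)"

lemma mdifferentiable_continuous: "mdifferentiable M N f \<Longrightarrow> continuous_map (mtop M) (mtop N) f"
  by (simp add: mdifferentiable_def)

lemma mdifferentiable_topspace:
  "mdifferentiable M N f \<Longrightarrow> p \<in> topspace (mtop M) \<Longrightarrow> f p \<in> topspace (mtop N)"
  unfolding mdifferentiable_def continuous_map_def by blast

lemma smooth_map_imp_mdifferentiable:
  assumes "smooth_map M N f"
  shows "mdifferentiable M N f"
  unfolding mdifferentiable_def
proof (intro conjI ballI)
  show "continuous_map (mtop M) (mtop N) f"
    using assms by (simp add: smooth_map_def)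
  fix p c d assume c: "c \<in> charts_at M p" and d: "d \<in> charts_at N (f p)"
  have "smooth_on (model M) (snd c ` (fst c \<inter> f -` fst d)) (local_rep c d f)"
    using assms c d by (simp add: smooth_map_def charts_at_def)
  then have "Ck_on (Suc 0) (model M) (snd c ` (fst c \<inter> f -` fst d)) (local_rep c d f)"
    unfolding smooth_on_def by blast
  moreover have "snd c p \<in> snd c ` (fst c \<inter> f -` fst d)"
    using c d by (auto simp: charts_at_def)
  ultimately show "local_rep c d f differentiable (at (snd c p) within model M)"
    unfolding Ck_on.simps by blast
qed

lemma mdifferentiable_id: "smooth_manifold M \<Longrightarrow> mdifferentiable M M id"
  by (rule smooth_map_imp_mdifferentiable)
    (simp add: smooth_map_def smooth_manifold_def continuous_map_id)

lemma rep_deriv: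
  assumes "mdifferentiable M N f" "p \<in> topspace (mtop M)" "c \<in> charts_at M p" "d \<in> charts_at N (f p)"
  shows "(local_rep c d f has_derivative rep_deriv M c d f p) (at (snd c p) within model M)"
  using assms by (simp add: mdifferentiable_def frechet_derivative_works[symmetric])

lemma linear_rep_deriv:
  assumes "mdifferentiable M N f" "p \<in> topspace (mtop M)" "c \<in> charts_at M p" "d \<in> charts_at N (f p)"
  shows "bounded_linear (rep_deriv M c d f p)"
  using rep_deriv[OF assms] by (rule has_derivative_bounded_linear)

lemma rep_deriv_cong:
  assumes M: "smooth_manifold M" and p: "p \<in> topspace (mtop M)" and c: "c \<in> charts_at M p"
    and eq: "\<And>x. x \<in> topspace (mtop M) \<Longrightarrow> f x = g x"
  shows "rep_deriv M c d f p = rep_deriv M c d g p"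
proof (rule deriv_at_cong)
  have ch: "is_chart M c"
    using charts_at_chart[OF M c] .
  then show "openin (top_of_set (model M)) (snd c ` fst c)"
    by (simp add: is_chart_def)
  show "snd c p \<in> snd c ` fst c"
    using charts_at_mem[OF c] by simp
  fix z assume "z \<in> snd c ` fst c"
  from chart_inv_mem[OF this] have "chart_inv c z \<in> topspace (mtop M)"
    using chart_subset[OF ch] by blast
  from eq[OF this] show "local_rep c d f z = local_rep c d g z"
    by (simp add: local_rep_def)
qed

lemma rep_deriv_in_model:
  assumes M: "smooth_manifold M" and N: "smooth_manifold N" and f: "mdifferentiable M N f"
    and p: "p \<in> topspace (mtop M)" and c: "c \<in> charts_at M p" and d: "d \<in> charts_at N (f p)"
    and v: "v \<in> model M"
  shows "rep_deriv M c d f p v \<in> model N"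
proof -
  have ch: "is_chart M c" "is_chart N d"
    by (rule charts_at_chart[OF M c], rule charts_at_chart[OF N d])
  have op: "openin (top_of_set (model M)) (rep_domain c d f)"
    using ch f by (intro openin_rep_domain mdifferentiable_continuous)
  have "snd c p \<in> rep_domain c d f"
    using c d by (auto simp: rep_domain_def charts_at_def)
  moreover have "local_rep c d f z \<in> model N" if "z \<in> rep_domain c d f" for z
    using that ch by (auto simp: rep_domain_def local_rep_coord[OF ch(1)] coord_in_model)
  ultimately show ?thesis
    using f p c d v op manifold_model[OF M] manifold_model[OF N]
    by (intro deriv_at_in_subspace[where S = "rep_domain c d f"]) (auto simp: mdifferentiable_def)
qed

lemma rep_compose:
  assumes M: "smooth_manifold M" and N: "smooth_manifold N"
    and f: "mdifferentiable M N f" and g: "mdifferentiable N P g"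
    and p: "p \<in> topspace (mtop M)" and c: "c \<in> charts_at M p"
    and d: "d \<in> charts_at N (f p)" and e: "e \<in> charts_at P (g (f p))"
  shows "(local_rep c e (g \<circ> f) has_derivative rep_deriv N d e g (f p) \<circ> rep_deriv M c d f p)
    (at (snd c p) within model M)"
proof -
  have ch: "is_chart M c" "is_chart N d"
    by (rule charts_at_chart[OF M c], rule charts_at_chart[OF N d])
  have op: "openin (top_of_set (model M)) (rep_domain c d f)"
    using ch f by (intro openin_rep_domain mdifferentiable_continuous)
  have mem: "snd c p \<in> rep_domain c d f"
    using c d by (auto simp: rep_domain_def charts_at_def)
  have "((local_rep d e g \<circ> local_rep c d f) has_derivative rep_deriv N d e g (f p) \<circ> rep_deriv M c d f p)
    (at (snd c p) within model M)"
  proof (rule has_derivative_compose_openin[OF op mem])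
    show "local_rep c d f ` rep_domain c d f \<subseteq> model N"
      using ch by (auto simp: rep_domain_def local_rep_coord[OF ch(1)] coord_in_model)
    show "(local_rep c d f has_derivative rep_deriv M c d f p) (at (snd c p) within model M)"
      by (rule rep_deriv[OF f p c d])
    show "(local_rep d e g has_derivative rep_deriv N d e g (f p))
        (at (local_rep c d f (snd c p)) within model N)"
      using rep_deriv[OF g mdifferentiable_topspace[OF f p] d e]
      by (simp add: local_rep_coord[OF ch(1) charts_at_mem[OF c]])
  qed
  moreover have "local_rep c e (g \<circ> f) z = (local_rep d e g \<circ> local_rep c d f) z"
    if "z \<in> rep_domain c d f" for z
    using that by (auto simp: rep_domain_def local_rep_coord[OF ch(1)] local_rep_coord[OF ch(2)])
  ultimately show ?thesis
    using has_derivative_openin_cong[OF op mem] by metis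
qed

lemma mdifferentiable_compose:
  assumes M: "smooth_manifold M" and N: "smooth_manifold N"
    and f: "mdifferentiable M N f" and g: "mdifferentiable N P g"
  shows "mdifferentiable M P (g \<circ> f)"
  unfolding mdifferentiable_def
proof (intro conjI ballI)
  show "continuous_map (mtop M) (mtop P) (g \<circ> f)"
    by (rule continuous_map_compose[OF mdifferentiable_continuous[OF f] mdifferentiable_continuous[OF g]])
  fix p c e assume p: "p \<in> topspace (mtop M)" and c: "c \<in> charts_at M p" and e: "e \<in> charts_at P ((g \<circ> f) p)"
  obtain d where d: "d \<in> charts_at N (f p)"
    using ex_chart_at[OF N mdifferentiable_topspace[OF f p]] .
  show "local_rep c e (g \<circ> f) differentiable (at (snd c p) within model M)"
    using rep_compose[OF M N f g p c d, of e] e unfolding differentiable_def by (auto simp del: o_apply simp: o_apply[of g f p])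
qed

lemma rep_deriv_compose:
  assumes M: "smooth_manifold M" and N: "smooth_manifold N"
    and f: "mdifferentiable M N f" and g: "mdifferentiable N P g"
    and p: "p \<in> topspace (mtop M)" and c: "c \<in> charts_at M p"
    and d: "d \<in> charts_at N (f p)" and e: "e \<in> charts_at P (g (f p))" and v: "v \<in> model M"
  shows "rep_deriv M c e (g \<circ> f) p v = rep_deriv N d e g (f p) (rep_deriv M c d f p v)"
proof -
  have "is_chart M c"
    using charts_at_chart[OF M c] .
  then have "snd c p \<in> model M"
    by (rule coord_in_model[OF _ charts_at_mem[OF c]])
  from deriv_at_eq[OF manifold_model[OF M] this v rep_compose[OF M N f g p c d e]] show ?thesis
    by simp
qed

lemma rep_deriv_id_same:
  assumes M: "smooth_manifold M" and c: "c \<in> charts_at M p" and v: "v \<in> model M"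
  shows "rep_deriv M c c id p v = v"
proof -
  have ch: "is_chart M c"
    using charts_at_chart[OF M c] .
  then have op: "openin (top_of_set (model M)) (snd c ` fst c)"
    by (simp add: is_chart_def)
  have mem: "snd c p \<in> snd c ` fst c" "snd c p \<in> model M"
    using charts_at_mem[OF c] coord_in_model[OF ch] by auto
  have "(local_rep c c id has_derivative id) (at (snd c p) within model M)"
    by (subst has_derivative_openin_cong[OF op mem(1), of _ id])
      (auto simp: local_rep_coord[OF ch] id_def)
  from deriv_at_eq[OF manifold_model[OF M] mem(2) v this] show ?thesis
    by simp
qed

section \<open>Tangent vectors and tangent maps\<close>

lemma tangent_space_coord:
  assumes "v \<in> tangent_space M p" "c \<in> charts_at M p"
  shows "v c \<in> model M"
  using assms unfolding tangent_space_def by blast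

lemma tangent_space_change:
  assumes "v \<in> tangent_space M p" "c \<in> charts_at M p" "d \<in> charts_at M p"
  shows "v d = rep_deriv M c d id p (v c)"
  using assms unfolding tangent_space_def by blast

lemma tangent_space_outside:
  assumes "v \<in> tangent_space M p" "c \<notin> charts_at M p"
  shows "v c = 0"
  using assms unfolding tangent_space_def by blast

lemma tangent_spaceI:
  assumes "\<And>c. c \<in> charts_at M p \<Longrightarrow> v c \<in> model M"
    and "\<And>c d. c \<in> charts_at M p \<Longrightarrow> d \<in> charts_at M p \<Longrightarrow> v d = rep_deriv M c d id p (v c)"
    and "\<And>c. c \<notin> charts_at M p \<Longrightarrow> v c = 0"
  shows "v \<in> tangent_space M p"
  using assms unfolding tangent_space_def by blast

text \<open>Let c0 be the chart selected by \<open>SOME\<close> in \<open>tangent_map\<close>.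
  Writing f as f o id and passing through c0 inserts the coordinate change from c to c0, which
  carries \<open>v c\<close> to \<open>v c0\<close> because v is a tangent vector.\<close>

lemma tangent_map_coord:
  assumes M: "smooth_manifold M" and f: "mdifferentiable M N f"
    and p: "p \<in> topspace (mtop M)" and v: "v \<in> tangent_space M p"
    and c: "c \<in> charts_at M p" and d: "d \<in> charts_at N (f p)"
  shows "tangent_map M N f p v d = rep_deriv M c d f p (v c)"
proof -
  define c0 where "c0 = (SOME c. c \<in> charts_at M p)"
  have c0: "c0 \<in> charts_at M p"
    unfolding c0_def using c by (rule someI)
  have "rep_deriv M c d (f \<circ> id) p (v c) = rep_deriv M c0 d f (id p) (rep_deriv M c c0 id p (v c))"
    using c0 d by (intro rep_deriv_compose[OF M M mdifferentiable_id[OF M] f p c] tangent_space_coord[OF v c]) auto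
  also have "rep_deriv M c c0 id p (v c) = v c0"
    using tangent_space_change[OF v c c0] by simp
  finally show ?thesis
    using d by (simp add: tangent_map_def Let_def c0_def)
qed

lemma tangent_map_outside: "d \<notin> charts_at N (f p) \<Longrightarrow> tangent_map M N f p v d = 0"
  by (simp add: tangent_map_def)

lemma tangent_map_in_tangent_space:
  assumes M: "smooth_manifold M" and N: "smooth_manifold N" and f: "mdifferentiable M N f"
    and p: "p \<in> topspace (mtop M)" and v: "v \<in> tangent_space M p"
  shows "tangent_map M N f p v \<in> tangent_space N (f p)"
proof -
  obtain c where c: "c \<in> charts_at M p"
    using ex_chart_at[OF M p] .
  note coord = tangent_map_coord[OF M f p v c]
  have "tangent_map M N f p v d \<in> model N" if "d \<in> charts_at N (f p)" for d
    unfolding coord[OF that] by (rule rep_deriv_in_model[OF M N f p c that tangent_space_coord[OF v c]])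
  moreover have "tangent_map M N f p v e = rep_deriv N d e id (f p) (tangent_map M N f p v d)"
    if d: "d \<in> charts_at N (f p)" and e: "e \<in> charts_at N (f p)" for d e
    using rep_deriv_compose[OF M N f mdifferentiable_id[OF N] p c d _ tangent_space_coord[OF v c], of e] e
    by (simp add: coord d)
  ultimately show ?thesis
    using tangent_map_outside by (rule tangent_spaceI)
qed

lemma tangent_map_compose:
  assumes M: "smooth_manifold M" and N: "smooth_manifold N" and P: "smooth_manifold P"
    and f: "mdifferentiable M N f" and g: "mdifferentiable N P g"
    and p: "p \<in> topspace (mtop M)" and v: "v \<in> tangent_space M p"
  shows "tangent_map M P (g \<circ> f) p v = tangent_map N P g (f p) (tangent_map M N f p v)"
proof
  fix e
  obtain c where c: "c \<in> charts_at M p"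
    using ex_chart_at[OF M p] .
  have fp: "f p \<in> topspace (mtop N)"
    using f p by (rule mdifferentiable_topspace)
  obtain d where d: "d \<in> charts_at N (f p)"
    using ex_chart_at[OF N fp] .
  show "tangent_map M P (g \<circ> f) p v e = tangent_map N P g (f p) (tangent_map M N f p v) e"
  proof (cases "e \<in> charts_at P (g (f p))")
    case True
    have "tangent_map M P (g \<circ> f) p v e = rep_deriv M c e (g \<circ> f) p (v c)"
      using True by (intro tangent_map_coord[OF M mdifferentiable_compose[OF M N f g] p v c]) simp
    also have "\<dots> = rep_deriv N d e g (f p) (rep_deriv M c d f p (v c))"
      by (rule rep_deriv_compose[OF M N f g p c d True tangent_space_coord[OF v c]])
    also have "\<dots> = tangent_map N P g (f p) (tangent_map M N f p v) e"
      using tangent_map_coord[OF N g fp tangent_map_in_tangent_space[OF M N f p v] d True]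
        tangent_map_coord[OF M f p v c d] by simp
    finally show ?thesis .
  qed (simp add: tangent_map_outside)
qed

text \<open>Identities between group expressions hold on the carrier only; this transfers them to
  differentials.\<close>

lemma tangent_map_cong:
  assumes M: "smooth_manifold M" and p: "p \<in> topspace (mtop M)"
    and eq: "\<And>x. x \<in> topspace (mtop M) \<Longrightarrow> f x = g x"
  shows "tangent_map M N f p = tangent_map M N g p"
proof -
  obtain c where "c \<in> charts_at M p"
    using ex_chart_at[OF M p] .
  then have c0: "(SOME c. c \<in> charts_at M p) \<in> charts_at M p"
    by (rule someI)
  show ?thesis
    by (intro ext) (simp add: tangent_map_def Let_def eq[OF p] rep_deriv_cong[OF M p c0, of f g, OF eq])
qed

lemma tangent_of_coord_in_tangent_space:
  assumes M: "smooth_manifold M" and p: "p \<in> topspace (mtop M)" and c: "c \<in> charts_at M p"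
    and x: "x \<in> model M"
  shows "tangent_of_coord M p c x \<in> tangent_space M p"
proof -
  note id = mdifferentiable_id[OF M]
  have in_model: "rep_deriv M c d id p x \<in> model M" if "d \<in> charts_at M p" for d
    using rep_deriv_in_model[OF M M id p c _ x] that by simp
  have comp: "rep_deriv M c e id p x = rep_deriv M d e id p (rep_deriv M c d id p x)"
    if "d \<in> charts_at M p" "e \<in> charts_at M p" for d e
    using rep_deriv_compose[OF M M id id p c _ _ x, of d e] that by simp
  show ?thesis
    unfolding tangent_of_coord_def
    by (rule tangent_spaceI; simp only: if_True if_False; rule in_model comp; assumption)
qed

lemma tangent_of_coord_same:
  assumes "smooth_manifold M" "c \<in> charts_at M p" "x \<in> model M"
  shows "tangent_of_coord M p c x c = x"
  using assms by (simp add: tangent_of_coord_def rep_deriv_id_same)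

lemma tangent_of_coord_coord:
  assumes v: "v \<in> tangent_space M p" and c: "c \<in> charts_at M p"
  shows "tangent_of_coord M p c (v c) = v"
proof
  fix d
  show "tangent_of_coord M p c (v c) d = v d"
  proof (cases "d \<in> charts_at M p")
    case True
    then show ?thesis
      using tangent_space_change[OF v c True] by (simp add: tangent_of_coord_def)
  next
    case False
    then show ?thesis
      using tangent_space_outside[OF v] by (simp add: tangent_of_coord_def)
  qed
qed

lemma tangent_of_coord_linear:
  assumes M: "smooth_manifold M" and p: "p \<in> topspace (mtop M)" and c: "c \<in> charts_at M p"
  shows "tangent_of_coord M p c (a *\<^sub>R x + b *\<^sub>R y) =
    (\<lambda>d. a *\<^sub>R tangent_of_coord M p c x d + b *\<^sub>R tangent_of_coord M p c y d)"
proof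
  fix d
  have "bounded_linear (rep_deriv M c d id p)" if "d \<in> charts_at M p"
    using linear_rep_deriv[OF mdifferentiable_id[OF M] p c] that by simp
  then show "tangent_of_coord M p c (a *\<^sub>R x + b *\<^sub>R y) d =
      a *\<^sub>R tangent_of_coord M p c x d + b *\<^sub>R tangent_of_coord M p c y d"
    by (simp add: tangent_of_coord_def linear_simps)
qed

section \<open>Lie groups\<close>

lemma smooth_map_cong:
  assumes M: "smooth_manifold M" and f: "smooth_map M M f"
    and N: "\<And>x. x \<in> topspace (mtop M) \<Longrightarrow> f x = g x"
  shows "smooth_map M M g"
  unfolding smooth_map_def
proof (intro conjI ballI)
  show cont: "continuous_map (mtop M) (mtop M) g"
    using f N by (auto simp: smooth_map_def intro: continuous_map_eq)
  fix c d assume c: "c \<in> atlas M" and d: "d \<in> atlas M"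
  have ch: "is_chart M c" "is_chart M d"
    using c d M by (simp_all add: manifold_chart)
  have cU: "fst c \<subseteq> topspace (mtop M)"
    using ch(1) by (rule chart_subset)
  have dom: "fst c \<inter> g -` fst d = fst c \<inter> f -` fst d"
    using cU N by auto
  have op: "openin (top_of_set (model M)) (snd c ` (fst c \<inter> f -` fst d))"
    using openin_rep_domain[OF ch cont] by (simp add: rep_domain_def dom)
  have eq: "local_rep c d f z = local_rep c d g z" if "z \<in> snd c ` (fst c \<inter> f -` fst d)" for z
    using that cU N by (auto simp: local_rep_coord[OF ch(1)])
  have "smooth_on (model M) (snd c ` (fst c \<inter> f -` fst d)) (local_rep c d f)"
    using f c d by (simp add: smooth_map_def)
  then show "smooth_on (model M) (snd c ` (fst c \<inter> g -` fst d)) (local_rep c d g)"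
    unfolding dom smooth_on_def using Ck_on_cong[OF op, of "local_rep c d f" "local_rep c d g", OF eq] by simp
qed

locale lie =
  fixes G :: "('a, 'm) monoid_scheme" (structure) and M :: "('a, 'e::euclidean_space) manifold"
  assumes lie_group: "lie_group G M"
begin

sublocale topological_group G "mtop M"
proof -
  interpret group G
    using lie_group by (simp add: lie_group_def)
  show "topological_group G (mtop M)"
    by unfold_locales
      (use lie_group in \<open>simp_all add: lie_group_def smooth_map_def prod_manifold_def\<close>)
qed

lemma manifold: "smooth_manifold M"
  using lie_group by (simp add: lie_group_def)

abbreviation mult_rep :: "('a, 'e) chart \<Rightarrow> ('a, 'e) chart \<Rightarrow> ('a, 'e) chart \<Rightarrow> 'e \<times> 'e \<Rightarrow> 'e" where
  "mult_rep c c' d \<equiv>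
     local_rep (fst c \<times> fst c', map_prod (snd c) (snd c')) d (\<lambda>(x, y). x \<otimes> y)"

definition mult_dom :: "('a, 'e) chart \<Rightarrow> ('a, 'e) chart \<Rightarrow> ('a, 'e) chart \<Rightarrow> ('e \<times> 'e) set" where
  "mult_dom c c' d = map_prod (snd c) (snd c') ` ((fst c \<times> fst c') \<inter> (\<lambda>(x, y). x \<otimes> y) -` fst d)"

lemma mult_rep_smooth:
  assumes "c \<in> atlas M" "c' \<in> atlas M" "d \<in> atlas M"
  shows "smooth_on (model M \<times> model M) (mult_dom c c' d) (mult_rep c c' d)"
proof -
  have "smooth_map (prod_manifold M M) M (\<lambda>(x, y). x \<otimes> y)"
    using lie_group by (simp add: lie_group_def)
  moreover have "(fst c \<times> fst c', map_prod (snd c) (snd c')) \<in> atlas (prod_manifold M M)"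
    unfolding prod_manifold_def manifold.simps using assms(1,2)
    by (intro CollectI exI[of _ c] exI[of _ c'] conjI refl)
  ultimately have "smooth_on (model (prod_manifold M M))
      (snd (fst c \<times> fst c', map_prod (snd c) (snd c')) `
        (fst (fst c \<times> fst c', map_prod (snd c) (snd c')) \<inter> (\<lambda>(x, y). x \<otimes> y) -` fst d))
      (mult_rep c c' d)"
    using assms(3) unfolding smooth_map_def by blast
  then show ?thesis
    by (simp add: mult_dom_def prod_manifold_def)
qed

lemma mult_rep_coord:
  assumes "is_chart M c" "is_chart M c'" "x \<in> fst c" "y \<in> fst c'"
  shows "mult_rep c c' d (snd c x, snd c' y) = snd d (x \<otimes> y)"
proof -
  have "inj_on (snd c) (fst c)" "inj_on (snd c') (fst c')"
    using assms(1,2) by (auto intro!: inj_on_inverseI chart_inv_coord)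
  then have "inj_on (map_prod (snd c) (snd c')) (fst c \<times> fst c')"
    by (rule map_prod_inj_on)
  from inv_into_f_f[OF this, of "(x, y)"] assms(3,4) show ?thesis
    by (simp add: local_rep_def chart_inv_def)
qed

text \<open>Within the product of the two chart images this is the preimage of \<open>fst d\<close>
  under the continuous map that multiplies the points with the given coordinates.\<close>

lemma openin_mult_dom:
  assumes c: "is_chart M c" and c': "is_chart M c'" and d: "is_chart M d"
  shows "openin (top_of_set (model M \<times> model M)) (mult_dom c c' d)"
proof -
  let ?Y = "prod_topology (top_of_set (snd c ` fst c)) (top_of_set (snd c' ` fst c'))"
  have Y: "?Y = top_of_set (snd c ` fst c \<times> snd c' ` fst c')"
    by (simp add: subtopology_Times euclidean_product_topology[symmetric])
  have "continuous_map ?Y (mtop M) (\<lambda>q. chart_inv c (fst q) \<otimes> chart_inv c' (snd q))"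
    by (intro continuous_map_mult continuous_map_compose[OF continuous_map_fst continuous_map_chart_inv[OF c], unfolded o_def]
        continuous_map_compose[OF continuous_map_snd continuous_map_chart_inv[OF c'], unfolded o_def])
  moreover have "openin (mtop M) (fst d)"
    using d by (simp add: is_chart_def)
  ultimately have "openin ?Y {q \<in> topspace ?Y. chart_inv c (fst q) \<otimes> chart_inv c' (snd q) \<in> fst d}"
    by (rule openin_continuous_map_preimage)
  moreover have "{q \<in> topspace ?Y. chart_inv c (fst q) \<otimes> chart_inv c' (snd q) \<in> fst d} = mult_dom c c' d"
    unfolding mult_dom_def by (force simp: chart_inv_coord[OF c] chart_inv_coord[OF c'])
  ultimately have "openin (top_of_set (snd c ` fst c \<times> snd c' ` fst c')) (mult_dom c c' d)"
    by (simp add: Y)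
  moreover have "openin (top_of_set (model M \<times> model M)) (snd c ` fst c \<times> snd c' ` fst c')"
    using c c' by (intro openin_Times) (simp_all add: is_chart_def)
  ultimately show ?thesis
    by (rule openin_trans)
qed

section \<open>Translations and conjugations\<close>

lemma subspace_model: "subspace (model M)"
  by (rule manifold_model[OF manifold])

text \<open>In charts, right translation by h is the multiplication with its second coordinate
  frozen at that of h. This is precomposition with an affine map, so \<open>Ck_on_affine\<close>
  applies.\<close>

lemma smooth_rmult:
  assumes h: "h \<in> carrier G"
  shows "smooth_map M M (\<lambda>x. x \<otimes> h)"
  unfolding smooth_map_def
proof (intro conjI ballI)
  show cont: "continuous_map (mtop M) (mtop M) (\<lambda>x. x \<otimes> h)"
    using h by (intro continuous_map_mult) (simp_all add: space)
  fix c d assume c: "c \<in> atlas M" and d: "d \<in> atlas M"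
  obtain c' where c': "c' \<in> charts_at M h"
    using ex_chart_at[OF manifold] h space by metis
  have ch: "is_chart M c" "is_chart M c'" "is_chart M d"
    by (rule manifold_chart[OF manifold c] charts_at_chart[OF manifold c'] manifold_chart[OF manifold d])+
  have op: "openin (top_of_set (model M)) (rep_domain c d (\<lambda>x. x \<otimes> h))"
    by (rule openin_rep_domain[OF ch(1,3) cont])
  have "Ck_on k (model M) (rep_domain c d (\<lambda>x. x \<otimes> h)) (local_rep c d (\<lambda>x. x \<otimes> h))" for k
  proof (subst Ck_on_cong[OF op])
    show "local_rep c d (\<lambda>x. x \<otimes> h) z = mult_rep c c' d ((0, snd c' h) + (z, 0))"
      if "z \<in> rep_domain c d (\<lambda>x. x \<otimes> h)" for z
      using that charts_at_mem[OF c'] ch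
      by (auto simp: rep_domain_def local_rep_coord mult_rep_coord)
    show "Ck_on k (model M) (rep_domain c d (\<lambda>x. x \<otimes> h)) (\<lambda>z. mult_rep c c' d ((0, snd c' h) + (z, 0)))"
    proof (rule Ck_on_affine[OF subspace_model op openin_imp_subset[OF openin_mult_dom[OF ch]]])
      show "bounded_linear (\<lambda>z::'e. (z, 0::'e))"
        by (intro bounded_linear_intros)
      show "(\<lambda>z. (z, 0)) ` model M \<subseteq> model M \<times> model M"
        using subspace_0[OF subspace_model] by auto
      show "(0, snd c' h) + (z, 0) \<in> mult_dom c c' d" if "z \<in> rep_domain c d (\<lambda>x. x \<otimes> h)" for z
        using that charts_at_mem[OF c'] by (force simp: rep_domain_def mult_dom_def)
      show "subspace (model M \<times> model M)"
        by (intro subspace_Times subspace_model)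
      show "Ck_on k (model M \<times> model M) (mult_dom c c' d) (mult_rep c c' d)"
        using mult_rep_smooth[OF c charts_at_atlas[OF c'] d] by (simp add: smooth_on_def)
    qed
  qed
  then show "smooth_on (model M) (snd c ` (fst c \<inter> (\<lambda>x. x \<otimes> h) -` fst d)) (local_rep c d (\<lambda>x. x \<otimes> h))"
    by (simp add: smooth_on_def rep_domain_def)
qed

lemma smooth_lmult:
  assumes h: "h \<in> carrier G"
  shows "smooth_map M M (\<lambda>x. h \<otimes> x)"
  unfolding smooth_map_def
proof (intro conjI ballI)
  show cont: "continuous_map (mtop M) (mtop M) (\<lambda>x. h \<otimes> x)"
    using h by (intro continuous_map_mult) (simp_all add: space)
  fix c d assume c: "c \<in> atlas M" and d: "d \<in> atlas M"
  obtain c' where c': "c' \<in> charts_at M h"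
    using ex_chart_at[OF manifold] h space by metis
  have ch: "is_chart M c'" "is_chart M c" "is_chart M d"
    by (rule manifold_chart[OF manifold c] charts_at_chart[OF manifold c'] manifold_chart[OF manifold d])+
  have op: "openin (top_of_set (model M)) (rep_domain c d (\<lambda>x. h \<otimes> x))"
    by (rule openin_rep_domain[OF ch(2,3) cont])
  have "Ck_on k (model M) (rep_domain c d (\<lambda>x. h \<otimes> x)) (local_rep c d (\<lambda>x. h \<otimes> x))" for k
  proof (subst Ck_on_cong[OF op])
    show "local_rep c d (\<lambda>x. h \<otimes> x) z = mult_rep c' c d ((snd c' h, 0) + (0, z))"
      if "z \<in> rep_domain c d (\<lambda>x. h \<otimes> x)" for z
      using that charts_at_mem[OF c'] ch
      by (auto simp: rep_domain_def local_rep_coord mult_rep_coord)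
    show "Ck_on k (model M) (rep_domain c d (\<lambda>x. h \<otimes> x)) (\<lambda>z. mult_rep c' c d ((snd c' h, 0) + (0, z)))"
    proof (rule Ck_on_affine[OF subspace_model op openin_imp_subset[OF openin_mult_dom[OF ch]]])
      show "bounded_linear (\<lambda>z::'e. (0::'e, z))"
        by (intro bounded_linear_intros)
      show "(\<lambda>z. (0, z)) ` model M \<subseteq> model M \<times> model M"
        using subspace_0[OF subspace_model] by auto
      show "(snd c' h, 0) + (0, z) \<in> mult_dom c' c d" if "z \<in> rep_domain c d (\<lambda>x. h \<otimes> x)" for z
        using that charts_at_mem[OF c'] by (force simp: rep_domain_def mult_dom_def)
      show "subspace (model M \<times> model M)"
        by (intro subspace_Times subspace_model)
      show "Ck_on k (model M \<times> model M) (mult_dom c' c d) (mult_rep c' c d)"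
        using mult_rep_smooth[OF charts_at_atlas[OF c'] c d] by (simp add: smooth_on_def)
    qed
  qed
  then show "smooth_on (model M) (snd c ` (fst c \<inter> (\<lambda>x. h \<otimes> x) -` fst d)) (local_rep c d (\<lambda>x. h \<otimes> x))"
    by (simp add: smooth_on_def rep_domain_def)
qed

lemma mdiff_rmult: "h \<in> carrier G \<Longrightarrow> mdifferentiable M M (\<lambda>x. x \<otimes> h)"
  by (intro smooth_map_imp_mdifferentiable smooth_rmult)

lemma mdiff_lmult: "h \<in> carrier G \<Longrightarrow> mdifferentiable M M (\<lambda>x. h \<otimes> x)"
  by (intro smooth_map_imp_mdifferentiable smooth_lmult)

definition conjugation :: "'a \<Rightarrow> 'a \<Rightarrow> 'a" where
  "conjugation h x = h \<otimes> x \<otimes> inv h"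

lemma conjugation_one [simp]: "h \<in> carrier G \<Longrightarrow> conjugation h \<one> = \<one>"
  by (simp add: conjugation_def)

lemma mdiff_conjugation:
  assumes "h \<in> carrier G"
  shows "mdifferentiable M M (conjugation h)"
proof -
  have "conjugation h = (\<lambda>x. x \<otimes> inv h) \<circ> (\<lambda>x. h \<otimes> x)"
    by (simp add: conjugation_def fun_eq_iff)
  then show ?thesis
    using mdifferentiable_compose[OF manifold manifold mdiff_lmult[OF assms] mdiff_rmult] assms by simp
qed

lemma diffeomorphism_rmult:
  assumes h: "h \<in> carrier G"
  shows "diffeomorphism M M (\<lambda>x. x \<otimes> h)"
proof -
  have bij: "bij_betw (\<lambda>x. x \<otimes> h) (carrier G) (carrier G)"
    by (rule bij_betw_byWitness[where f' = "\<lambda>x. x \<otimes> inv h"]) (use h in \<open>auto simp: m_assoc\<close>)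
  have "inv_into (carrier G) (\<lambda>x. x \<otimes> h) x = x \<otimes> inv h" if x: "x \<in> carrier G" for x
  proof (rule inv_into_f_eq)
    show "inj_on (\<lambda>x. x \<otimes> h) (carrier G)"
      using bij by (rule bij_betw_imp_inj_on)
  qed (use h x in \<open>auto simp: m_assoc\<close>)
  then have "smooth_map M M (inv_into (carrier G) (\<lambda>x. x \<otimes> h))"
    using h by (intro smooth_map_cong[OF manifold smooth_rmult[of "inv h"]]) (auto simp: space)
  then show ?thesis
    using bij smooth_rmult[OF h] by (simp add: diffeomorphism_def space)
qed

end

section \<open>The adjoint representation in a chart\<close>

text \<open>A chart \<open>c\<close> at the identity identifies the Lie algebra with the model space; \<open>P\<close> is a projection
  onto the model space, by which everything is extended to the ambient Euclidean space.\<close>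

locale lie_chart = lie G M
  for G :: "('a, 'm) monoid_scheme" (structure) and M :: "('a, 'e::euclidean_space) manifold" +
  fixes c :: "('a, 'e) chart" and P :: "'e \<Rightarrow>\<^sub>L 'e"
  assumes chart_at_one: "c \<in> charts_at M \<one>"
    and P_in_model: "P v \<in> model M"
    and P_id: "v \<in> model M \<Longrightarrow> P v = v"
begin

lemma chart: "is_chart M c"
  by (rule charts_at_chart[OF manifold chart_at_one])

lemma chart_carrier: "x \<in> fst c \<Longrightarrow> x \<in> carrier G"
  using chart_subset[OF chart] by (auto simp: space)

lemma one_in_chart: "\<one> \<in> fst c"
  by (rule charts_at_mem[OF chart_at_one])

lemma charts_atI: "x \<in> fst c \<Longrightarrow> c \<in> charts_at M x"
  using chart_at_one by (simp add: charts_at_def)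

abbreviation coord :: "'a \<Rightarrow> 'e" where
  "coord \<equiv> snd c"

lemma P_P [simp]: "P (P v) = P v"
  by (simp add: P_id P_in_model)

lemma P_coord [simp]: "x \<in> fst c \<Longrightarrow> P (coord x) = coord x"
  by (simp add: P_id coord_in_model[OF chart])

definition Ad :: "'a \<Rightarrow> 'e \<Rightarrow> 'e" where
  "Ad h v = rep_deriv M c c (conjugation h) \<one> v"

lemma one_topspace: "\<one> \<in> topspace (mtop M)"
  by (simp add: space)

lemma bounded_linear_Ad: "h \<in> carrier G \<Longrightarrow> bounded_linear (Ad h)"
  unfolding Ad_def[abs_def]
  by (rule linear_rep_deriv[OF mdiff_conjugation one_topspace chart_at_one])
    (simp_all add: chart_at_one)

lemma Ad_in_model: "h \<in> carrier G \<Longrightarrow> v \<in> model M \<Longrightarrow> Ad h v \<in> model M"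
  unfolding Ad_def
  by (rule rep_deriv_in_model[OF manifold manifold mdiff_conjugation one_topspace chart_at_one])
    (simp_all add: chart_at_one)

lemma Ad_one:
  assumes v: "v \<in> model M"
  shows "Ad \<one> v = v"
proof -
  have "rep_deriv M c c (conjugation \<one>) \<one> = rep_deriv M c c id \<one>"
    by (rule rep_deriv_cong[OF manifold one_topspace chart_at_one])
      (simp add: conjugation_def space)
  then show ?thesis
    using rep_deriv_id_same[OF manifold chart_at_one v] by (simp add: Ad_def)
qed

lemma Ad_mult:
  assumes x: "x \<in> carrier G" and y: "y \<in> carrier G" and v: "v \<in> model M"
  shows "Ad (x \<otimes> y) v = Ad x (Ad y v)"
proof -
  have "rep_deriv M c c (conjugation (x \<otimes> y)) \<one> v = rep_deriv M c c (conjugation x \<circ> conjugation y) \<one> v"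
    using x y
    by (intro fun_cong[OF rep_deriv_cong[OF manifold one_topspace chart_at_one]])
      (simp add: conjugation_def space m_assoc inv_mult_group)
  also have "rep_deriv M c c (conjugation x \<circ> conjugation y) \<one> v =
      rep_deriv M c c (conjugation x) (conjugation y \<one>) (rep_deriv M c c (conjugation y) \<one> v)"
    using x y chart_at_one v
    by (intro rep_deriv_compose[OF manifold manifold mdiff_conjugation mdiff_conjugation one_topspace chart_at_one])
      simp_all
  finally show ?thesis
    using y by (simp add: Ad_def)
qed

text \<open>\<open>Ad\<close> on the model space, extended by the identity on the kernel of
  \<open>P\<close>. So \<open>A\<close> is multiplicative on the ambient space and sends
  \<open>\<one>\<close> to the identity.\<close>

definition A :: "'a \<Rightarrow> 'e \<Rightarrow>\<^sub>L 'e" where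
  "A h = Blinfun (\<lambda>v. Ad h (P v) + (v - P v))"

lemma A_apply:
  assumes "h \<in> carrier G"
  shows "A h v = Ad h (P v) + (v - P v)"
proof -
  have "bounded_linear (\<lambda>v. Ad h (P v) + (v - P v))"
    by (intro bounded_linear_add bounded_linear_sub bounded_linear_ident blinfun.bounded_linear_right
        bounded_linear_compose[OF bounded_linear_Ad[OF assms]])
  then show ?thesis
    by (simp add: A_def bounded_linear_Blinfun_apply)
qed

lemma P_A: "h \<in> carrier G \<Longrightarrow> P (A h v) = Ad h (P v)"
  by (simp add: A_apply blinfun.bilinear_simps P_id[OF Ad_in_model] P_in_model)

lemma A_one: "A \<one> = id_blinfun"
  by (rule blinfun_eqI) (simp add: A_apply Ad_one P_in_model)

lemma A_mult:
  assumes "x \<in> carrier G" "y \<in> carrier G"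
  shows "A (x \<otimes> y) = A x o\<^sub>L A y"
proof (rule blinfun_eqI)
  fix v
  have "A x (A y v) = Ad x (P (A y v)) + (A y v - P (A y v))"
    using assms by (simp add: A_apply[of x])
  also have "\<dots> = Ad x (Ad y (P v)) + (v - P v)"
    using assms by (simp add: P_A) (simp add: A_apply)
  finally show "A (x \<otimes> y) v = (A x o\<^sub>L A y) v"
    using assms by (simp add: A_apply[of "x \<otimes> y"] Ad_mult P_in_model)
qed

section \<open>A parametrization of a neighbourhood of the identity\<close>

definition base :: "'e \<Rightarrow> 'e" where
  "base z = coord \<one> + P z"

text \<open>The inverse chart, recentred so that 0 goes to the identity and made constant along the
  kernel of \<open>P\<close>. The default value \<open>\<one>\<close> keeps \<theta> in the carrier
  everywhere.\<close>

definition \<theta> :: "'e \<Rightarrow> 'a" where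
  "\<theta> z = (if base z \<in> coord ` fst c then chart_inv c (base z) else \<one>)"

lemma base_in_model: "base z \<in> model M"
  unfolding base_def
  by (intro subspace_add[OF subspace_model] P_in_model coord_in_model[OF chart one_in_chart])

lemma continuous_base: "continuous_on UNIV base"
  unfolding base_def[abs_def] by (intro continuous_intros)

lemma open_base_vimage:
  assumes "openin (top_of_set (model M)) S"
  shows "open {z. base z \<in> S}"
proof -
  obtain T where T: "open T" "S = model M \<inter> T"
    using assms by (auto simp: openin_open)
  have "{z. base z \<in> S} = base -` T"
    using T base_in_model by auto
  then show ?thesis
    using open_vimage[OF T(1) continuous_base] by simp
qed

definition dom :: "'e set" where
  "dom = {z. base z \<in> coord ` fst c}"

lemma open_dom: "open dom"
  unfolding dom_def using chart by (intro open_base_vimage) (simp add: is_chart_def)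

lemma zero_in_dom: "0 \<in> dom"
  using one_in_chart by (simp add: dom_def base_def)

lemma \<theta>_in_chart: "z \<in> dom \<Longrightarrow> \<theta> z \<in> fst c"
  by (simp add: dom_def \<theta>_def chart_inv_mem)

lemma coord_\<theta>: "z \<in> dom \<Longrightarrow> coord (\<theta> z) = base z"
  by (simp add: dom_def \<theta>_def coord_chart_inv)

lemma \<theta>_carrier [simp]: "\<theta> z \<in> carrier G"
  unfolding \<theta>_def using chart_carrier[OF chart_inv_mem] by (cases "base z \<in> coord ` fst c") simp_all

lemma \<theta>_coord:
  assumes "x \<in> fst c" "P z = coord x - coord \<one>"
  shows "\<theta> z = x"
  using assms by (simp add: \<theta>_def base_def chart_inv_coord[OF chart])

lemma \<theta>_zero [simp]: "\<theta> 0 = \<one>"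
  by (rule \<theta>_coord[OF one_in_chart]) simp

lemma P_coord_diff: "x \<in> fst c \<Longrightarrow> y \<in> fst c \<Longrightarrow> P (coord x - coord y) = coord x - coord y"
  by (simp add: blinfun.bilinear_simps)

text \<open>Derivatives within the model space become derivatives on the ambient space here:
  \<open>base\<close> takes values in the model space and has derivative \<open>P\<close>.\<close>

lemma has_derivative_coord_\<theta>:
  assumes f: "mdifferentiable M M f" and y: "y \<in> dom" and fy: "f (\<theta> y) \<in> fst c"
  shows "((\<lambda>z. coord (f (\<theta> z))) has_derivative (\<lambda>h. rep_deriv M c c f (\<theta> y) (P h))) (at y)"
proof -
  have "(local_rep c c f has_derivative rep_deriv M c c f (\<theta> y)) (at (base y) within model M)"
    using rep_deriv[OF f _ charts_atI[OF \<theta>_in_chart[OF y]] charts_atI[OF fy]]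
    by (simp add: space coord_\<theta>[OF y])
  then have "(local_rep c c f has_derivative rep_deriv M c c f (\<theta> y)) (at (base y) within range base)"
    by (rule has_derivative_subset) (auto intro: base_in_model)
  moreover have "(base has_derivative P) (at y)"
    using has_derivative_add[OF has_derivative_const bounded_linear_imp_has_derivative[OF blinfun.bounded_linear_right]]
    by (simp add: base_def[abs_def])
  ultimately have *: "((\<lambda>z. local_rep c c f (base z)) has_derivative (\<lambda>h. rep_deriv M c c f (\<theta> y) (P h))) (at y)"
    by (rule has_derivative_in_compose[rotated])
  show ?thesis
  proof (rule has_derivative_transform_within_open[OF * open_dom y])
    fix z assume z: "z \<in> dom"
    show "local_rep c c f (base z) = coord (f (\<theta> z))"
      using local_rep_coord[OF chart \<theta>_in_chart[OF z], of c f] by (simp add: coord_\<theta>[OF z])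
  qed
qed

lemma eventually_in_chart:
  assumes f: "mdifferentiable M M f" and y: "y \<in> dom" and fy: "f (\<theta> y) \<in> fst c"
  shows "\<forall>\<^sub>F z in nhds y. z \<in> dom \<and> f (\<theta> z) \<in> fst c"
proof -
  let ?N = "{z. base z \<in> rep_domain c c f}"
  have "open ?N"
    by (rule open_base_vimage[OF openin_rep_domain[OF chart chart mdifferentiable_continuous[OF f]]])
  moreover have "y \<in> ?N"
    using \<theta>_in_chart[OF y] fy coord_\<theta>[OF y, symmetric] by (auto simp: rep_domain_def)
  ultimately have "\<forall>\<^sub>F z in nhds y. z \<in> ?N"
    by (rule eventually_nhds_in_open)
  then show ?thesis
  proof eventually_elim
    case (elim z)
    then obtain x where x: "x \<in> fst c" "f x \<in> fst c" and z: "base z = coord x"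
      by (auto simp: rep_domain_def)
    then have "z \<in> dom" "\<theta> z = x"
      by (auto simp: dom_def \<theta>_def chart_inv_coord[OF chart])
    then show ?case
      using x by simp
  qed
qed

lemma conjugation_chart:
  assumes x: "x \<in> carrier G"
  shows "\<exists>\<gamma>. (\<gamma> has_derivative A x) (at 0) \<and> \<gamma> 0 = 0 \<and>
    (\<forall>\<^sub>F z in nhds 0. A (\<theta> (\<gamma> z)) = A (x \<otimes> \<theta> z \<otimes> inv x))"
proof -
  \<comment> \<open>The summand z - P z is invisible to \<theta>, but it makes the derivative equal
    to \<open>A x\<close> on the whole ambient space.\<close>
  define \<gamma> where "\<gamma> z = (coord (conjugation x (\<theta> z)) - coord \<one>) + (z - P z)" for z
  have conj1: "conjugation x (\<theta> 0) \<in> fst c"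
    using x one_in_chart by simp
  note D = has_derivative_coord_\<theta>[OF mdiff_conjugation[OF x] zero_in_dom conj1]
  have "((\<lambda>z. (coord (conjugation x (\<theta> z)) - coord \<one>) + (z - P z)) has_derivative
      (\<lambda>h. (rep_deriv M c c (conjugation x) (\<theta> 0) (P h) - 0) + (h - P h))) (at 0)"
    by (intro has_derivative_add has_derivative_diff D has_derivative_const has_derivative_ident
        bounded_linear_imp_has_derivative blinfun.bounded_linear_right)
  moreover have "(\<lambda>h. (rep_deriv M c c (conjugation x) (\<theta> 0) (P h) - 0) + (h - P h)) = A x"
    using x by (simp add: fun_eq_iff A_apply Ad_def)
  ultimately have "(\<gamma> has_derivative A x) (at 0)"
    by (simp add: \<gamma>_def[abs_def])
  moreover have "\<gamma> 0 = 0"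
    using x by (simp add: \<gamma>_def)
  moreover have "\<forall>\<^sub>F z in nhds 0. A (\<theta> (\<gamma> z)) = A (x \<otimes> \<theta> z \<otimes> inv x)"
    using eventually_in_chart[OF mdiff_conjugation[OF x] zero_in_dom conj1]
  proof eventually_elim
    case (elim z)
    then have "\<theta> (\<gamma> z) = conjugation x (\<theta> z)"
      using one_in_chart by (intro \<theta>_coord) (simp_all add: \<gamma>_def blinfun.bilinear_simps)
    then show ?case
      by (simp add: conjugation_def)
  qed
  ultimately show ?thesis
    by blast
qed

text \<open>\<gamma> z is the recentred coordinate vector of \<theta>(z) \<theta>(y)^-1. Its
  derivative may stay unspecified, as it is only ever composed with a derivative that
  vanishes.\<close>

lemma shift_chart:
  "\<exists>d>0. \<forall>y\<in>ball 0 d. \<exists>\<gamma> \<gamma>'. (\<gamma> has_derivative \<gamma>') (at y) \<and> \<gamma> y = 0 \<and>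
    (\<forall>\<^sub>F z in nhds y. A (\<theta> z) = A (\<theta> (\<gamma> z) \<otimes> \<theta> y))"
proof -
  obtain d where d: "d > 0" "ball 0 d \<subseteq> dom"
    using open_dom zero_in_dom open_contains_ball by blast
  have "\<exists>\<gamma> \<gamma>'. (\<gamma> has_derivative \<gamma>') (at y) \<and> \<gamma> y = 0 \<and>
      (\<forall>\<^sub>F z in nhds y. A (\<theta> z) = A (\<theta> (\<gamma> z) \<otimes> \<theta> y))" if "y \<in> ball 0 d" for y
  proof -
    have y: "y \<in> dom"
      using that d by blast
    define f where "f x = x \<otimes> inv (\<theta> y)" for x
    have f: "mdifferentiable M M f"
      unfolding f_def[abs_def] by (rule mdiff_rmult) simp
    have fy: "f (\<theta> y) = \<one>"
      by (simp add: f_def)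
    then have fyc: "f (\<theta> y) \<in> fst c"
      by (simp add: one_in_chart)
    define \<gamma> where "\<gamma> z = coord (f (\<theta> z)) - coord \<one>" for z
    have "\<exists>\<gamma>'. (\<gamma> has_derivative \<gamma>') (at y)"
      using has_derivative_diff[OF has_derivative_coord_\<theta>[OF f y fyc] has_derivative_const]
      unfolding \<gamma>_def[abs_def] by blast
    moreover have "\<gamma> y = 0"
      by (simp add: \<gamma>_def fy)
    moreover have "\<forall>\<^sub>F z in nhds y. A (\<theta> z) = A (\<theta> (\<gamma> z) \<otimes> \<theta> y)"
      using eventually_in_chart[OF f y fyc]
    proof eventually_elim
      case (elim z)
      then have "\<theta> (\<gamma> z) = f (\<theta> z)"
        using one_in_chart by (intro \<theta>_coord) (simp_all add: \<gamma>_def P_coord_diff)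
      then show ?case
        by (simp add: f_def m_assoc)
    qed
    ultimately show ?thesis
      by blast
  qed
  then show ?thesis
    using d(1) by blast
qed

lemma nbhd_chart:
  assumes d: "d > 0"
  shows "\<exists>V. openin (mtop M) V \<and> \<one> \<in> V \<and> V \<subseteq> \<theta> ` ball 0 d"
proof (intro exI conjI)
  let ?V = "{x \<in> topspace (subtopology (mtop M) (fst c)). coord x \<in> ball (coord \<one>) d}"
  have "openin (subtopology (mtop M) (fst c)) ?V"
    by (rule openin_continuous_map_preimage[OF continuous_map_coord[OF chart]]) simp
  moreover have "openin (mtop M) (fst c)"
    using chart by (simp add: is_chart_def)
  ultimately show "openin (mtop M) ?V"
    by (rule openin_trans_full)
  show "\<one> \<in> ?V"
    using d one_in_chart by (simp add: space)
  show "?V \<subseteq> \<theta> ` ball 0 d"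
  proof
    fix x assume "x \<in> ?V"
    then have x: "x \<in> fst c" and dx: "dist (coord \<one>) (coord x) < d"
      by auto
    have "\<theta> (coord x - coord \<one>) = x"
      using x one_in_chart by (intro \<theta>_coord) (simp_all add: P_coord_diff)
    moreover have "coord x - coord \<one> \<in> ball 0 d"
      using dx by (simp add: dist_norm norm_minus_commute)
    ultimately show "x \<in> \<theta> ` ball 0 d"
      by (metis imageI)
  qed
qed

subsection \<open>Differentiability of the adjoint representation\<close>

text \<open>The multiplication in the chart, recentred at 0 and extended through \<open>P\<close>.
  It is thus C^2 on an open set of the ambient product, where second derivatives are
  symmetric.\<close>

definition m :: "'e \<times> 'e \<Rightarrow> 'e" where
  "m q = mult_rep c c c ((coord \<one>, coord \<one>) + (P (fst q), P (snd q)))"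

definition mdom :: "('e \<times> 'e) set" where
  "mdom = {q. (base (fst q), base (snd q)) \<in> mult_dom c c c}"

lemma mdom_iff: "(x, y) \<in> mdom \<longleftrightarrow> x \<in> dom \<and> y \<in> dom \<and> \<theta> x \<otimes> \<theta> y \<in> fst c"
proof
  assume "(x, y) \<in> mdom"
  then obtain u v where uv: "u \<in> fst c" "v \<in> fst c" "u \<otimes> v \<in> fst c"
    and eq: "base x = coord u" "base y = coord v"
    by (auto simp: mdom_def mult_dom_def)
  then have "\<theta> x = u" "\<theta> y = v"
    by (simp_all add: \<theta>_def chart_inv_coord[OF chart])
  then show "x \<in> dom \<and> y \<in> dom \<and> \<theta> x \<otimes> \<theta> y \<in> fst c"
    using uv eq by (simp add: dom_def)
next
  assume xy: "x \<in> dom \<and> y \<in> dom \<and> \<theta> x \<otimes> \<theta> y \<in> fst c"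
  then have "map_prod coord coord (\<theta> x, \<theta> y) \<in> mult_dom c c c"
    unfolding mult_dom_def by (intro imageI) (simp add: \<theta>_in_chart)
  then show "(x, y) \<in> mdom"
    using xy by (simp add: mdom_def coord_\<theta>)
qed

lemma m_apply:
  assumes "x \<in> dom" "y \<in> dom"
  shows "m (x, y) = coord (\<theta> x \<otimes> \<theta> y)"
  using mult_rep_coord[OF chart chart \<theta>_in_chart[OF assms(1)] \<theta>_in_chart[OF assms(2)], of c]
  by (simp add: m_def coord_\<theta> assms base_def)

lemma open_mdom: "open mdom"
proof -
  obtain T where T: "open T" "mult_dom c c c = (model M \<times> model M) \<inter> T"
    using openin_mult_dom[OF chart chart chart] by (auto simp: openin_open)
  have "mdom = (\<lambda>q. (base (fst q), base (snd q))) -` T"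
    using T base_in_model by (auto simp: mdom_def)
  moreover have "continuous_on UNIV (\<lambda>q :: 'e \<times> 'e. (base (fst q), base (snd q)))"
    unfolding base_def by (intro continuous_intros)
  ultimately show ?thesis
    using open_vimage[OF T(1)] by simp
qed

lemma zero_in_mdom: "(0, 0) \<in> mdom"
  by (simp add: mdom_iff zero_in_dom one_in_chart)

lemma m_C2: "Ck_on 2 UNIV mdom m"
  unfolding m_def[abs_def]
proof (rule Ck_on_affine)
  show "mult_dom c c c \<subseteq> model M \<times> model M"
    by (rule openin_imp_subset[OF openin_mult_dom[OF chart chart chart]])
  show "bounded_linear (\<lambda>q :: 'e \<times> 'e. (P (fst q), P (snd q)))"
    by (intro bounded_linear_Pair bounded_linear_compose[OF blinfun.bounded_linear_right]
        bounded_linear_fst bounded_linear_snd)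
  show "(\<lambda>q. (P (fst q), P (snd q))) ` UNIV \<subseteq> model M \<times> model M"
    by (auto simp: P_in_model)
  show "(coord \<one>, coord \<one>) + (P (fst q), P (snd q)) \<in> mult_dom c c c" if "q \<in> mdom" for q
    using that by (simp add: mdom_def base_def)
  show "subspace (model M \<times> model M)"
    by (intro subspace_Times subspace_model)
  show "Ck_on 2 (model M \<times> model M) (mult_dom c c c) (mult_rep c c c)"
    using mult_rep_smooth[OF charts_at_atlas charts_at_atlas charts_at_atlas,
        OF chart_at_one chart_at_one chart_at_one] by (simp add: smooth_on_def)
qed (simp_all add: open_mdom)

abbreviation Dm :: "'e \<times> 'e \<Rightarrow> 'e \<times> 'e \<Rightarrow> 'e" where
  "Dm \<equiv> deriv_at UNIV m"

lemma m_deriv: "q \<in> mdom \<Longrightarrow> (m has_derivative Dm q) (at q)"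
  using m_C2 by (simp add: numeral_2_eq_2 frechet_derivative_works[symmetric])

lemma Dm_deriv: "q \<in> mdom \<Longrightarrow> ((\<lambda>q. Dm q w) has_derivative deriv_at UNIV (\<lambda>q. Dm q w) q) (at q)"
  unfolding frechet_derivative_works[symmetric]
  using m_C2 unfolding numeral_2_eq_2 Ck_on.simps by blast

text \<open>The values of this second derivative on (0, v) and (u, 0) form the bilinear term of the
  multiplication at the identity; antisymmetrizing that term gives the Lie bracket.\<close>

definition D2m :: "'e \<times> 'e \<Rightarrow> 'e \<times> 'e \<Rightarrow> 'e" where
  "D2m u w = deriv_at UNIV (\<lambda>q. Dm q u) (0, 0) w"

lemma D2m_sym: "D2m u w = D2m w u"
  unfolding D2m_def by (rule second_derivative_symmetric[OF open_mdom zero_in_mdom m_C2])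

lemma bounded_linear_D2m: "bounded_linear (D2m u)"
  unfolding D2m_def[abs_def] by (rule has_derivative_bounded_linear[OF Dm_deriv[OF zero_in_mdom]])

lemma Dm_right:
  assumes z: "(0, z) \<in> mdom"
  shows "Dm (0, z) (w, 0) = rep_deriv M c c (\<lambda>x. x \<otimes> \<theta> z) \<one> (P w)"
proof -
  have zd: "z \<in> dom" and fc: "\<one> \<otimes> \<theta> z \<in> fst c"
    using z by (simp_all add: mdom_iff)
  have "((\<lambda>x. m (x, z)) has_derivative (\<lambda>h. Dm (0, z) (h, 0))) (at 0)"
    by (rule has_derivative_compose[of "\<lambda>x. (x, z)", where g = m])
      (auto intro!: derivative_eq_intros m_deriv z)
  moreover have "((\<lambda>x. m (x, z)) has_derivative (\<lambda>h. rep_deriv M c c (\<lambda>x. x \<otimes> \<theta> z) \<one> (P h))) (at 0)"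
  proof (rule has_derivative_transform_within_open[OF _ open_dom zero_in_dom])
    show "((\<lambda>x. coord (\<theta> x \<otimes> \<theta> z)) has_derivative (\<lambda>h. rep_deriv M c c (\<lambda>x. x \<otimes> \<theta> z) \<one> (P h))) (at 0)"
      using has_derivative_coord_\<theta>[OF mdiff_rmult[OF \<theta>_carrier] zero_in_dom, of z] fc by simp
    show "coord (\<theta> x \<otimes> \<theta> z) = m (x, z)" if "x \<in> dom" for x
      using m_apply[OF that zd] by simp
  qed
  ultimately have "(\<lambda>h. Dm (0, z) (h, 0)) = (\<lambda>h. rep_deriv M c c (\<lambda>x. x \<otimes> \<theta> z) \<one> (P h))"
    by (rule has_derivative_unique)
  then show ?thesis
    by meson
qed

lemma Dm_left:
  assumes z: "(z, 0) \<in> mdom"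
  shows "Dm (z, 0) (0, w) = rep_deriv M c c (\<lambda>x. \<theta> z \<otimes> x) \<one> (P w)"
proof -
  have zd: "z \<in> dom" and fc: "\<theta> z \<otimes> \<one> \<in> fst c"
    using z by (simp_all add: mdom_iff)
  have "((\<lambda>x. m (z, x)) has_derivative (\<lambda>h. Dm (z, 0) (0, h))) (at 0)"
    by (rule has_derivative_compose[of "\<lambda>x. (z, x)", where g = m])
      (auto intro!: derivative_eq_intros m_deriv z)
  moreover have "((\<lambda>x. m (z, x)) has_derivative (\<lambda>h. rep_deriv M c c (\<lambda>x. \<theta> z \<otimes> x) \<one> (P h))) (at 0)"
  proof (rule has_derivative_transform_within_open[OF _ open_dom zero_in_dom])
    show "((\<lambda>x. coord (\<theta> z \<otimes> \<theta> x)) has_derivative (\<lambda>h. rep_deriv M c c (\<lambda>x. \<theta> z \<otimes> x) \<one> (P h))) (at 0)"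
      using has_derivative_coord_\<theta>[OF mdiff_lmult[OF \<theta>_carrier] zero_in_dom, of z] fc by simp
    show "coord (\<theta> z \<otimes> \<theta> x) = m (z, x)" if "x \<in> dom" for x
      using m_apply[OF zd that] by simp
  qed
  ultimately have "(\<lambda>h. Dm (z, 0) (0, h)) = (\<lambda>h. rep_deriv M c c (\<lambda>x. \<theta> z \<otimes> x) \<one> (P h))"
    by (rule has_derivative_unique)
  then show ?thesis
    by meson
qed

text \<open>For z near 0 this is, by \<open>Dm_right\<close>, the differential at the identity of
  right translation by \<theta> z, extended by v - P v; \<open>Ld\<close> is the analogue for left
  translation. Their quotient is the adjoint operator.\<close>

definition Rd :: "'e \<Rightarrow> 'e \<Rightarrow>\<^sub>L 'e" where
  "Rd z = Blinfun (\<lambda>v. Dm (0, z) (v, 0) + (v - P v))"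

definition Ld :: "'e \<Rightarrow> 'e \<Rightarrow>\<^sub>L 'e" where
  "Ld z = Blinfun (\<lambda>v. Dm (z, 0) (0, v) + (v - P v))"

lemma bounded_linear_slice:
  "bounded_linear (\<lambda>v :: 'e. (v, 0 :: 'e))" "bounded_linear (\<lambda>v :: 'e. (0 :: 'e, v))"
  by (intro bounded_linear_Pair bounded_linear_ident bounded_linear_zero)+

lemma Rd_apply:
  assumes "(0, z) \<in> mdom"
  shows "Rd z v = Dm (0, z) (v, 0) + (v - P v)"
proof -
  have "bounded_linear (\<lambda>v. Dm (0, z) (v, 0) + (v - P v))"
    by (intro bounded_linear_add bounded_linear_sub bounded_linear_ident blinfun.bounded_linear_right
        bounded_linear_compose[OF has_derivative_bounded_linear[OF m_deriv[OF assms]] bounded_linear_slice(1)])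
  then show ?thesis
    by (simp add: Rd_def bounded_linear_Blinfun_apply)
qed

lemma Ld_apply:
  assumes "(z, 0) \<in> mdom"
  shows "Ld z v = Dm (z, 0) (0, v) + (v - P v)"
proof -
  have "bounded_linear (\<lambda>v. Dm (z, 0) (0, v) + (v - P v))"
    by (intro bounded_linear_add bounded_linear_sub bounded_linear_ident blinfun.bounded_linear_right
        bounded_linear_compose[OF has_derivative_bounded_linear[OF m_deriv[OF assms]] bounded_linear_slice(2)])
  then show ?thesis
    by (simp add: Ld_def bounded_linear_Blinfun_apply)
qed

text \<open>The derivative of \<open>Rd\<close> at 0 in the direction u, written with the second
  derivative of m; \<open>Ldd\<close> plays this role for \<open>Ld\<close>.\<close>

definition Rdd :: "'e \<Rightarrow> 'e \<Rightarrow>\<^sub>L 'e" where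
  "Rdd u = Blinfun (\<lambda>v. D2m (v, 0) (0, u))"

definition Ldd :: "'e \<Rightarrow> 'e \<Rightarrow>\<^sub>L 'e" where
  "Ldd u = Blinfun (\<lambda>v. D2m (0, v) (u, 0))"

text \<open>\<open>D2m\<close> is linear in its second argument, the direction differentiated last;
  symmetry transfers this to the argument v.\<close>

lemma Rdd_apply: "Rdd u v = D2m (v, 0) (0, u)"
proof -
  have "bounded_linear (\<lambda>v. D2m (v, 0) (0, u))"
    unfolding D2m_sym[of "(_, 0)"] by (rule bounded_linear_compose[OF bounded_linear_D2m bounded_linear_slice(1)])
  then show ?thesis
    by (simp add: Rdd_def bounded_linear_Blinfun_apply)
qed

lemma Ldd_apply: "Ldd u v = D2m (0, v) (u, 0)"
proof -
  have "bounded_linear (\<lambda>v. D2m (0, v) (u, 0))"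
    unfolding D2m_sym[of "(0, _)"] by (rule bounded_linear_compose[OF bounded_linear_D2m bounded_linear_slice(2)])
  then show ?thesis
    by (simp add: Ldd_def bounded_linear_Blinfun_apply)
qed

text \<open>Symmetry of the second derivative turns \<open>Ldd u v - Rdd u v\<close> into
  \<open>Ldd u v - Ldd v u\<close>. This is the source of the antisymmetry of the bracket.\<close>

lemma Rdd_eq_Ldd: "Rdd u v = Ldd v u"
  unfolding Rdd_apply Ldd_apply by (rule D2m_sym)

lemma open_slice: "open {z. (0, z) \<in> mdom}" "open {z. (z, 0) \<in> mdom}"
proof -
  have "continuous_on UNIV (\<lambda>z :: 'e. (0 :: 'e, z))" "continuous_on UNIV (\<lambda>z :: 'e. (z, 0 :: 'e))"
    by (intro continuous_intros)+
  from this[THEN open_vimage[OF open_mdom]]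
  show "open {z. (0, z) \<in> mdom}" "open {z. (z, 0) \<in> mdom}"
    by (simp_all add: vimage_def)
qed

lemma Rd_deriv: "(Rd has_derivative Rdd) (at 0)"
proof (rule has_derivative_blinfun_componentwise)
  fix v
  have "((\<lambda>z. Dm (0, z) (v, 0)) has_derivative (\<lambda>h. D2m (v, 0) (0, h))) (at 0)"
    unfolding D2m_def
    by (rule has_derivative_compose[of "\<lambda>z. (0, z)", where g = "\<lambda>q. Dm q (v, 0)"])
      (auto intro!: derivative_eq_intros Dm_deriv zero_in_mdom)
  from has_derivative_add[OF this has_derivative_const[of "v - P v"]]
  have "((\<lambda>z. Dm (0, z) (v, 0) + (v - P v)) has_derivative (\<lambda>h. Rdd h v)) (at 0)"
    by (simp add: Rdd_apply)
  then show "((\<lambda>z. Rd z v) has_derivative (\<lambda>h. Rdd h v)) (at 0)"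
    by (rule has_derivative_transform_within_open[OF _ open_slice(1)]) (simp_all add: zero_in_mdom Rd_apply)
qed

lemma Ld_deriv: "(Ld has_derivative Ldd) (at 0)"
proof (rule has_derivative_blinfun_componentwise)
  fix v
  have "((\<lambda>z. Dm (z, 0) (0, v)) has_derivative (\<lambda>h. D2m (0, v) (h, 0))) (at 0)"
    unfolding D2m_def
    by (rule has_derivative_compose[of "\<lambda>z. (z, 0)", where g = "\<lambda>q. Dm q (0, v)"])
      (auto intro!: derivative_eq_intros Dm_deriv zero_in_mdom)
  from has_derivative_add[OF this has_derivative_const[of "v - P v"]]
  have "((\<lambda>z. Dm (z, 0) (0, v) + (v - P v)) has_derivative (\<lambda>h. Ldd h v)) (at 0)"
    by (simp add: Ldd_apply)
  then show "((\<lambda>z. Ld z v) has_derivative (\<lambda>h. Ldd h v)) (at 0)"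
    by (rule has_derivative_transform_within_open[OF _ open_slice(2)]) (simp_all add: zero_in_mdom Ld_apply)
qed

text \<open>Differentiating \<open>(x y x\<^sup>-\<^sup>1) x = x y\<close> in \<open>y\<close> at the identity.\<close>

lemma Rd_A_eq_Ld:
  assumes z: "(0, z) \<in> mdom" "(z, 0) \<in> mdom"
  shows "Rd z o\<^sub>L A (\<theta> z) = Ld z"
proof (rule blinfun_eqI)
  fix v
  let ?x = "\<theta> z"
  have xc: "?x \<in> fst c"
    using z by (simp add: mdom_iff \<theta>_in_chart)
  have "rep_deriv M c c (\<lambda>y. ?x \<otimes> y) \<one> (P v) =
      rep_deriv M c c ((\<lambda>y. y \<otimes> ?x) \<circ> conjugation ?x) \<one> (P v)"
    by (rule fun_cong[OF rep_deriv_cong[OF manifold one_topspace chart_at_one]])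
      (simp add: conjugation_def space m_assoc)
  also have "rep_deriv M c c ((\<lambda>y. y \<otimes> ?x) \<circ> conjugation ?x) \<one> (P v) =
      rep_deriv M c c (\<lambda>y. y \<otimes> ?x) (conjugation ?x \<one>) (rep_deriv M c c (conjugation ?x) \<one> (P v))"
    using xc charts_atI chart_at_one
    by (intro rep_deriv_compose[OF manifold manifold mdiff_conjugation mdiff_rmult one_topspace chart_at_one])
      (simp_all add: P_in_model)
  finally have chain: "rep_deriv M c c (\<lambda>y. ?x \<otimes> y) \<one> (P v) =
      rep_deriv M c c (\<lambda>y. y \<otimes> ?x) \<one> (Ad ?x (P v))"
    by (simp add: Ad_def)
  have "Rd z (A ?x v) = rep_deriv M c c (\<lambda>y. y \<otimes> ?x) \<one> (Ad ?x (P v)) + (A ?x v - P (A ?x v))"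
    by (simp add: Rd_apply[OF z(1)] Dm_right[OF z(1)] P_A)
  also have "A ?x v - P (A ?x v) = v - P v"
    by (simp add: P_A) (simp add: A_apply)
  finally show "(Rd z o\<^sub>L A ?x) v = Ld z v"
    by (simp add: chain[symmetric] Ld_apply[OF z(2)] Dm_left[OF z(2)])
qed

lemma rep_deriv_identity:
  assumes "\<And>x. x \<in> carrier G \<Longrightarrow> f x = x"
  shows "rep_deriv M c c f \<one> (P v) = P v"
proof -
  have "rep_deriv M c c f \<one> = rep_deriv M c c id \<one>"
    by (rule rep_deriv_cong[OF manifold one_topspace chart_at_one]) (simp add: assms space)
  then show ?thesis
    using rep_deriv_id_same[OF manifold chart_at_one P_in_model] by simp
qed

text \<open>\<open>A\<close> is defined point by point through differentials of conjugations; its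
  dependence on z is read off from the equation \<open>Rd z o\<^sub>L A (\<theta> z) = Ld z\<close>,
  whose coefficients are differentiable at 0.\<close>

lemma A_\<theta>_deriv: "((\<lambda>z. A (\<theta> z)) has_derivative (\<lambda>h. Ldd h - Rdd h)) (at 0)"
proof (rule has_derivative_left_quotient[OF Rd_deriv Ld_deriv])
  show "Rd 0 = id_blinfun" "Ld 0 = id_blinfun"
    by (rule blinfun_eqI; simp add: Rd_apply Ld_apply zero_in_mdom Dm_right Dm_left rep_deriv_identity)+
  show "A (\<theta> 0) = id_blinfun"
    by (simp add: A_one)
  have "\<forall>\<^sub>F z in nhds 0. z \<in> {z. (0, z) \<in> mdom}" "\<forall>\<^sub>F z in nhds 0. z \<in> {z. (z, 0) \<in> mdom}"
    by (rule eventually_nhds_in_open[OF open_slice(1)] eventually_nhds_in_open[OF open_slice(2)];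
        simp add: zero_in_mdom)+
  then show "\<forall>\<^sub>F z in nhds 0. Rd z o\<^sub>L A (\<theta> z) = Ld z"
    by eventually_elim (simp add: Rd_A_eq_Ld)
qed

text \<open>Differentiability at 0 gives continuity at the identity, and A y = A x A (x^-1 y)
  carries it to every x.\<close>

lemma continuous_map_A: "continuous_map (mtop M) euclidean A"
  unfolding continuous_map_def
proof (intro conjI allI impI)
  fix T :: "('e \<Rightarrow>\<^sub>L 'e) set" assume "openin euclidean T"
  then have T: "open T"
    by simp
  show "openin (mtop M) {x \<in> topspace (mtop M). A x \<in> T}"
  proof (subst openin_subopen, intro ballI)
    fix x assume "x \<in> {x \<in> topspace (mtop M). A x \<in> T}"
    then have x: "x \<in> carrier G" and AT: "A x \<in> T"
      by (auto simp: space)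
    have "isCont (\<lambda>z. A x o\<^sub>L A (\<theta> z)) 0"
      by (intro bounded_bilinear.continuous[OF bounded_bilinear_blinfun_compose] continuous_const
          has_derivative_continuous[OF A_\<theta>_deriv])
    moreover have "A x o\<^sub>L A (\<theta> 0) \<in> T"
      using AT by (simp add: A_one)
    ultimately obtain d where d: "d > 0" "\<And>z. dist z 0 < d \<Longrightarrow> A x o\<^sub>L A (\<theta> z) \<in> T"
      using T unfolding continuous_at_open eventually_nhds_metric
      by (metis (no_types, lifting) open_contains_ball mem_ball dist_commute subset_iff)
    obtain V where V: "openin (mtop M) V" "\<one> \<in> V" "V \<subseteq> \<theta> ` ball 0 d"
      using nbhd_chart[OF d(1)] by blast
    let ?N = "{y \<in> topspace (mtop M). inv x \<otimes> y \<in> V}"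
    have "continuous_map (mtop M) (mtop M) (\<lambda>y. inv x \<otimes> y)"
      using x by (intro continuous_map_mult) (simp_all add: space)
    from openin_continuous_map_preimage[OF this V(1)] have "openin (mtop M) ?N" .
    moreover have "x \<in> ?N"
      using x V(2) by (simp add: space)
    moreover have "A y \<in> T" if "y \<in> ?N" for y
    proof -
      obtain z where z: "z \<in> ball 0 d" "inv x \<otimes> y = \<theta> z"
        using \<open>y \<in> ?N\<close> V(3) by auto
      have y: "y \<in> carrier G"
        using that by (simp add: space)
      have "A y = A (x \<otimes> (inv x \<otimes> y))"
        using x y by (simp add: m_assoc[symmetric])
      also have "\<dots> = A x o\<^sub>L A (\<theta> z)"
        using x by (simp add: z(2) A_mult)
      finally show ?thesis
        using d(2)[of z] z(1) by (simp add: dist_commute)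
    qed
    ultimately show "\<exists>N. openin (mtop M) N \<and> x \<in> N \<and> N \<subseteq> {x \<in> topspace (mtop M). A x \<in> T}"
      by (intro exI[of _ ?N]) auto
  qed
qed simp

sublocale adjoint_rep G "mtop M" A \<theta> "\<lambda>h. Ldd h - Rdd h"
proof
  show "A \<one> = id_blinfun"
    by (rule A_one)
  show "A (x \<otimes> y) = A x o\<^sub>L A y" if "x \<in> carrier G" "y \<in> carrier G" for x y
    using that by (rule A_mult)
  show "continuous_map (mtop M) euclidean A"
    by (rule continuous_map_A)
  show "\<exists>V. openin (mtop M) V \<and> \<one> \<in> V \<and> V \<subseteq> \<theta> ` ball 0 d" if "d > 0" for d
    using that by (rule nbhd_chart)
  show "((\<lambda>z. A (\<theta> z)) has_derivative (\<lambda>h. Ldd h - Rdd h)) (at 0)"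
    by (rule A_\<theta>_deriv)
  show "(Ldd u - Rdd u) v = - (Ldd v - Rdd v) u" for u v
    by (simp add: blinfun.bilinear_simps Rdd_eq_Ldd)
  show "\<exists>d>0. \<forall>y\<in>ball 0 d. \<exists>\<gamma> \<gamma>'. (\<gamma> has_derivative \<gamma>') (at y) \<and> \<gamma> y = 0 \<and>
      (\<forall>\<^sub>F z in nhds y. A (\<theta> z) = A (\<theta> (\<gamma> z) \<otimes> \<theta> y))"
    by (rule shift_chart)
qed (simp_all add: conjugation_chart)

end

section \<open>Left-invariant metrics\<close>

locale lie_metric = lie_chart G M c P
  for G :: "('a, 'm) monoid_scheme" (structure) and M :: "('a, 'e::euclidean_space) manifold"
    and c :: "('a, 'e) chart" and P :: "'e \<Rightarrow>\<^sub>L 'e" +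
  fixes g :: "('a, 'e) tensor02"
  assumes metric: "pseudo_riemannian_metric M g" and left_inv: "left_invariant G M g"
begin

definition \<tau> :: "'e \<Rightarrow> ('a, 'e) tangent" where
  "\<tau> v = tangent_of_coord M \<one> c (P v)"

text \<open>The metric on the Lie algebra, pulled back along \<open>P\<close>. It depends on
  \<open>P u\<close> and \<open>P v\<close> only, and \<open>P (A h v) = Ad h (P v)\<close>, so
  invariance under \<open>A\<close> is invariance under \<open>Ad\<close>.\<close>

definition \<beta> :: "'e \<Rightarrow> 'e \<Rightarrow> real" where
  "\<beta> u v = g \<one> (\<tau> u) (\<tau> v)"

lemma \<tau>_tangent: "\<tau> v \<in> tangent_space M \<one>"
  unfolding \<tau>_def
  by (rule tangent_of_coord_in_tangent_space[OF manifold one_topspace chart_at_one P_in_model])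

lemma \<tau>_coord: "u \<in> tangent_space M \<one> \<Longrightarrow> \<tau> (u c) = u"
  using tangent_space_coord[OF _ chart_at_one] tangent_of_coord_coord[OF _ chart_at_one]
  by (simp add: \<tau>_def P_id)

lemma \<tau>_linear: "\<tau> (a *\<^sub>R x + b *\<^sub>R y) = (\<lambda>d. a *\<^sub>R \<tau> x d + b *\<^sub>R \<tau> y d)"
  unfolding \<tau>_def blinfun.bilinear_simps
  by (rule tangent_of_coord_linear[OF manifold one_topspace chart_at_one])

lemma \<beta>_sym: "\<beta> u v = \<beta> v u"
  using metric one_topspace \<tau>_tangent unfolding \<beta>_def pseudo_riemannian_metric_def by blast

lemma \<beta>_linear: "\<beta> (a *\<^sub>R x + b *\<^sub>R y) w = a * \<beta> x w + b * \<beta> y w"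
  using metric one_topspace \<tau>_tangent unfolding \<beta>_def \<tau>_linear pseudo_riemannian_metric_def by blast

lemma bilinear_\<beta>: "bilinear \<beta>"
proof -
  have lin: "linear (\<lambda>u. \<beta> u w)" for w
    using \<beta>_linear[of 1 _ 1 _ w] \<beta>_linear[of _ _ 0 0 w] by (intro linearI) auto
  have "(\<lambda>u. \<beta> u w) = \<beta> w" for w
    by (intro ext) (rule \<beta>_sym)
  then have "linear (\<beta> w)" for w
    using lin[of w] by simp
  with lin show ?thesis
    unfolding bilinear_def by blast
qed

text \<open>A tangent vector at the identity is determined by its coordinate in c, and \<tau> sees
  only the part \<open>P (A h v) = Ad h (P v)\<close>.\<close>

lemma tangent_map_conjugation:
  assumes h: "h \<in> carrier G"
  shows "tangent_map M M (conjugation h) \<one> (\<tau> v) = \<tau> (A h v)"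
proof -
  have "tangent_map M M (conjugation h) \<one> (\<tau> v) \<in> tangent_space M (conjugation h \<one>)"
    by (rule tangent_map_in_tangent_space[OF manifold manifold mdiff_conjugation[OF h] one_topspace \<tau>_tangent])
  then have T: "tangent_map M M (conjugation h) \<one> (\<tau> v) \<in> tangent_space M \<one>"
    using h by simp
  have "tangent_map M M (conjugation h) \<one> (\<tau> v) c = rep_deriv M c c (conjugation h) \<one> (\<tau> v c)"
    using h chart_at_one
    by (intro tangent_map_coord[OF manifold mdiff_conjugation[OF h] one_topspace \<tau>_tangent chart_at_one]) simp
  also have "\<tau> v c = P v"
    unfolding \<tau>_def by (rule tangent_of_coord_same[OF manifold chart_at_one P_in_model])
  finally have "tangent_map M M (conjugation h) \<one> (\<tau> v) c = P (A h v)"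
    using h by (simp add: P_A Ad_def)
  then show ?thesis
    using \<tau>_coord[OF T] by (simp add: \<tau>_def)
qed

section \<open>Isometric right translations and invariance of the form\<close>

lemma left_isometry:
  assumes "h \<in> carrier G" "p \<in> carrier G" "u \<in> tangent_space M p" "v \<in> tangent_space M p"
  shows "g (h \<otimes> p) (tangent_map M M (\<lambda>x. h \<otimes> x) p u) (tangent_map M M (\<lambda>x. h \<otimes> x) p v) = g p u v"
  using left_inv assms unfolding left_invariant_def isometry_def space by blast

lemma tangent_lmult:
  assumes "h \<in> carrier G" "p \<in> carrier G" "u \<in> tangent_space M p"
  shows "tangent_map M M (\<lambda>x. h \<otimes> x) p u \<in> tangent_space M (h \<otimes> p)"
  using tangent_map_in_tangent_space[OF manifold manifold mdiff_lmult[OF assms(1)] _ assms(3)] assms(2)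
  by (simp add: space)

text \<open>Conjugation by h^-1 is left translation by h^-1 followed by right translation by h. Both
  preserve the metric, so the differential of the conjugation preserves it at the identity.\<close>

lemma right_isometry_imp_form_invariant:
  assumes h: "h \<in> carrier G" and iso: "isometry M g (\<lambda>x. x \<otimes> h)"
  shows "\<beta> (A (inv h) u) (A (inv h) v) = \<beta> u v"
proof -
  let ?T = "\<lambda>w. tangent_map M M (\<lambda>x. inv h \<otimes> x) \<one> (\<tau> w)"
  have T: "?T w \<in> tangent_space M (inv h)" for w
    using tangent_lmult[OF _ one_closed \<tau>_tangent, of "inv h"] h by simp
  have conj: "\<tau> (A (inv h) w) = tangent_map M M (\<lambda>x. x \<otimes> h) (inv h) (?T w)" for w
  proof -
    have "tangent_map M M (conjugation (inv h)) \<one> = tangent_map M M ((\<lambda>x. x \<otimes> h) \<circ> (\<lambda>x. inv h \<otimes> x)) \<one>"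
      using h by (intro tangent_map_cong[OF manifold one_topspace]) (simp add: conjugation_def)
    then have "\<tau> (A (inv h) w) = tangent_map M M ((\<lambda>x. x \<otimes> h) \<circ> (\<lambda>x. inv h \<otimes> x)) \<one> (\<tau> w)"
      using h by (simp add: tangent_map_conjugation[symmetric])
    also have "\<dots> = tangent_map M M (\<lambda>x. x \<otimes> h) (inv h \<otimes> \<one>) (?T w)"
      using h by (intro tangent_map_compose[OF manifold manifold manifold mdiff_lmult mdiff_rmult one_topspace \<tau>_tangent]) auto
    finally show ?thesis
      using h by simp
  qed
  \<comment> \<open>The base point is written as h^-1 h because it arises as the image of h^-1 under
    right translation by h.\<close>
  have "\<beta> (A (inv h) u) (A (inv h) v) = g (inv h \<otimes> h) (\<tau> (A (inv h) u)) (\<tau> (A (inv h) v))"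
    using h by (simp add: \<beta>_def)
  also have "\<dots> = g (inv h) (?T u) (?T v)"
  proof -
    have "inv h \<in> topspace (mtop M)"
      using h by (simp add: space)
    then show ?thesis
      unfolding conj using iso T unfolding isometry_def by blast
  qed
  also have "\<dots> = \<beta> u v"
    using left_isometry[of "inv h" \<one>, OF _ _ \<tau>_tangent \<tau>_tangent] h by (simp add: \<beta>_def)
  finally show ?thesis .
qed

text \<open>At p, right translation by h factors into left translation by p^-1, conjugation by h^-1
  and left translation by p h. The first takes p to the identity, where the invariance of \<beta>
  handles the conjugation; left invariance handles the outer factors.\<close>

lemma form_invariant_imp_right_isometry:
  assumes h: "h \<in> carrier G" and inv: "\<And>u v. \<beta> (A (inv h) u) (A (inv h) v) = \<beta> u v"
  shows "isometry M g (\<lambda>x. x \<otimes> h)"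
  unfolding isometry_def
proof (intro conjI ballI)
  show "diffeomorphism M M (\<lambda>x. x \<otimes> h)"
    by (rule diffeomorphism_rmult[OF h])
  fix p u v assume p: "p \<in> topspace (mtop M)" and u: "u \<in> tangent_space M p" and v: "v \<in> tangent_space M p"
  have pG: "p \<in> carrier G"
    using p by (simp add: space)
  let ?L = "\<lambda>w. tangent_map M M (\<lambda>x. inv p \<otimes> x) p w"
  have L: "?L w \<in> tangent_space M \<one>" if "w \<in> tangent_space M p" for w
    using tangent_lmult[OF _ pG that, of "inv p"] pG by simp
  let ?C = "conjugation (inv h)" and ?B = "\<lambda>x. (p \<otimes> h) \<otimes> x"
  have R: "tangent_map M M (\<lambda>x. x \<otimes> h) p w = tangent_map M M ?B \<one> (\<tau> (A (inv h) (?L w c)))"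
    if w: "w \<in> tangent_space M p" for w
  proof -
    have mC: "mdifferentiable M M ?C" and mB: "mdifferentiable M M ?B" and mL: "mdifferentiable M M (\<lambda>x. inv p \<otimes> x)"
      using h pG by (simp_all add: mdiff_conjugation mdiff_lmult)
    have "tangent_map M M (\<lambda>x. x \<otimes> h) p = tangent_map M M ((?B \<circ> ?C) \<circ> (\<lambda>x. inv p \<otimes> x)) p"
    proof (rule tangent_map_cong[OF manifold p])
      fix x assume "x \<in> topspace (mtop M)"
      then have x: "x \<in> carrier G"
        by (simp add: space)
      have "h \<otimes> (inv h \<otimes> (inv p \<otimes> x \<otimes> h)) = inv p \<otimes> x \<otimes> h"
        using h pG x by (simp add: m_assoc[symmetric])
      moreover have "p \<otimes> (inv p \<otimes> x \<otimes> h) = x \<otimes> h"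
        using h pG x by (simp add: m_assoc[symmetric])
      ultimately show "x \<otimes> h = ((?B \<circ> ?C) \<circ> (\<lambda>x. inv p \<otimes> x)) x"
        using h pG x by (simp add: conjugation_def m_assoc)
    qed
    then have "tangent_map M M (\<lambda>x. x \<otimes> h) p w = tangent_map M M (?B \<circ> ?C) (inv p \<otimes> p) (?L w)"
      using tangent_map_compose[OF manifold manifold manifold mL mdifferentiable_compose[OF manifold manifold mC mB] p w]
      by simp
    also have "\<dots> = tangent_map M M ?B (?C \<one>) (tangent_map M M ?C \<one> (?L w))"
      using tangent_map_compose[OF manifold manifold manifold mC mB one_topspace L[OF w]] pG by simp
    also have "tangent_map M M ?C \<one> (?L w) = \<tau> (A (inv h) (?L w c))"
      using tangent_map_conjugation[of "inv h" "?L w c"] h by (simp add: \<tau>_coord[OF L[OF w]])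
    finally show ?thesis
      using h by simp
  qed
  have "g (p \<otimes> h) (tangent_map M M (\<lambda>x. x \<otimes> h) p u) (tangent_map M M (\<lambda>x. x \<otimes> h) p v) =
      g \<one> (\<tau> (A (inv h) (?L u c))) (\<tau> (A (inv h) (?L v c)))"
    unfolding R[OF u] R[OF v]
    using left_isometry[of "p \<otimes> h" \<one>, OF _ _ \<tau>_tangent \<tau>_tangent] h pG by simp
  also have "\<dots> = g \<one> (?L u) (?L v)"
    using inv[of "?L u c" "?L v c"] by (simp add: \<beta>_def \<tau>_coord L u v)
  also have "\<dots> = g p u v"
    using left_isometry[OF _ pG u v, of "inv p"] pG by simp
  finally show "g (p \<otimes> h) (tangent_map M M (\<lambda>x. x \<otimes> h) p u) (tangent_map M M (\<lambda>x. x \<otimes> h) p v) = g p u v" .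
qed

text \<open>The function \<open>x \<mapsto> \<beta>(A(x\<^sup>-\<^sup>1) u, A(x\<^sup>-\<^sup>1) v)\<close> descends to the compact space \<open>G/H\<close>.\<close>

lemma orbit_bounded:
  assumes H: "uniform_subgroup G (mtop M) H" and right: "right_invariant_under G M H g"
  shows "\<exists>K. \<forall>x\<in>carrier G. \<bar>\<beta> (A x u) (A x v)\<bar> \<le> K"
proof -
  have sub: "subgroup H G" and comp: "compact_space (coset_space G (mtop M) H)"
    using H by (simp_all add: uniform_subgroup_def)
  define f where "f x = \<bar>\<beta> (A (inv x) u) (A (inv x) v)\<bar>" for x
  have f_cont: "continuous_map (mtop M) euclideanreal f"
  proof -
    have "bounded_bilinear \<beta>"
      using bilinear_\<beta> by (simp add: bilinear_conv_bounded_bilinear)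
    then have "continuous_on UNIV (\<lambda>a. \<bar>\<beta> (blinfun_apply a u) (blinfun_apply a v)\<bar>)"
      by (intro continuous_intros bounded_bilinear.continuous_on[of \<beta>])
    then have "continuous_map euclidean euclideanreal (\<lambda>a. \<bar>\<beta> (blinfun_apply a u) (blinfun_apply a v)\<bar>)"
      by simp
    from continuous_map_compose[OF continuous_map_compose[OF inv_cont continuous_map_A] this]
    show ?thesis
      by (simp add: f_def[abs_def] o_def)
  qed
  have f_H: "f (x \<otimes> h) = f x" if "x \<in> carrier G" "h \<in> H" for x h
  proof -
    have h: "h \<in> carrier G"
      using subgroup.mem_carrier[OF sub \<open>h \<in> H\<close>] .
    have "isometry M g (\<lambda>x. x \<otimes> h)"
      using right \<open>h \<in> H\<close> by (simp add: right_invariant_under_def)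
    from right_isometry_imp_form_invariant[OF h this] show ?thesis
      using that(1) h by (simp add: f_def inv_mult_group A_mult)
  qed
  \<comment> \<open>The sets f < n are open and unions of left cosets of H, so these images form an
    open cover of G/H.\<close>
  define U where "U n = {x <# H | x. x \<in> carrier G \<and> f x < real n}" for n :: nat
  have U_iff: "x <# H \<in> U n \<longleftrightarrow> f x < real n" if x: "x \<in> carrier G" for x n
  proof
    assume "x <# H \<in> U n"
    then obtain y where y: "y \<in> carrier G" "f y < real n" and eq: "x <# H = y <# H"
      by (auto simp: U_def)
    have "x \<in> y <# H"
      using lcos_self[OF x sub] eq by simp
    then obtain h where "h \<in> H" "x = y \<otimes> h"
      by (auto simp: l_coset_def)
    then show "f x < real n"
      using f_H y by simp
  qed (use x in \<open>auto simp: U_def\<close>)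
  have "openin (coset_space G (mtop M) H) (U n)" for n
  proof -
    have "U n \<subseteq> lcosets H"
      by (auto simp: U_def LCOSETS_def)
    moreover have "openin (mtop M) {x \<in> topspace (mtop M). f x \<in> {..<real n}}"
      by (rule openin_continuous_map_preimage[OF f_cont]) simp
    moreover have "{x \<in> topspace (mtop M). x <# H \<in> U n} = {x \<in> topspace (mtop M). f x \<in> {..<real n}}"
      using U_iff by (auto simp: space)
    ultimately show ?thesis
      by (simp add: openin_coset_space)
  qed
  moreover have "topspace (coset_space G (mtop M) H) \<subseteq> \<Union>(range U)"
  proof
    fix C assume "C \<in> topspace (coset_space G (mtop M) H)"
    then have "C \<in> lcosets H"
      using openin_topspace[of "coset_space G (mtop M) H"] unfolding openin_coset_space by blast
    then obtain x where x: "x \<in> carrier G" "C = x <# H"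
      by (auto simp: LCOSETS_def)
    obtain n :: nat where "f x < real n"
      using reals_Archimedean2 by blast
    then show "C \<in> \<Union>(range U)"
      using U_iff[OF x(1)] x(2) by blast
  qed
  ultimately obtain \<F> where \<F>: "finite \<F>" "\<F> \<subseteq> range U" "topspace (coset_space G (mtop M) H) \<subseteq> \<Union>\<F>"
    using comp unfolding compact_space_alt by (metis (no_types, lifting) imageE)
  obtain N where N: "finite N" "\<F> = U ` N"
    using finite_subset_image[OF \<F>(1,2)] by auto
  have "lcosets H \<subseteq> topspace (coset_space G (mtop M) H)"
  proof (rule openin_subset)
    have "{x \<in> topspace (mtop M). x <# H \<in> lcosets H} = topspace (mtop M)"
      by (auto simp: LCOSETS_def space)
    then show "openin (coset_space G (mtop M) H) (lcosets H)"
      by (simp add: openin_coset_space)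
  qed
  then have cover: "x <# H \<in> \<Union>(U ` N)" if "x \<in> carrier G" for x
    using that \<F>(3) N(2) by (auto simp: LCOSETS_def)
  \<comment> \<open>The sum of the finitely many indices is a convenient upper bound for each of
    them.\<close>
  have "f x \<le> real (\<Sum>N)" if x: "x \<in> carrier G" for x
  proof -
    obtain n where n: "n \<in> N" "f x < real n"
      using cover[OF x] U_iff[OF x] by auto
    then have "n \<le> \<Sum>N"
      using N(1) by (intro member_le_sum[where f = "\<lambda>n. n"]) auto
    then show ?thesis
      using n(2) by linarith
  qed
  then have "\<bar>\<beta> (A x u) (A x v)\<bar> \<le> real (\<Sum>N)" if "x \<in> carrier G" for x
    using that inv_closed[OF that] unfolding f_def by (metis inv_inv)
  then show ?thesis
    by blast
qed

theorem bi_invariant_if_uniform: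
  assumes conn: "connected_space (mtop M)" and solv: "solvable G"
    and H: "uniform_subgroup G (mtop M) H" and right: "right_invariant_under G M H g"
  shows "bi_invariant G M g"
proof -
  interpret adjoint_form G "mtop M" A \<theta> "\<lambda>h. Ldd h - Rdd h" \<beta>
    by unfold_locales (use bilinear_\<beta> orbit_bounded[OF H right] \<beta>_sym conn solv in auto)
  have "isometry M g (\<lambda>x. x \<otimes> h)" if "h \<in> carrier G" for h
    using that form_invariant by (intro form_invariant_imp_right_isometry) auto
  then show ?thesis
    using left_inv by (simp add: bi_invariant_def right_invariant_under_def)
qed

end

theorem corollary1p3:
  fixes G :: "('a, 'm) monoid_scheme"
    and M :: "('a, 'e::euclidean_space) manifold"
    and H :: "'a set"
    and g :: "('a, 'e) tensor02"
  assumes "lie_group G M"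
    and "connected_space (mtop M)"
    and "solvable G"
    and "uniform_subgroup G (mtop M) H"
    and "pseudo_riemannian_metric M g"
    and "left_invariant G M g"
    and "right_invariant_under G M H g"
  shows "bi_invariant G M g"
proof -
  interpret lie G M
    using assms(1) by unfold_locales
  \<comment> \<open>The conclusion mentions neither a chart nor a projection, so any chart at the
    identity and any projection onto the model space will do.\<close>
  obtain c where c: "c \<in> charts_at M \<one>\<^bsub>G\<^esub>"
    using ex_chart_at[OF manifold, of "\<one>\<^bsub>G\<^esub>"] by (auto simp: space)
  obtain P :: "'e \<Rightarrow>\<^sub>L 'e" where P: "\<And>x. P x \<in> model M" "\<And>x. x \<in> model M \<Longrightarrow> P x = x"
    using subspace_projection[OF subspace_model] by metis
  interpret lie_metric G M c P g
    using assms(5,6) c P by unfold_locales auto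
  show ?thesis
    using assms(2,3,4,7) by (rule bi_invariant_if_uniform)
qed

end
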